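(* Let $R$ be a local Noetherian super-ring containing a field, with maximal superideal $\mathfrak{M}=\mathfrak{m}\oplus R_1$, and let $\mathfrak{N}=\mathfrak{n}\oplus\mathfrak{N}_1$ be an $\mathfrak{M}$-primary superideal of $R$. Suppose that there are elements $x_1,\dots,x_d\in R_0$ whose residue classes form a system of parameters of the local ring $\overline{R}=R_0/R_1^2$ and such that $\mathfrak{n}$ is generated by these elements modulo $R_1^2$ (i.e. the ideal $(\mathfrak{n}+R_1^2)/R_1^2$ of $\overline{R}$ is generated by the residue classes of $x_1,\dots,x_d$). Then $$\mathrm{Ksdim}_1(\mathsf{bgr}_{\mathfrak{N}}(R))\le \mathrm{Ksdim}_1(R).$$
   Context: A super-ring is a unital associative $\mathbb{Z}_2$-graded ring $R=R_0\oplus R_1$; all super-rings are super-commutative ($ab=(-1)^{|a||b|}ba$ for homogeneous $a,b$, and $a^2=0$ for odd $a$). Superideals are $\mathbb{Z}_2$-graded ideals $I=I_0\oplus I_1$. Noetherian means the ascending chain condition on superideals. $R$ is local if $R_0$ is local with maximal ideal $\mathfrak{m}$; then $\mathfrak{M}=\mathfrak{m}\oplus R_1$ is its maximal superideal. A superideal $\mathfrak{N}$ is $\mathfrak{M}$-primary if $\mathfrak{n}:=\mathfrak{N}_0$ is an $\mathfrak{m}$-primary ideal of $R_0$. For a super-ring $S$ with $\mathrm{Kdim}(S_0)<\infty$, odd elements $y_1,\dots,y_s\in S_1$ ($s\ge1$) form a system of odd parameters if $\mathrm{Kdim}(S_0/\mathrm{Ann}_{S_0}(y_1\cdots y_s))=\mathrm{Kdim}(S_0)$.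 $\mathrm{Ksdim}_0(S)=\mathrm{Kdim}(S_0)$ and $\mathrm{Ksdim}_1(S)$ is the supremum of lengths of systems of odd parameters of $S$ ($0$ if there are none). For a superideal $I$, put $I_{k,l}=I_0^kI_1^lR$ ($k,l\ge0$, $I_{0,0}=R$); $\mathsf{bgr}_I(R)=\bigoplus_{k,l\ge0}I_{k,l}/(I_{k+1,l}+I_{k,l+1})$, a super-ring with multiplication induced from $R$. *)

theory Defs
  imports
    "HOL-Algebra.Algebra"
    "HOL-Library.Extended_Nat"
    "HOL-Library.Extended_Real"
begin

section \<open>Ideals and dimension of commutative rings\<close>

definition local_ring :: "('a, 'b) ring_scheme \<Rightarrow> 'a set \<Rightarrow> bool" where
  "local_ring A m \<longleftrightarrow> cring A \<and> maximalideal m A \<and> (\<forall>I. maximalideal I A \<longrightarrow> I = m)"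

definition primary_ideal :: "'a set \<Rightarrow> ('a, 'b) ring_scheme \<Rightarrow> bool" where
  "primary_ideal Q A \<longleftrightarrow> ideal Q A \<and> Q \<noteq> carrier A \<and>
     (\<forall>a\<in>carrier A. \<forall>b\<in>carrier A.
        a \<otimes>\<^bsub>A\<^esub> b \<in> Q \<longrightarrow> a \<in> Q \<or> (\<exists>n::nat. b [^]\<^bsub>A\<^esub> n \<in> Q))"

definition ideal_radical :: "('a, 'b) ring_scheme \<Rightarrow> 'a set \<Rightarrow> 'a set" where
  "ideal_radical A I = {a \<in> carrier A. \<exists>n::nat. a [^]\<^bsub>A\<^esub> n \<in> I}"

definition primary_to :: "('a, 'b) ring_scheme \<Rightarrow> 'a set \<Rightarrow> 'a set \<Rightarrow> bool" where
  "primary_to A m Q \<longleftrightarrow> primary_ideal Q A \<and> ideal_radical A Q = m"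

text \<open>The supremum is taken in the extended reals, so that the zero ring, which has no prime
  ideals, has dimension \<open>- \<infinity>\<close>.  With \<open>enat\<close> it would have dimension \<open>0\<close>, and a vanishing product
  of odd elements would count as a system of odd parameters whenever the dimension is \<open>0\<close>.\<close>

definition Kdim :: "('a, 'b) ring_scheme \<Rightarrow> ereal" where
  "Kdim A = Sup {ereal (real n) | n. \<exists>P :: nat \<Rightarrow> 'a set.
     (\<forall>i\<le>n. primeideal (P i) A) \<and> (\<forall>i<n. P i \<subset> P (Suc i))}"

definition system_of_parameters :: "('a, 'b) ring_scheme \<Rightarrow> 'a set \<Rightarrow> 'a list \<Rightarrow> bool" where
  "system_of_parameters A m xs \<longleftrightarrow>
     set xs \<subseteq> carrier A \<and> ereal (real (length xs)) = Kdim A \<and> primary_to A m (Idl\<^bsub>A\<^esub> (set xs))"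


section \<open>Super-rings\<close>

record 'a super_ring = "'a ring" +
  even_part :: "'a set"
  odd_part :: "'a set"

locale super_ring = ring R for R :: "('a, 'b) super_ring_scheme" (structure) +
  assumes even_subgroup: "additive_subgroup (even_part R) R"
    and odd_subgroup: "additive_subgroup (odd_part R) R"
    and parts_sum: "even_part R <+> odd_part R = carrier R"
    and parts_inter: "even_part R \<inter> odd_part R = {\<zero>}"
    and one_even: "\<one> \<in> even_part R"
    and even_even: "\<lbrakk>a \<in> even_part R; b \<in> even_part R\<rbrakk> \<Longrightarrow> a \<otimes> b \<in> even_part R"
    and even_odd: "\<lbrakk>a \<in> even_part R; b \<in> odd_part R\<rbrakk> \<Longrightarrow> a \<otimes> b \<in> odd_part R"
    and odd_even: "\<lbrakk>a \<in> odd_part R; b \<in> even_part R\<rbrakk> \<Longrightarrow> a \<otimes> b \<in> odd_part R"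
    and odd_odd: "\<lbrakk>a \<in> odd_part R; b \<in> odd_part R\<rbrakk> \<Longrightarrow> a \<otimes> b \<in> even_part R"
    and even_comm: "\<lbrakk>a \<in> even_part R; b \<in> even_part R \<union> odd_part R\<rbrakk> \<Longrightarrow> a \<otimes> b = b \<otimes> a"
    and odd_anticomm: "\<lbrakk>a \<in> odd_part R; b \<in> odd_part R\<rbrakk> \<Longrightarrow> a \<otimes> b = \<ominus> (b \<otimes> a)"
    and odd_square: "a \<in> odd_part R \<Longrightarrow> a \<otimes> a = \<zero>"

definition even_ring :: "('a, 'b) super_ring_scheme \<Rightarrow> ('a, 'b) super_ring_scheme" where
  "even_ring R = R\<lparr>carrier := even_part R\<rparr>"

definition superideal :: "'a set \<Rightarrow> ('a, 'b) super_ring_scheme \<Rightarrow> bool" where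
  "superideal I R \<longleftrightarrow>
     ideal I R \<and> I = (I \<inter> even_part R) <+>\<^bsub>R\<^esub> (I \<inter> odd_part R)"

definition noetherian_super_ring :: "('a, 'b) super_ring_scheme \<Rightarrow> bool" where
  "noetherian_super_ring R \<longleftrightarrow> super_ring R \<and>
     (\<forall>I :: nat \<Rightarrow> 'a set. (\<forall>n. superideal (I n) R \<and> I n \<subseteq> I (Suc n)) \<longrightarrow>
        (\<exists>N. \<forall>n\<ge>N. I n = I N))"

definition local_super_ring :: "('a, 'b) super_ring_scheme \<Rightarrow> 'a set \<Rightarrow> bool" where
  "local_super_ring R M \<longleftrightarrow> super_ring R \<and>
     (\<exists>m. local_ring (even_ring R) m \<and> M = m <+>\<^bsub>R\<^esub> odd_part R)"

definition primary_superideal :: "('a, 'b) super_ring_scheme \<Rightarrow> 'a set \<Rightarrow> 'a set \<Rightarrow> bool" where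
  "primary_superideal R M N \<longleftrightarrow> superideal N R \<and>
     primary_to (even_ring R) (M \<inter> even_part R) (N \<inter> even_part R)"

text \<open>\<open>ideal_prod\<close> is the additive span of the pairwise products, so \<open>odd_square_ideal R\<close>
  is the ideal \<open>R\<^sub>1\<^sup>2\<close> of \<open>R\<^sub>0\<close>.\<close>

definition odd_square_ideal :: "('a, 'b) super_ring_scheme \<Rightarrow> 'a set" where
  "odd_square_ideal R = ideal_prod R (odd_part R) (odd_part R)"

definition bar_ring :: "('a, 'b) super_ring_scheme \<Rightarrow> 'a set ring" where
  "bar_ring R = even_ring R Quot odd_square_ideal R"

definition even_residue :: "('a, 'b) super_ring_scheme \<Rightarrow> 'a \<Rightarrow> 'a set" where
  "even_residue R a = odd_square_ideal R +>\<^bsub>even_ring R\<^esub> a"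


section \<open>Odd Krull super-dimension\<close>

definition list_product :: "('a, 'b) ring_scheme \<Rightarrow> 'a list \<Rightarrow> 'a" where
  "list_product R ys = foldr (\<lambda>y z. y \<otimes>\<^bsub>R\<^esub> z) ys \<one>\<^bsub>R\<^esub>"

definition even_annihilator :: "('a, 'b) super_ring_scheme \<Rightarrow> 'a \<Rightarrow> 'a set" where
  "even_annihilator R y = {a \<in> even_part R. a \<otimes>\<^bsub>R\<^esub> y = \<zero>\<^bsub>R\<^esub>}"

definition odd_parameters :: "('a, 'b) super_ring_scheme \<Rightarrow> 'a list \<Rightarrow> bool" where
  "odd_parameters R ys \<longleftrightarrow> ys \<noteq> [] \<and> set ys \<subseteq> odd_part R \<and> Kdim (even_ring R) < \<infinity> \<and>
     Kdim (even_ring R Quot even_annihilator R (list_product R ys)) = Kdim (even_ring R)"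

text \<open>The supremum of the empty set in \<open>enat\<close> is \<open>0\<close>.\<close>

definition Ksdim1 :: "('a, 'b) super_ring_scheme \<Rightarrow> enat" where
  "Ksdim1 R = Sup {enat (length ys) | ys. odd_parameters R ys}"


section \<open>The bigraded super-ring of a superideal\<close>

text \<open>\<open>I\<^sub>0\<^sup>k I\<^sub>1\<^sup>l R\<close>, formed as the iterated additive span \<open>I\<^sub>0 (\<dots> (I\<^sub>0 (I\<^sub>1 (\<dots> (I\<^sub>1 R)))))\<close>.\<close>

definition bipower :: "('a, 'b) super_ring_scheme \<Rightarrow> 'a set \<Rightarrow> nat \<Rightarrow> nat \<Rightarrow> 'a set" where
  "bipower R I k l =
     ((\<lambda>J. ideal_prod R (I \<inter> even_part R) J) ^^ k)
       (((\<lambda>J. ideal_prod R (I \<inter> odd_part R) J) ^^ l) (carrier R))"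

definition bipower_next :: "('a, 'b) super_ring_scheme \<Rightarrow> 'a set \<Rightarrow> nat \<Rightarrow> nat \<Rightarrow> 'a set" where
  "bipower_next R I k l = bipower R I (Suc k) l <+>\<^bsub>R\<^esub> bipower R I k (Suc l)"

text \<open>The families with \<open>f k l\<close> the class of an element of \<open>S \<inter> I\<^sub>k\<^sub>,\<^sub>l\<close> and only finitely many
  nonzero components.\<close>

definition bgr_families ::
  "('a, 'b) super_ring_scheme \<Rightarrow> 'a set \<Rightarrow> 'a set \<Rightarrow> (nat \<Rightarrow> nat \<Rightarrow> 'a set) set" where
  "bgr_families R I S =
     {f. (\<forall>k l. \<exists>a \<in> S \<inter> bipower R I k l. f k l = bipower_next R I k l +>\<^bsub>R\<^esub> a) \<and>
         finite {(k, l). f k l \<noteq> bipower_next R I k l}}"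

text \<open>The component in bidegree \<open>(k, l)\<close> lives in \<open>I\<^sub>k\<^sub>,\<^sub>l / (I\<^sub>k\<^sub>+\<^sub>1\<^sub>,\<^sub>l + I\<^sub>k\<^sub>,\<^sub>l\<^sub>+\<^sub>1)\<close>, which is an ideal
  of \<open>R Quot bipower_next R I k l\<close>; the convolution sums are formed there.  The parity is the one
  inherited from \<open>R\<close>, not the parity of \<open>l\<close>; the two differ in general when \<open>I\<^sub>1 \<noteq> R\<^sub>1\<close>.\<close>

definition bgr :: "('a, 'b) super_ring_scheme \<Rightarrow> 'a set \<Rightarrow> (nat \<Rightarrow> nat \<Rightarrow> 'a set) super_ring" where
  "bgr R I =
     \<lparr>carrier = bgr_families R I (carrier R),
      monoid.mult = (\<lambda>f g k l.
        finsum (R Quot bipower_next R I k l)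
          (\<lambda>(i, j). rcoset_mult R (bipower_next R I k l) (f i j) (g (k - i) (l - j)))
          ({..k} \<times> {..l})),
      monoid.one = (\<lambda>k l. if k = 0 \<and> l = 0 then bipower_next R I 0 0 +>\<^bsub>R\<^esub> \<one>\<^bsub>R\<^esub>
                   else bipower_next R I k l),
      ring.zero = (\<lambda>k l. bipower_next R I k l),
      ring.add = (\<lambda>f g k l. f k l <+>\<^bsub>R\<^esub> g k l),
      even_part = bgr_families R I (even_part R),
      odd_part = bgr_families R I (odd_part R)\<rparr>"

end

theory Submission
  imports Defs
begin

text \<open>Write \<open>A = R\<^sub>0\<close> and \<open>S\<close> for the bigraded ring, and let \<open>d\<close> be the dimension of \<open>A\<close>.  Odd elements with
  product \<open>z\<close> are odd parameters of \<open>R\<close> iff some chain of \<open>d + 1\<close> primes of \<open>A\<close> lies above \<open>Ann z\<close>.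

  Suppose that this fails for all products \<open>z\<close> of \<open>s\<close> odd elements.  Then the length of
  \<open>A / (Ann z + \<nn>\<^sup>t)\<close> is \<open>O(t\<^sup>d\<^sup>-\<^sup>1)\<close>.  If \<open>Y\<close> is a product of \<open>s\<close> odd elements of \<open>S\<close>, then \<open>S\<^sub>0 Y\<close> lies in
  a finite sum of modules \<open>S\<^sub>0 y\<close> with \<open>y\<close> the class of such a \<open>z\<close>, so modulo nilpotents the part of
  \<open>S\<^sub>0 Y\<close> of degree up to \<open>t\<close> also has length \<open>O(t\<^sup>d\<^sup>-\<^sup>1)\<close>.  But a chain of \<open>d + 1\<close> primes of \<open>S\<^sub>0\<close> above
  \<open>Ann Y\<close> would give \<open>T\<^sup>d\<close> independent elements of \<open>S\<^sub>0 Y\<close> in degrees \<open>O(T)\<close>.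

  It remains to see that \<open>S\<^sub>0\<close> has dimension at least \<open>d\<close>.  This holds because the parameters are
  analytically independent: after perturbing the degrees to suitable weights \<open>w\<^sub>i\<close>, Krull's height
  theorem gives a non-maximal prime containing all \<open>x\<^sub>i\<^sup>e - x\<^sub>d\<^sup>w\<^sup>i\<close> with \<open>e = w\<^sub>d\<close>, modulo which a relation
  between initial forms would make a power of \<open>x\<^sub>d\<close> a multiple of the next one.\<close>

section \<open>Lengths of localised modules\<close>

text \<open>Nothing is proved about chain conditions in \<open>S\<close>. Noetherian arguments take
  place in \<open>A\<close> alone, and the two facts about primes of the even ring of
  \<open>S\<close> are obtained from elements: one by counting, the other by an explicit
  multiplicative set that avoids 0. This is why only half of the dimension theorem appears: lengths
  over \<open>A\<close> are bounded above through chains of primes, and the lower bound is supplied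
  by monomials. In the counting, lengths are taken at \<open>m\<close>, but Krull's theorem needs
  them at an arbitrary prime and for ideals without finite length, so lengths are local from the
  start. The perturbed weights are forced by the shape of the relations to be excluded. Such a
  relation has one monomial with coefficient 1 and arbitrary coefficients elsewhere. With equal
  weights all its monomials would tie; with weights that increase lexicographically the
  distinguished monomial is the only one of lowest weight, and the relation becomes a statement
  about that single monomial, which can be compared with a power of the last parameter.\<close>

locale prime_action = P: primeideal P A + M: abelian_group M
  for P :: "'a set" and A :: "('a, 'x) ring_scheme" and M :: "('m, 'y) ring_scheme" +
  fixes act :: "'a \<Rightarrow> 'm \<Rightarrow> 'm" (infixr "\<bullet>" 75)
  assumes act_closed: "\<lbrakk>r \<in> carrier A; x \<in> carrier M\<rbrakk> \<Longrightarrow> r \<bullet> x \<in> carrier M"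
    and act_add_right: "\<lbrakk>r \<in> carrier A; x \<in> carrier M; y \<in> carrier M\<rbrakk> \<Longrightarrow>
      r \<bullet> (x \<oplus>\<^bsub>M\<^esub> y) = r \<bullet> x \<oplus>\<^bsub>M\<^esub> r \<bullet> y"
    and act_add_left: "\<lbrakk>r \<in> carrier A; s \<in> carrier A; x \<in> carrier M\<rbrakk> \<Longrightarrow>
      (r \<oplus>\<^bsub>A\<^esub> s) \<bullet> x = r \<bullet> x \<oplus>\<^bsub>M\<^esub> s \<bullet> x"
    and act_mult: "\<lbrakk>r \<in> carrier A; s \<in> carrier A; x \<in> carrier M\<rbrakk> \<Longrightarrow>
      (r \<otimes>\<^bsub>A\<^esub> s) \<bullet> x = r \<bullet> s \<bullet> x"
    and act_one: "x \<in> carrier M \<Longrightarrow> \<one>\<^bsub>A\<^esub> \<bullet> x = x"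
begin

lemma act_zero_left: "x \<in> carrier M \<Longrightarrow> \<zero>\<^bsub>A\<^esub> \<bullet> x = \<zero>\<^bsub>M\<^esub>"
  using act_add_left[of "\<zero>\<^bsub>A\<^esub>" "\<zero>\<^bsub>A\<^esub>" x] act_closed[of "\<zero>\<^bsub>A\<^esub>" x]
  by (metis M.add.l_cancel_one P.zero_closed P.add.l_one P.add.one_closed)

lemma act_zero_right: "r \<in> carrier A \<Longrightarrow> r \<bullet> \<zero>\<^bsub>M\<^esub> = \<zero>\<^bsub>M\<^esub>"
  using act_add_right[of r "\<zero>\<^bsub>M\<^esub>" "\<zero>\<^bsub>M\<^esub>"] act_closed[of r "\<zero>\<^bsub>M\<^esub>"]
  by (metis M.add.l_cancel_one M.zero_closed M.l_zero)

lemma act_minus_left: "\<lbrakk>r \<in> carrier A; x \<in> carrier M\<rbrakk> \<Longrightarrow> (\<ominus>\<^bsub>A\<^esub> r) \<bullet> x = \<ominus>\<^bsub>M\<^esub> (r \<bullet> x)"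
  using act_add_left[of "\<ominus>\<^bsub>A\<^esub> r" r x] act_closed act_zero_left
  by (metis M.minus_equality P.a_inv_closed P.cring_simprules(3) P.l_neg)

lemma act_comm: "\<lbrakk>r \<in> carrier A; s \<in> carrier A; x \<in> carrier M\<rbrakk> \<Longrightarrow> r \<bullet> s \<bullet> x = s \<bullet> r \<bullet> x"
  using act_mult P.m_comm by metis

definition submod :: "'m set \<Rightarrow> bool" where
  "submod U \<longleftrightarrow> U \<subseteq> carrier M \<and> \<zero>\<^bsub>M\<^esub> \<in> U \<and> (\<forall>x\<in>U. \<forall>y\<in>U. x \<oplus>\<^bsub>M\<^esub> y \<in> U) \<and>
     (\<forall>r\<in>carrier A. \<forall>x\<in>U. r \<bullet> x \<in> U)"

text \<open>The preimage in \<open>M\<close> of the localisation of \<open>U\<close> at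
  \<open>P\<close>. Statements about localised modules become statements about \<open>sat\<close>,
  so that no fractions have to be built.\<close>

definition sat :: "'m set \<Rightarrow> 'm set" where
  "sat U = {x \<in> carrier M. \<exists>s\<in>carrier A - P. s \<bullet> x \<in> U}"

definition adj :: "'m set \<Rightarrow> 'm \<Rightarrow> 'm set" where
  "adj U c = {u \<oplus>\<^bsub>M\<^esub> r \<bullet> c | u r. u \<in> U \<and> r \<in> carrier A}"

lemma submodD:
  assumes "submod U"
  shows "x \<in> U \<Longrightarrow> x \<in> carrier M" "\<zero>\<^bsub>M\<^esub> \<in> U" "\<lbrakk>x \<in> U; y \<in> U\<rbrakk> \<Longrightarrow> x \<oplus>\<^bsub>M\<^esub> y \<in> U"
    "\<lbrakk>r \<in> carrier A; x \<in> U\<rbrakk> \<Longrightarrow> r \<bullet> x \<in> U" "x \<in> U \<Longrightarrow> \<ominus>\<^bsub>M\<^esub> x \<in> U"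
    "\<lbrakk>x \<in> U; y \<in> U\<rbrakk> \<Longrightarrow> x \<ominus>\<^bsub>M\<^esub> y \<in> U"
proof -
  show *: "x \<in> U \<Longrightarrow> x \<in> carrier M" "\<zero>\<^bsub>M\<^esub> \<in> U" "\<lbrakk>x \<in> U; y \<in> U\<rbrakk> \<Longrightarrow> x \<oplus>\<^bsub>M\<^esub> y \<in> U"
    "\<lbrakk>r \<in> carrier A; x \<in> U\<rbrakk> \<Longrightarrow> r \<bullet> x \<in> U" for x y r
    using assms unfolding submod_def by auto
  show neg: "x \<in> U \<Longrightarrow> \<ominus>\<^bsub>M\<^esub> x \<in> U" for x
    using *(1)[of x] *(4)[of "\<ominus>\<^bsub>A\<^esub> \<one>\<^bsub>A\<^esub>" x] act_minus_left[of "\<one>\<^bsub>A\<^esub>" x] act_one[of x] by simp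
  show "\<lbrakk>x \<in> U; y \<in> U\<rbrakk> \<Longrightarrow> x \<ominus>\<^bsub>M\<^esub> y \<in> U"
    using *(3) neg by (simp add: a_minus_def)
qed

lemma mult_not_in_prime:
  "\<lbrakk>s \<in> carrier A - P; t \<in> carrier A - P\<rbrakk> \<Longrightarrow> s \<otimes>\<^bsub>A\<^esub> t \<in> carrier A - P"
  using P.I_prime by auto

lemma one_not_in_prime: "\<one>\<^bsub>A\<^esub> \<in> carrier A - P"
  using P.I_notcarr P.one_imp_carrier by auto

lemma satI: "\<lbrakk>x \<in> carrier M; s \<in> carrier A - P; s \<bullet> x \<in> U\<rbrakk> \<Longrightarrow> x \<in> sat U"
  by (auto simp: sat_def)

lemma sat_superset: "submod U \<Longrightarrow> x \<in> U \<Longrightarrow> x \<in> sat U"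
  using one_not_in_prime by (auto intro!: satI[of x "\<one>\<^bsub>A\<^esub>"] simp: act_one submodD)

lemma submod_sat: assumes "submod U" shows "submod (sat U)"
  unfolding submod_def
proof (intro conjI ballI)
  show "sat U \<subseteq> carrier M" by (auto simp: sat_def)
  show "\<zero>\<^bsub>M\<^esub> \<in> sat U" using assms sat_superset submodD by blast
next
  fix x y assume "x \<in> sat U" "y \<in> sat U"
  then obtain s t where st: "s \<in> carrier A - P" "t \<in> carrier A - P" "s \<bullet> x \<in> U" "t \<bullet> y \<in> U"
    and xy: "x \<in> carrier M" "y \<in> carrier M" by (auto simp: sat_def)
  have "(s \<otimes>\<^bsub>A\<^esub> t) \<bullet> (x \<oplus>\<^bsub>M\<^esub> y) = t \<bullet> s \<bullet> x \<oplus>\<^bsub>M\<^esub> s \<bullet> t \<bullet> y"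
    using st xy act_mult act_comm by (simp add: act_add_right act_closed)
  then have "(s \<otimes>\<^bsub>A\<^esub> t) \<bullet> (x \<oplus>\<^bsub>M\<^esub> y) \<in> U" using st assms submodD by auto
  then show "x \<oplus>\<^bsub>M\<^esub> y \<in> sat U" using satI mult_not_in_prime st(1,2) xy by blast
next
  fix r x assume r: "r \<in> carrier A" and "x \<in> sat U"
  then obtain s where s: "s \<in> carrier A - P" "s \<bullet> x \<in> U" "x \<in> carrier M" by (auto simp: sat_def)
  then have "s \<bullet> r \<bullet> x \<in> U" using act_comm[of s r x] r assms submodD by auto
  then show "r \<bullet> x \<in> sat U" using satI s r act_closed by blast
qed

lemma sat_cancel:
  assumes "s \<in> carrier A - P" "x \<in> carrier M" "s \<bullet> x \<in> sat U"
  shows "x \<in> sat U"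
proof -
  obtain t where "t \<in> carrier A - P" "t \<bullet> s \<bullet> x \<in> U" using assms by (auto simp: sat_def)
  then show ?thesis using assms mult_not_in_prime satI act_mult by (metis Diff_iff)
qed

lemma sat_subset: "\<lbrakk>V \<subseteq> sat U\<rbrakk> \<Longrightarrow> sat V \<subseteq> sat U"
  by (auto simp: sat_def[of V] intro: sat_cancel)

lemma sat_mono: "U \<subseteq> V \<Longrightarrow> sat U \<subseteq> sat V"
  by (auto simp: sat_def)

lemma mem_set_add: "z \<in> U <+>\<^bsub>M\<^esub> V \<longleftrightarrow> (\<exists>x\<in>U. \<exists>y\<in>V. z = x \<oplus>\<^bsub>M\<^esub> y)"
  by (auto simp: set_add_def')

lemma submod_set_add: assumes "submod U" "submod V" shows "submod (U <+>\<^bsub>M\<^esub> V)"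
  unfolding submod_def
proof (intro conjI ballI)
  show "U <+>\<^bsub>M\<^esub> V \<subseteq> carrier M" using assms by (auto simp: mem_set_add submodD)
  have "\<zero>\<^bsub>M\<^esub> = \<zero>\<^bsub>M\<^esub> \<oplus>\<^bsub>M\<^esub> \<zero>\<^bsub>M\<^esub>" by simp
  then show "\<zero>\<^bsub>M\<^esub> \<in> U <+>\<^bsub>M\<^esub> V" using assms submodD(2) unfolding mem_set_add by blast
next
  fix x y assume "x \<in> U <+>\<^bsub>M\<^esub> V" "y \<in> U <+>\<^bsub>M\<^esub> V"
  then obtain a b c d where "a \<in> U" "b \<in> V" "c \<in> U" "d \<in> V" "x = a \<oplus>\<^bsub>M\<^esub> b" "y = c \<oplus>\<^bsub>M\<^esub> d"
    by (auto simp: mem_set_add)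
  moreover from this have "(a \<oplus>\<^bsub>M\<^esub> b) \<oplus>\<^bsub>M\<^esub> (c \<oplus>\<^bsub>M\<^esub> d) = (a \<oplus>\<^bsub>M\<^esub> c) \<oplus>\<^bsub>M\<^esub> (b \<oplus>\<^bsub>M\<^esub> d)"
    using assms by (simp add: submodD M.a_ac)
  ultimately show "x \<oplus>\<^bsub>M\<^esub> y \<in> U <+>\<^bsub>M\<^esub> V" using assms submodD(3) unfolding mem_set_add by metis
next
  fix r x assume "r \<in> carrier A" "x \<in> U <+>\<^bsub>M\<^esub> V"
  then show "r \<bullet> x \<in> U <+>\<^bsub>M\<^esub> V" using assms
    by (auto simp: mem_set_add) (meson act_add_right submodD)
qed

lemma set_add_upper1: "\<lbrakk>submod U; submod V\<rbrakk> \<Longrightarrow> U \<subseteq> U <+>\<^bsub>M\<^esub> V"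
  by (auto simp: mem_set_add) (metis submodD(1,2) M.r_zero)

lemma set_add_upper2: "\<lbrakk>submod U; submod V\<rbrakk> \<Longrightarrow> V \<subseteq> U <+>\<^bsub>M\<^esub> V"
  by (auto simp: mem_set_add) (metis submodD(1,2) M.l_zero)

lemma set_add_least: "\<lbrakk>submod W; U \<subseteq> W; V \<subseteq> W\<rbrakk> \<Longrightarrow> U <+>\<^bsub>M\<^esub> V \<subseteq> W"
  by (auto simp: mem_set_add) (meson subsetD submodD(3))

lemma submod_Int: "\<lbrakk>submod U; submod V\<rbrakk> \<Longrightarrow> submod (U \<inter> V)"
  by (auto simp: submod_def)

lemma submod_multiples: assumes "c \<in> carrier M" shows "submod {r \<bullet> c | r. r \<in> carrier A}"
  unfolding submod_def
proof (intro conjI ballI)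
  show "{r \<bullet> c | r. r \<in> carrier A} \<subseteq> carrier M" using assms act_closed by auto
  show "\<zero>\<^bsub>M\<^esub> \<in> {r \<bullet> c | r. r \<in> carrier A}" using assms act_zero_left[of c] by (metis (mono_tags, lifting) P.zero_closed mem_Collect_eq)
next
  fix x y assume "x \<in> {r \<bullet> c | r. r \<in> carrier A}" "y \<in> {r \<bullet> c | r. r \<in> carrier A}"
  then obtain r s where "r \<in> carrier A" "s \<in> carrier A" "x = r \<bullet> c" "y = s \<bullet> c" by auto
  then have "x \<oplus>\<^bsub>M\<^esub> y = (r \<oplus>\<^bsub>A\<^esub> s) \<bullet> c \<and> r \<oplus>\<^bsub>A\<^esub> s \<in> carrier A" using act_add_left assms by simp
  then show "x \<oplus>\<^bsub>M\<^esub> y \<in> {r \<bullet> c | r. r \<in> carrier A}" by blast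
next
  fix r x assume "r \<in> carrier A" "x \<in> {r \<bullet> c | r. r \<in> carrier A}"
  then obtain s where "r \<in> carrier A" "s \<in> carrier A" "x = s \<bullet> c" by auto
  then have "r \<bullet> x = (r \<otimes>\<^bsub>A\<^esub> s) \<bullet> c \<and> r \<otimes>\<^bsub>A\<^esub> s \<in> carrier A" using act_mult assms by simp
  then show "r \<bullet> x \<in> {r \<bullet> c | r. r \<in> carrier A}" by blast
qed

lemma adj_eq: "adj U c = U <+>\<^bsub>M\<^esub> {r \<bullet> c | r. r \<in> carrier A}"
  unfolding adj_def set_add_def' by blast

lemma submod_adj: "\<lbrakk>submod U; c \<in> carrier M\<rbrakk> \<Longrightarrow> submod (adj U c)"
  by (simp add: adj_eq submod_set_add submod_multiples)

lemma adj_upper: "\<lbrakk>submod U; c \<in> carrier M\<rbrakk> \<Longrightarrow> U \<subseteq> adj U c"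
  by (simp add: adj_eq set_add_upper1 submod_multiples)

lemma adj_self: "\<lbrakk>submod U; c \<in> carrier M\<rbrakk> \<Longrightarrow> c \<in> adj U c"
  unfolding adj_def using act_one[of c] submodD(2)[of U] M.l_zero[of c] P.one_closed by force

lemma adj_least: "\<lbrakk>submod W; U \<subseteq> W; c \<in> W\<rbrakk> \<Longrightarrow> adj U c \<subseteq> W"
  by (auto simp: adj_def) (meson subsetD submodD(3,4))

text \<open>A bound \<open>n\<close> on the length of the localisation of \<open>J / I\<close> at \<open>P\<close>, witnessed by a series
  whose steps are, after localisation, quotients of the residue field.\<close>

inductive lenle :: "'m set \<Rightarrow> 'm set \<Rightarrow> nat \<Rightarrow> bool" where
  base: "\<lbrakk>submod I; submod J; I \<subseteq> J; J \<subseteq> sat I\<rbrakk> \<Longrightarrow> lenle I J 0"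
| step: "\<lbrakk>lenle I J n; submod J'; J \<subseteq> J'; c \<in> J'; \<And>p. p \<in> P \<Longrightarrow> p \<bullet> c \<in> sat J; J' \<subseteq> sat (adj J c)\<rbrakk>
    \<Longrightarrow> lenle I J' (Suc n)"
| weaken: "lenle I J n \<Longrightarrow> lenle I J (Suc n)"

lemma lenle_submod: "lenle I J n \<Longrightarrow> submod I \<and> submod J \<and> I \<subseteq> J"
  by (induction rule: lenle.induct) auto

lemma lenle_mono: assumes "lenle I J n" "n \<le> m" shows "lenle I J m"
  using assms(2,1) by (induction rule: dec_induct) (auto intro: weaken)

lemma lenle_refl: "submod I \<Longrightarrow> lenle I I 0"
  by (auto intro: base sat_superset)

lemma lenle_top:
  assumes "lenle I J n" "submod J'" "J \<subseteq> J'" "J' \<subseteq> sat J"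
  shows "lenle I J' n"
  using assms
proof (induction arbitrary: J' rule: lenle.induct)
  case (base I J)
  have "J' \<subseteq> sat I" using sat_subset[of J I] base by blast
  then show ?case using base by (intro lenle.base) auto
next
  case (step I J n K c)
  have "J' \<subseteq> sat (adj J c)" using sat_subset[OF step.hyps(6)] step.prems(3) by blast
  then show ?case using step by (intro lenle.step[of I J n J' c]) auto
next
  case (weaken I J n)
  then show ?case by (auto intro: lenle.weaken)
qed

lemma lenle_trans: "\<lbrakk>lenle J K m; lenle I J n\<rbrakk> \<Longrightarrow> lenle I K (n + m)"
proof (induction rule: lenle.induct)
  case (base J K)
  then show ?case using lenle_top by auto
next
  case (step J K m K' c)
  then show ?case by (auto intro: lenle.step)
next
  case (weaken J K m)
  then show ?case by (auto intro: lenle.weaken)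
qed

end

text \<open>The series of \<open>J / I\<close> is carried to a quotient of it, because \<phi>
  respects \<open>sat\<close> and sends the generator of each step to a generator. Linearity is
  asked for on \<open>J\<close> only: the maps into the bigraded ring multiply and take a class,
  which is additive only on elements that land in the right degree.\<close>

lemma lenle_map:
  assumes "prime_action P A M act" "prime_action P A M' act'"
  assumes "prime_action.lenle P A M act I J n"
    and "\<And>x. x \<in> J \<Longrightarrow> \<phi> x \<in> carrier M'"
    and "\<And>x y. \<lbrakk>x \<in> J; y \<in> J\<rbrakk> \<Longrightarrow> \<phi> (x \<oplus>\<^bsub>M\<^esub> y) = \<phi> x \<oplus>\<^bsub>M'\<^esub> \<phi> y"
    and "\<And>r x. \<lbrakk>r \<in> carrier A; x \<in> J\<rbrakk> \<Longrightarrow> \<phi> (act r x) = act' r (\<phi> x)"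
    and "prime_action.submod A M' act' I'" "\<phi> ` I \<subseteq> I'"
  shows "prime_action.lenle P A M' act' I' (I' <+>\<^bsub>M'\<^esub> \<phi> ` J) n"
proof -
  interpret M: prime_action P A M act by fact
  interpret N: prime_action P A M' act' by fact
  have sub: "N.submod (\<phi> ` J)"
    if s: "M.submod J" and lin: "\<And>x. x \<in> J \<Longrightarrow> \<phi> x \<in> carrier M'"
      "\<And>x y. \<lbrakk>x \<in> J; y \<in> J\<rbrakk> \<Longrightarrow> \<phi> (x \<oplus>\<^bsub>M\<^esub> y) = \<phi> x \<oplus>\<^bsub>M'\<^esub> \<phi> y"
      "\<And>r x. \<lbrakk>r \<in> carrier A; x \<in> J\<rbrakk> \<Longrightarrow> \<phi> (act r x) = act' r (\<phi> x)" for J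
    unfolding N.submod_def
  proof (intro conjI ballI)
    show "\<phi> ` J \<subseteq> carrier M'" using lin by auto
    have "\<phi> \<zero>\<^bsub>M\<^esub> = \<zero>\<^bsub>M'\<^esub>"
      using lin(3)[of "\<zero>\<^bsub>A\<^esub>" "\<zero>\<^bsub>M\<^esub>"] lin(1) M.submodD(2)[OF s] M.act_zero_left[of "\<zero>\<^bsub>M\<^esub>"] N.act_zero_left by simp
    then show "\<zero>\<^bsub>M'\<^esub> \<in> \<phi> ` J" using M.submodD(2)[OF s] by (metis imageI)
  qed (use M.submodD[OF s] lin in \<open>force simp flip: lin(2,3)\<close>)+
  show ?thesis using assms(3-8)
  proof (induction rule: M.lenle.induct)
    case (base I J)
    have "\<phi> ` J \<subseteq> N.sat I'"
    proof
      fix z assume "z \<in> \<phi> ` J"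
      then obtain x where x: "x \<in> J" "z = \<phi> x" by auto
      then obtain s where s: "s \<in> carrier A - P" "act s x \<in> I" using base by (auto simp: M.sat_def)
      then have "act' s z \<in> I'" using base x by (metis Diff_iff image_subset_iff)
      then show "z \<in> N.sat I'" using N.satI s x base by blast
    qed
    moreover have "N.submod (\<phi> ` J)" using sub base by blast
    ultimately show ?case
      using base(8) N.submod_sat N.sat_superset
      by (intro N.lenle.base N.submod_set_add N.set_add_upper1 N.set_add_least) auto
  next
    case (step I J n J' c)
    have "M.submod J" using M.lenle_submod[OF step.hyps(1)] by blast
    moreover have "N.submod (\<phi> ` J')" using step.hyps(2) step.prems by (intro sub)
    moreover have "N.submod (\<phi> ` J)"
      using step.hyps(3) step.prems by (intro sub \<open>M.submod J\<close>) (simp_all add: subset_iff)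
    ultimately have sJ: "M.submod J" "N.submod (\<phi> ` J)" "N.submod (\<phi> ` J')" by auto
    let ?K = "I' <+>\<^bsub>M'\<^esub> \<phi> ` J" and ?K' = "I' <+>\<^bsub>M'\<^esub> \<phi> ` J'"
    have IH: "N.lenle I' ?K n" using step by blast
    have sK: "N.submod ?K" "N.submod ?K'" using sJ N.submod_set_add step.prems by auto
    have up: "\<phi> ` J \<subseteq> ?K" "\<phi> ` J' \<subseteq> ?K'" "I' \<subseteq> ?K" "I' \<subseteq> ?K'"
      using N.set_add_upper2 N.set_add_upper1 step.prems(4) sJ by blast+
    have cM: "c \<in> carrier M" "\<phi> c \<in> carrier M'" using step M.submodD by auto
    show ?case
    proof (rule N.lenle.step[OF IH sK(2), where c = "\<phi> c"])
      show "?K \<subseteq> ?K'" using step.hyps(3) unfolding set_add_def' by blast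
      show "\<phi> c \<in> ?K'" using up step.hyps by auto
      show "act' p (\<phi> c) \<in> N.sat ?K" if p: "p \<in> P" for p
      proof -
        have pA: "p \<in> carrier A" using p by auto
        obtain s where s: "s \<in> carrier A - P" "act s (act p c) \<in> J"
          using step.hyps(5)[OF p] by (auto simp: M.sat_def)
        have "act' s (act' p (\<phi> c)) = \<phi> (act s (act p c))"
          using s pA step.hyps step.prems M.submodD(4)[OF step.hyps(2)] by simp
        then show ?thesis using s up N.satI[of "act' p (\<phi> c)" s] N.act_closed pA cM by auto
      qed
      show "?K' \<subseteq> N.sat (N.adj ?K (\<phi> c))"
      proof (rule N.set_add_least[OF N.submod_sat[OF N.submod_adj[OF sK(1) cM(2)]]])
        show "I' \<subseteq> N.sat (N.adj ?K (\<phi> c))"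
          using up N.adj_upper[OF sK(1) cM(2)] N.sat_superset[OF N.submod_adj[OF sK(1) cM(2)]] by auto
        show "\<phi> ` J' \<subseteq> N.sat (N.adj ?K (\<phi> c))"
        proof
          fix z assume "z \<in> \<phi> ` J'"
          then obtain x where x: "x \<in> J'" "z = \<phi> x" by auto
          then obtain s u r where s: "s \<in> carrier A - P" "u \<in> J" "r \<in> carrier A"
            "act s x = u \<oplus>\<^bsub>M\<^esub> act r c" using step.hyps(6) by (auto simp: M.sat_def M.adj_def)
          have "act' s z = \<phi> u \<oplus>\<^bsub>M'\<^esub> act' r (\<phi> c)"
          proof -
            have "act' s z = \<phi> (act s x)" using x s step.prems(3)[of s x] by simp
            also have "\<dots> = \<phi> u \<oplus>\<^bsub>M'\<^esub> \<phi> (act r c)"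
              using s step.hyps step.prems(2)[of u "act r c"] M.submodD(4)[OF step.hyps(2)] by auto
            finally show ?thesis using s step.hyps step.prems(3)[of r c] by simp
          qed
          then have "act' s z \<in> N.adj ?K (\<phi> c)" using s up by (auto simp: N.adj_def)
          then show "z \<in> N.sat (N.adj ?K (\<phi> c))" using N.satI s x step.prems(1) by blast
        qed
      qed
    qed
  next
    case (weaken I J n)
    then show ?case by (auto intro: N.lenle.weaken)
  qed
qed

context prime_action
begin

text \<open>\<open>(U + J) / U\<close> is a quotient of \<open>J / I\<close>.\<close>

lemma lenle_add:
  assumes "lenle I J n" "submod U" "I \<subseteq> U"
  shows "lenle U (U <+>\<^bsub>M\<^esub> J) n"
proof -
  have "J \<subseteq> carrier M" using lenle_submod[OF assms(1)] submodD by blast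
  then show ?thesis
    using lenle_map[OF prime_action_axioms prime_action_axioms assms(1), of "\<lambda>x. x" U] assms by auto
qed

text \<open>The series from \<open>I\<close> to \<open>J\<close> is intersected with
  \<open>K\<close> on one side and added to \<open>K\<close> on the other; each of its steps is
  charged to one of the two sides.\<close>

lemma lenle_split:
  assumes "lenle I J n" "submod K" "I \<subseteq> K" "K \<subseteq> J"
  shows "\<exists>n1 n2. n1 + n2 \<le> n \<and> lenle I K n1 \<and> lenle K J n2"
  using assms
proof (induction arbitrary: K rule: lenle.induct)
  case (base I J)
  then have "lenle I K 0" "lenle K J 0"
    using lenle.base[of I K] lenle.base[of K J] sat_mono[of I K] by auto
  then show ?case by force
next
  case (weaken I J n)
  then show ?case by (metis le_Suc_eq)
next
  case (step I J n J' c K)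
  have sI: "submod I" and sJ: "submod J" and IJ: "I \<subseteq> J" using lenle_submod[OF step.hyps(1)] by auto
  have c: "c \<in> carrier M" using step.hyps submodD by auto
  obtain n1 n2 where n: "n1 + n2 \<le> n" and l1: "lenle I (K \<inter> J) n1" and l2: "lenle (K \<inter> J) J n2"
    using step.IH[of "K \<inter> J"] submod_Int[OF step.prems(1) sJ] step.prems(2) IJ by auto
  have sKJ: "submod (K \<inter> J)" using lenle_submod l1 by blast
  let ?KJ = "K <+>\<^bsub>M\<^esub> J"
  have s2: "submod ?KJ" using submod_set_add step.prems(1) sJ by blast
  have KJ': "?KJ \<subseteq> J'" using set_add_least step by auto
  have KKJ: "K \<subseteq> ?KJ" and JKJ: "J \<subseteq> ?KJ" using set_add_upper1 set_add_upper2 step.prems(1) sJ by blast+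
  have l2': "lenle K ?KJ n2" using lenle_add[OF l2 step.prems(1)] by blast
  show ?case
  \<comment> \<open>If \<open>c\<close> lies locally in \<open>K + J\<close>, the step from
    \<open>J\<close> to \<open>J'\<close> is realised inside \<open>K\<close>, and
    \<open>K + J\<close> already equals \<open>J'\<close> locally. Otherwise \<open>K\<close> equals
    \<open>K \<inter> J\<close> locally, and the step is realised above \<open>K\<close>.\<close>
  proof (cases "c \<in> sat ?KJ")
    case True
    then obtain s where s: "s \<in> carrier A - P" "s \<bullet> c \<in> ?KJ" by (auto simp: sat_def)
    then obtain k j where kj: "k \<in> K" "j \<in> J" "s \<bullet> c = k \<oplus>\<^bsub>M\<^esub> j" by (auto simp: mem_set_add)
    have kc: "k \<in> carrier M" "j \<in> carrier M" using kj step.prems sJ submodD by auto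
    \<comment> \<open>Modulo \<open>J\<close> the element \<open>k\<close> is
      \<open>s \<bullet> c\<close> with \<open>s\<close> outside \<open>P\<close>, so it can
      generate the step in place of \<open>c\<close>.\<close>
    have "lenle I K (Suc n1)"
    proof (rule lenle.step[OF l1 step.prems(1) _ kj(1)])
      show "p \<bullet> k \<in> sat (K \<inter> J)" if p: "p \<in> P" for p
      proof -
        have pA: "p \<in> carrier A" using p by auto
        have "p \<bullet> k = p \<bullet> (s \<bullet> c \<ominus>\<^bsub>M\<^esub> j)" using kj kc by (simp add: M.minus_eq M.a_assoc M.r_neg)
        also have "\<dots> = s \<bullet> p \<bullet> c \<oplus>\<^bsub>M\<^esub> p \<bullet> (\<ominus>\<^bsub>M\<^esub> j)"
          using pA s c kc by (simp add: M.minus_eq act_add_right act_closed act_comm)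
        also have "\<dots> \<in> sat J"
        proof (rule submodD(3)[OF submod_sat[OF sJ]])
          show "s \<bullet> p \<bullet> c \<in> sat J" using step.hyps(5)[OF p] s submodD(4)[OF submod_sat[OF sJ]] by blast
          show "p \<bullet> (\<ominus>\<^bsub>M\<^esub> j) \<in> sat J" using sat_superset[OF sJ] submodD(4,5)[OF sJ] pA kj(2) by blast
        qed
        finally obtain t where t: "t \<in> carrier A - P" "t \<bullet> p \<bullet> k \<in> J" by (auto simp: sat_def)
        then have "t \<bullet> p \<bullet> k \<in> K \<inter> J" using step.prems(1) kj pA submodD(4) by auto
        then show ?thesis using satI t pA kc act_closed by blast
      qed
      show "K \<subseteq> sat (adj (K \<inter> J) k)"
      proof
        fix x assume x: "x \<in> K"
        then have xM: "x \<in> carrier M" using step.prems(1) submodD by auto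
        have "x \<in> sat (adj J c)" using x step by auto
        then obtain t u r where t: "t \<in> carrier A - P" and u: "u \<in> J" and r: "r \<in> carrier A"
          and e: "t \<bullet> x = u \<oplus>\<^bsub>M\<^esub> r \<bullet> c" by (auto simp: sat_def adj_def)
        have uM: "u \<in> carrier M" using u sJ submodD by auto
        have st: "s \<otimes>\<^bsub>A\<^esub> t \<in> carrier A - P" using s t mult_not_in_prime by auto
        have "(s \<otimes>\<^bsub>A\<^esub> t) \<bullet> x = s \<bullet> u \<oplus>\<^bsub>M\<^esub> r \<bullet> s \<bullet> c"
          using s t r e xM uM c by (simp add: act_mult act_add_right act_closed act_comm)
        also have "\<dots> = (s \<bullet> u \<oplus>\<^bsub>M\<^esub> r \<bullet> j) \<oplus>\<^bsub>M\<^esub> r \<bullet> k"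
          using kj kc s r uM by (simp add: act_add_right act_closed M.a_ac)
        finally have e2: "(s \<otimes>\<^bsub>A\<^esub> t) \<bullet> x = (s \<bullet> u \<oplus>\<^bsub>M\<^esub> r \<bullet> j) \<oplus>\<^bsub>M\<^esub> r \<bullet> k" .
        have inJ: "s \<bullet> u \<oplus>\<^bsub>M\<^esub> r \<bullet> j \<in> J" using sJ s u r kj submodD(3,4) by auto
        have "s \<bullet> u \<oplus>\<^bsub>M\<^esub> r \<bullet> j = (s \<otimes>\<^bsub>A\<^esub> t) \<bullet> x \<ominus>\<^bsub>M\<^esub> r \<bullet> k"
          using e2 submodD(1)[OF sJ inJ] r kc act_closed by (simp add: M.minus_eq M.a_assoc M.r_neg)
        then have "s \<bullet> u \<oplus>\<^bsub>M\<^esub> r \<bullet> j \<in> K"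
          using st x r kj step.prems(1) submodD(4,6) by (metis Diff_iff)
        then have "(s \<otimes>\<^bsub>A\<^esub> t) \<bullet> x \<in> adj (K \<inter> J) k" using inJ r e2 by (auto simp: adj_def)
        then show "x \<in> sat (adj (K \<inter> J) k)" using satI xM st by blast
      qed
    qed auto
    moreover have "lenle K J' n2"
    proof (rule lenle_top[OF l2' step.hyps(2) KJ'])
      have "adj J c \<subseteq> sat ?KJ" using adj_least[of "sat ?KJ" J c] submod_sat[OF s2] True JKJ
          sat_superset[OF s2] by blast
      then show "J' \<subseteq> sat ?KJ" using step.hyps sat_subset by blast
    qed
    ultimately show ?thesis using n by (intro exI[of _ "Suc n1"] exI[of _ n2]) auto
  next
    case False
    have "K \<subseteq> sat (K \<inter> J)"
    proof
      fix x assume x: "x \<in> K"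
      then have xM: "x \<in> carrier M" using step.prems(1) submodD by auto
      have "x \<in> sat (adj J c)" using x step by auto
      then obtain t u r where t: "t \<in> carrier A - P" and u: "u \<in> J" and r: "r \<in> carrier A"
        and e: "t \<bullet> x = u \<oplus>\<^bsub>M\<^esub> r \<bullet> c" by (auto simp: sat_def adj_def)
      have uM: "u \<in> carrier M" using u sJ submodD by auto
      have tK: "t \<bullet> x \<in> K" using t x step.prems(1) submodD by auto
      \<comment> \<open>With \<open>r\<close> outside \<open>P\<close> the equation \<open>e\<close>
        would put \<open>c\<close> into \<open>sat ?KJ\<close>.\<close>
      have "r \<in> P"
      proof (rule ccontr)
        assume "r \<notin> P"
        moreover have "r \<bullet> c = t \<bullet> x \<oplus>\<^bsub>M\<^esub> \<ominus>\<^bsub>M\<^esub> u"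
          using e uM c r act_closed by (simp add: M.a_ac M.r_neg2)
        then have "r \<bullet> c \<in> ?KJ" using tK u sJ submodD(5) by (auto simp: mem_set_add)
        ultimately show False using False satI c r by blast
      qed
      then have "t \<bullet> x \<in> sat J"
        using e step.hyps(5) submodD(3)[OF submod_sat[OF sJ]] sat_superset[OF sJ u] by auto
      then have "x \<in> sat J" using sat_cancel t xM by blast
      then obtain t' where t': "t' \<in> carrier A - P" "t' \<bullet> x \<in> J" by (auto simp: sat_def)
      then show "x \<in> sat (K \<inter> J)" using satI[OF xM t'(1)] x step.prems(1) submodD(4) by auto
    qed
    then have "lenle I K n1" using lenle_top[OF l1 step.prems(1)] by auto
    moreover have "adj J c \<subseteq> adj ?KJ c" using JKJ unfolding adj_def by blast
    then have "lenle K J' (Suc n2)"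
      using step.hyps sat_mono[OF JKJ] sat_mono[of "adj J c" "adj ?KJ c"]
      by (intro lenle.step[OF l2' step.hyps(2) KJ']) blast+
    ultimately show ?thesis using n by (intro exI[of _ n1] exI[of _ "Suc n2"]) auto
  qed
qed

fun spanl :: "'m set \<Rightarrow> 'm list \<Rightarrow> 'm set" where
  "spanl I [] = I"
| "spanl I (g # gs) = adj (spanl I gs) g"

text \<open>Weaker than linear independence: each entry merely has to enlarge the localised span of
  the entries after it. This is what forces a length of at least one per entry.\<close>

fun indep :: "'m set \<Rightarrow> 'm list \<Rightarrow> bool" where
  "indep I [] = True"
| "indep I (g # gs) \<longleftrightarrow> indep I gs \<and> g \<notin> sat (spanl I gs)"

lemma submod_spanl: "\<lbrakk>submod I; set gs \<subseteq> carrier M\<rbrakk> \<Longrightarrow> submod (spanl I gs)"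
  by (induction gs) (auto intro: submod_adj)

lemma spanl_upper: "\<lbrakk>submod I; set gs \<subseteq> carrier M\<rbrakk> \<Longrightarrow> I \<subseteq> spanl I gs"
  by (induction gs) (use adj_upper submod_spanl in fastforce)+

lemma spanl_least: "\<lbrakk>submod W; I \<subseteq> W; set gs \<subseteq> W\<rbrakk> \<Longrightarrow> spanl I gs \<subseteq> W"
  by (induction gs) (auto simp: adj_least)

lemma indep_length_le:
  "\<lbrakk>lenle I J n; set gs \<subseteq> J; indep I gs\<rbrakk> \<Longrightarrow> length gs \<le> n"
proof (induction gs arbitrary: J n)
  case (Cons g gs)
  have s: "submod I" "submod J" "I \<subseteq> J" using lenle_submod Cons by auto
  have gs: "set gs \<subseteq> carrier M" "g \<in> carrier M" using Cons s submodD by auto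
  have sub: "spanl I gs \<subseteq> J" using spanl_least s Cons by auto
  have up: "set gs \<subseteq> spanl I gs"
    using gs(1)
  proof (induction gs)
    case (Cons a gs)
    then show ?case using adj_self[OF submod_spanl[OF s(1)], of gs a]
        adj_upper[OF submod_spanl[OF s(1)], of gs a] by auto
  qed simp
  obtain n1 n2 where n: "n1 + n2 \<le> n" "lenle I (spanl I gs) n1" "lenle (spanl I gs) J n2"
    using lenle_split[OF Cons.prems(1) submod_spanl[OF s(1) gs(1)] spanl_upper[OF s(1) gs(1)] sub] by auto
  have "length gs \<le> n1" using Cons.IH n up Cons.prems by auto
  moreover have "n2 \<noteq> 0"
  proof
    assume "n2 = 0"
    then have "J \<subseteq> sat (spanl I gs)" using n(3) by (auto elim: lenle.cases)
    then show False using Cons.prems by auto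
  qed
  ultimately show ?case using n by auto
qed simp

end

section \<open>Prime ideals and chains of primes\<close>

lemma (in primeideal) self_action: "prime_action I R R (\<otimes>)"
  by unfold_locales (auto simp: r_distr l_distr m_assoc)

lemma (in ring) idealD:
  assumes "ideal I R"
  shows "x \<in> I \<Longrightarrow> x \<in> carrier R" "\<zero> \<in> I" "\<lbrakk>x \<in> I; y \<in> I\<rbrakk> \<Longrightarrow> x \<oplus> y \<in> I"
    "x \<in> I \<Longrightarrow> \<ominus> x \<in> I" "\<lbrakk>x \<in> I; y \<in> I\<rbrakk> \<Longrightarrow> x \<ominus> y \<in> I"
    "\<lbrakk>x \<in> I; r \<in> carrier R\<rbrakk> \<Longrightarrow> r \<otimes> x \<in> I" "\<lbrakk>x \<in> I; r \<in> carrier R\<rbrakk> \<Longrightarrow> x \<otimes> r \<in> I"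
proof -
  interpret I: ideal I R by fact
  show "x \<in> I \<Longrightarrow> x \<in> carrier R" "\<zero> \<in> I" "\<lbrakk>x \<in> I; y \<in> I\<rbrakk> \<Longrightarrow> x \<oplus> y \<in> I"
    "x \<in> I \<Longrightarrow> \<ominus> x \<in> I" "\<lbrakk>x \<in> I; y \<in> I\<rbrakk> \<Longrightarrow> x \<ominus> y \<in> I"
    "\<lbrakk>x \<in> I; r \<in> carrier R\<rbrakk> \<Longrightarrow> r \<otimes> x \<in> I" "\<lbrakk>x \<in> I; r \<in> carrier R\<rbrakk> \<Longrightarrow> x \<otimes> r \<in> I"
    by (auto simp: I.I_l_closed I.I_r_closed minus_eq)
qed

lemma (in cring) idealI_closed:
  assumes "I \<subseteq> carrier R" "\<zero> \<in> I" "\<And>x y. \<lbrakk>x \<in> I; y \<in> I\<rbrakk> \<Longrightarrow> x \<oplus> y \<in> I"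
    "\<And>x r. \<lbrakk>x \<in> I; r \<in> carrier R\<rbrakk> \<Longrightarrow> r \<otimes> x \<in> I"
  shows "ideal I R"
proof (rule idealI[OF ring_axioms])
  have neg: "\<ominus> x \<in> I" if "x \<in> I" for x
  proof -
    have "x \<in> carrier R" using that assms(1) by blast
    then have "\<ominus> x = (\<ominus> \<one>) \<otimes> x" by (simp add: l_minus)
    then show ?thesis using assms(4)[OF that, of "\<ominus> \<one>"] by simp
  qed
  show "subgroup I (add_monoid R)"
    by (rule subgroup.intro) (use assms(1-3) neg in \<open>simp_all flip: a_inv_def\<close>)
  show l: "x \<otimes> a \<in> I" if "a \<in> I" "x \<in> carrier R" for a x using assms(4) that by blast
  show "a \<otimes> x \<in> I" if "a \<in> I" "x \<in> carrier R" for a x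
    using l[OF that] m_comm[of a x] that subsetD[OF assms(1)] by simp
qed

lemma (in primeideal) self_submod: "prime_action.submod R R (\<otimes>) U \<longleftrightarrow> ideal U R"
proof -
  interpret S: prime_action I R R "(\<otimes>)" by (rule self_action)
  show ?thesis
  proof
    assume U: "S.submod U"
    show "ideal U R" 
    proof (rule idealI_closed)
      show "U \<subseteq> carrier R" by (rule subsetI) (rule S.submodD(1)[OF U])
    qed (rule S.submodD[OF U]; assumption)+
  next
    assume "ideal U R"
    then have "\<And>x. x \<in> U \<Longrightarrow> x \<in> carrier R" "\<zero> \<in> U" "\<And>x y. \<lbrakk>x \<in> U; y \<in> U\<rbrakk> \<Longrightarrow> x \<oplus> y \<in> U"
      "\<And>x r. \<lbrakk>x \<in> U; r \<in> carrier R\<rbrakk> \<Longrightarrow> r \<otimes> x \<in> U" using idealD by metis+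
    then show "S.submod U" unfolding S.submod_def by (intro conjI ballI subsetI)
  qed
qed

context cring
begin

definition colon :: "'a set \<Rightarrow> 'a \<Rightarrow> 'a set" where
  "colon I b = {x \<in> carrier R. x \<otimes> b \<in> I}"

lemma ideal_colon: assumes "ideal I R" "b \<in> carrier R" shows "ideal (colon I b) R"
  using assms idealD[OF assms(1)]
  by (intro idealI_closed) (auto simp: colon_def l_distr m_assoc)

lemma mem_add: "z \<in> U <+>\<^bsub>R\<^esub> V \<longleftrightarrow> (\<exists>x\<in>U. \<exists>y\<in>V. z = x \<oplus> y)"
  by (auto simp: set_add_def')

lemma ideal_sum_upper: assumes "ideal U R" "ideal V R" shows "U \<subseteq> U <+>\<^bsub>R\<^esub> V" "V \<subseteq> U <+>\<^bsub>R\<^esub> V"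
proof -
  interpret U: ideal U R by fact
  interpret V: ideal V R by fact
  show "U \<subseteq> U <+>\<^bsub>R\<^esub> V" unfolding subset_iff mem_add
    using U.Icarr V.zero_closed r_zero by metis
  show "V \<subseteq> U <+>\<^bsub>R\<^esub> V" unfolding subset_iff mem_add
    using V.Icarr U.zero_closed l_zero by metis
qed

lemma ideal_sum_least: assumes "ideal W R" "U \<subseteq> W" "V \<subseteq> W" shows "U <+>\<^bsub>R\<^esub> V \<subseteq> W"
proof -
  interpret W: ideal W R by fact
  show ?thesis using assms(2,3) W.a_closed unfolding set_add_def' by blast
qed

lemma ideal_adj: "\<lbrakk>ideal I R; b \<in> carrier R\<rbrakk> \<Longrightarrow> ideal (I <+>\<^bsub>R\<^esub> PIdl b) R"
  by (simp add: add_ideals cgenideal_ideal)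

lemma PIdl_subset_iff: assumes "ideal I R" "b \<in> carrier R" shows "PIdl b \<subseteq> I \<longleftrightarrow> b \<in> I"
  using assms cgenideal_minimal cgenideal_self by blast

lemma mem_PIdl: "x \<in> PIdl b \<longleftrightarrow> (\<exists>r\<in>carrier R. x = r \<otimes> b)"
  by (auto simp: cgenideal_def)

lemma ideal_adj_psubset:
  assumes "ideal I R" "b \<in> carrier R" "b \<notin> I" shows "I \<subset> I <+>\<^bsub>R\<^esub> PIdl b"
  using ideal_sum_upper[OF assms(1) cgenideal_ideal[OF assms(2)]] cgenideal_self[OF assms(2)] assms(3)
  by blast

text \<open>An ideal maximal among those above \<open>I\<close> and disjoint from \<open>S\<close>
  is prime. It is found by Zorn's lemma rather than by a chain condition, because the even part of
  the bigraded ring is one of the rings to which this is applied.\<close>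

lemma prime_avoiding:
  assumes I: "ideal I R" and S: "S \<subseteq> carrier R" "\<one> \<in> S" "\<And>s t. \<lbrakk>s \<in> S; t \<in> S\<rbrakk> \<Longrightarrow> s \<otimes> t \<in> S"
    and disj: "I \<inter> S = {}"
  shows "\<exists>P. primeideal P R \<and> I \<subseteq> P \<and> P \<inter> S = {}"
proof -
  define F where "F = {J. ideal J R \<and> I \<subseteq> J \<and> J \<inter> S = {}}"
  have IF: "I \<in> F" using I disj by (auto simp: F_def)
  have ch: "\<Union>\<C> \<in> F" if False: "\<C> \<noteq> {}" and \<C>: "subset.chain F \<C>" for \<C>
  proof -
    have CF: "\<C> \<subseteq> F" and lin: "\<And>V W. \<lbrakk>V \<in> \<C>; W \<in> \<C>\<rbrakk> \<Longrightarrow> V \<subseteq> W \<or> W \<subseteq> V"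
      using \<C> by (auto simp: subset_chain_def)
    have id: "V \<in> \<C> \<Longrightarrow> ideal V R" for V using CF by (auto simp: F_def)
    obtain V0 where V0: "V0 \<in> \<C>" using False by auto
    have "ideal (\<Union>\<C>) R"
    proof (rule idealI_closed)
      show "\<Union>\<C> \<subseteq> carrier R" using idealD(1)[OF id] by blast
      show "\<zero> \<in> \<Union>\<C>" using idealD(2)[OF id] V0 by blast
      show "x \<oplus> y \<in> \<Union>\<C>" if xy: "x \<in> \<Union>\<C>" "y \<in> \<Union>\<C>" for x y
      proof -
        obtain V W where "V \<in> \<C>" "x \<in> V" "W \<in> \<C>" "y \<in> W" using xy by blast
        then obtain V where "V \<in> \<C>" "x \<in> V" "y \<in> V" using lin by blast
        then show ?thesis using idealD(3)[OF id] by blast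
      qed
      show "r \<otimes> x \<in> \<Union>\<C>" if "x \<in> \<Union>\<C>" "r \<in> carrier R" for x r
        using idealD(6)[OF id] that by blast
    qed
    then show ?thesis using False CF by (auto simp: F_def)
  qed
  then obtain P where P: "P \<in> F" and max: "\<And>V. V \<in> F \<Longrightarrow> P \<subseteq> V \<Longrightarrow> V = P"
    using subset_Zorn_nonempty[of F, OF _ ch] IF by blast
  have idP: "ideal P R" and IP: "I \<subseteq> P" and dP: "P \<inter> S = {}" using P by (auto simp: F_def)
  have hit: "\<exists>s\<in>S. \<exists>p\<in>P. \<exists>r\<in>carrier R. s = p \<oplus> r \<otimes> a" if a: "a \<in> carrier R" "a \<notin> P" for a
  proof -
    have "P \<subset> P <+>\<^bsub>R\<^esub> PIdl a" using ideal_adj_psubset[OF idP a] .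
    moreover have "ideal (P <+>\<^bsub>R\<^esub> PIdl a) R" using ideal_adj[OF idP a(1)] .
    ultimately have "(P <+>\<^bsub>R\<^esub> PIdl a) \<inter> S \<noteq> {}" using max[of "P <+>\<^bsub>R\<^esub> PIdl a"] IP by (auto simp: F_def)
    then obtain s where s: "s \<in> S" "s \<in> P <+>\<^bsub>R\<^esub> PIdl a" by blast
    then obtain p z where pz: "p \<in> P" "z \<in> PIdl a" "s = p \<oplus> z" using mem_add by metis
    then obtain r where "r \<in> carrier R" "z = r \<otimes> a" using mem_PIdl by metis
    then show ?thesis using s(1) pz by metis
  qed
  have "primeideal P R"
  proof (rule primeidealI[OF idP cring_axioms])
    show "carrier R \<noteq> P" using dP S(2) by auto
  next
    fix a b assume ab: "a \<in> carrier R" "b \<in> carrier R" "a \<otimes> b \<in> P"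
    show "a \<in> P \<or> b \<in> P"
    proof (rule ccontr)
      assume "\<not> (a \<in> P \<or> b \<in> P)"
      then obtain s p r t q u where *: "s \<in> S" "p \<in> P" "r \<in> carrier R" "s = p \<oplus> r \<otimes> a"
        "t \<in> S" "q \<in> P" "u \<in> carrier R" "t = q \<oplus> u \<otimes> b" using hit ab by meson
      have c: "p \<in> carrier R" "q \<in> carrier R" using * idealD(1)[OF idP] by auto
      have "s \<otimes> t = p \<otimes> t \<oplus> (r \<otimes> a) \<otimes> q \<oplus> (r \<otimes> u) \<otimes> (a \<otimes> b)"
        unfolding *(4,8) using c * ab by algebra
      moreover have "p \<otimes> t \<in> P" "(r \<otimes> a) \<otimes> q \<in> P" "(r \<otimes> u) \<otimes> (a \<otimes> b) \<in> P"
        using * ab S idealD(6,7)[OF idP] by auto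
      ultimately have "s \<otimes> t \<in> P" using idealD(3)[OF idP] by simp
      then show False using S(3) * dP by auto
    qed
  qed
  then show ?thesis using IP dP by auto
qed

end

section \<open>Chains of primes and Krull dimension\<close>

definition prime_chain :: "('a, 'b) ring_scheme \<Rightarrow> nat \<Rightarrow> (nat \<Rightarrow> 'a set) \<Rightarrow> bool" where
  "prime_chain A n Q \<longleftrightarrow> (\<forall>i\<le>n. primeideal (Q i) A) \<and> (\<forall>i<n. Q i \<subset> Q (Suc i))"

definition has_chain :: "('a, 'b) ring_scheme \<Rightarrow> 'a set \<Rightarrow> nat \<Rightarrow> bool" where
  "has_chain A I n \<longleftrightarrow> (\<exists>Q. prime_chain A n Q \<and> I \<subseteq> Q 0)"

text \<open>The same chains, peeled from the smallest prime, which suits the count of independent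
  elements; \<open>chain_to\<close> peels from the largest prime, as Krull's height theorem
  does.\<close>

fun chain_from :: "('a, 'b) ring_scheme \<Rightarrow> nat \<Rightarrow> 'a set \<Rightarrow> bool" where
  "chain_from A 0 P = primeideal P A"
| "chain_from A (Suc n) P \<longleftrightarrow> primeideal P A \<and> (\<exists>Q. P \<subset> Q \<and> chain_from A n Q)"

fun chain_to :: "('a, 'b) ring_scheme \<Rightarrow> 'a set \<Rightarrow> nat \<Rightarrow> 'a set \<Rightarrow> bool" where
  "chain_to A I 0 P \<longleftrightarrow> primeideal P A \<and> I \<subseteq> P"
| "chain_to A I (Suc n) P \<longleftrightarrow> primeideal P A \<and> (\<exists>Q. Q \<subset> P \<and> chain_to A I n Q)"

lemma chain_from_prime: "chain_from A n P \<Longrightarrow> primeideal P A"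
  by (cases n) auto

lemma chain_to_prime: "chain_to A I n P \<Longrightarrow> primeideal P A"
  by (cases n) auto

lemma chain_from_iff: "chain_from A n P \<longleftrightarrow> (\<exists>Q. prime_chain A n Q \<and> Q 0 = P)"
proof (induction n arbitrary: P)
  case 0
  show ?case by (auto simp: prime_chain_def intro: exI[of _ "\<lambda>_. P"])
next
  case (Suc n)
  show ?case
  proof
    assume "chain_from A (Suc n) P"
    then obtain Q where Q: "primeideal P A" "prime_chain A n Q" "P \<subset> Q 0" using Suc by auto
    then have "prime_chain A (Suc n) (case_nat P Q)"
      unfolding prime_chain_def by (simp add: All_less_Suc2 split: nat.split)
    then show "\<exists>Q. prime_chain A (Suc n) Q \<and> Q 0 = P" by (intro exI[of _ "case_nat P Q"]) auto
  next
    assume "\<exists>Q. prime_chain A (Suc n) Q \<and> Q 0 = P"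
    then obtain Q where Q: "prime_chain A (Suc n) Q" "Q 0 = P" by auto
    then have "prime_chain A n (\<lambda>i. Q (Suc i))" by (auto simp: prime_chain_def)
    then have "chain_from A n (Q (Suc 0))" using Suc by blast
    moreover have "primeideal P A" "P \<subset> Q (Suc 0)" using Q unfolding prime_chain_def by blast+
    ultimately show "chain_from A (Suc n) P" by auto
  qed
qed

lemma has_chain_from: "has_chain A I n \<longleftrightarrow> (\<exists>P. I \<subseteq> P \<and> chain_from A n P)"
  unfolding has_chain_def chain_from_iff by blast

lemma has_chain_imp_to: "prime_chain A n Q \<Longrightarrow> I \<subseteq> Q 0 \<Longrightarrow> chain_to A I n (Q n)"
proof (induction n)
  case (Suc n)
  then have "prime_chain A n Q" "primeideal (Q (Suc n)) A" "Q n \<subset> Q (Suc n)"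
    unfolding prime_chain_def by simp_all
  then show ?case using Suc by auto
qed (auto simp: prime_chain_def)

lemma has_chain_mono: "\<lbrakk>has_chain A J n; I \<subseteq> J; m \<le> n\<rbrakk> \<Longrightarrow> has_chain A I m"
  unfolding has_chain_def prime_chain_def by (meson dual_order.trans order_less_le_trans)

lemma has_chain_Suc:
  assumes "primeideal P A" "has_chain A J n" "P \<subset> J" shows "has_chain A P (Suc n)"
  using assms unfolding has_chain_from by (meson chain_from.simps(2) order.refl psubset_subset_trans)

lemma Kdim_eq: "Kdim A = Sup {ereal (real n) | n. has_chain A {} n}"
  by (simp add: Kdim_def has_chain_def prime_chain_def)

lemma Kdim_ge_iff: "ereal (real n) \<le> Kdim A \<longleftrightarrow> has_chain A {} n"
proof
  assume "has_chain A {} n"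
  then show "ereal (real n) \<le> Kdim A" unfolding Kdim_eq by (intro Sup_upper) auto
next
  assume "ereal (real n) \<le> Kdim A"
  \<comment> \<open>Half a step below \<open>n\<close> the inequality is strict, so some member of
    the set exceeds \<open>n - 1/2\<close> and, being an integer, is at least \<open>n\<close>. An
    infinite supremum is covered too.\<close>
  moreover have "ereal (real n - 1/2) < ereal (real n)" by simp
  ultimately have "ereal (real n - 1/2) < Kdim A" by (rule order.strict_trans2[rotated])
  then obtain m where m: "has_chain A {} m" "real n - 1/2 < real m"
    unfolding Kdim_eq less_Sup_iff by auto
  then have "n \<le> m" by linarith
  then show "has_chain A {} n" using m(1) has_chain_mono by blast
qed

lemma Kdim_le: "(\<And>n. has_chain A {} n \<Longrightarrow> n \<le> d) \<Longrightarrow> Kdim A \<le> ereal (real d)"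
  unfolding Kdim_eq by (rule Sup_least) auto

lemma (in ring) carrier_Quot: "carrier (R Quot I) = (+>) I ` carrier R"
  unfolding FactRing_def A_RCOSETS_def' a_r_coset_def' by auto

lemma (in cring) prime_Quot:
  assumes "ideal I R"
  shows "primeideal P (R Quot I) \<Longrightarrow> primeideal {x \<in> carrier R. I +> x \<in> P} R"
    and "\<lbrakk>primeideal Q R; I \<subseteq> Q\<rbrakk> \<Longrightarrow> primeideal ((+>) I ` Q) (R Quot I)"
    and "\<lbrakk>ideal Q R; I \<subseteq> Q; x \<in> carrier R\<rbrakk> \<Longrightarrow> I +> x \<in> (+>) I ` Q \<longleftrightarrow> x \<in> Q"
proof -
  interpret I: ideal I R by fact
  interpret h: ring_hom_cring R "R Quot I" "(+>) I" by (rule I.rcos_ring_hom_cring[OF cring_axioms])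
  have surj: "carrier (R Quot I) = (+>) I ` carrier R" by (rule carrier_Quot)
  show mem: "I +> x \<in> (+>) I ` Q \<longleftrightarrow> x \<in> Q" if "ideal Q R" "I \<subseteq> Q" "x \<in> carrier R" for x Q
  proof
    interpret Q: ideal Q R by fact
    assume "I +> x \<in> (+>) I ` Q"
    then obtain q where q: "q \<in> Q" "I +> x = I +> q" by auto
    then have "x \<ominus> q \<in> I" using that Q.Icarr quotient_eq_iff_same_a_r_cos[OF assms] by blast
    then have "x \<ominus> q \<oplus> q \<in> Q" using q that(2) by auto
    then show "x \<in> Q" using Q.Icarr q that by (simp add: minus_eq a_assoc l_neg)
  qed auto
  show "primeideal {x \<in> carrier R. I +> x \<in> P} R" if "primeideal P (R Quot I)"
  proof -
    interpret P: primeideal P "R Quot I" by fact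
    have "ideal {x \<in> carrier R. I +> x \<in> P} R"
      using h.S.idealD[OF P.is_ideal] h.hom_zero by (intro idealI_closed) auto
    moreover have "{x \<in> carrier R. I +> x \<in> P} \<noteq> carrier R"
    proof
      assume "{x \<in> carrier R. I +> x \<in> P} = carrier R"
      then have "carrier (R Quot I) \<subseteq> P" using surj by auto
      then show False using P.I_notcarr P.a_subset by blast
    qed
    ultimately show ?thesis
      using P.I_prime by (intro primeidealI[OF _ cring_axioms]) auto
  qed
  show "primeideal ((+>) I ` Q) (R Quot I)" if Q: "primeideal Q R" "I \<subseteq> Q"
  proof -
    interpret Q: primeideal Q R by fact
    have idl: "ideal ((+>) I ` Q) (R Quot I)"
      using ring_ideal_imp_quot_ideal[OF assms Q.is_ideal] by simp
    show ?thesis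
    proof (rule primeidealI[OF idl h.S.cring_axioms])
      show "carrier (R Quot I) \<noteq> (+>) I ` Q"
        using mem[OF Q.is_ideal Q(2)] Q.I_notcarr Q.a_subset surj by blast
    next
      fix a b assume ab: "a \<in> carrier (R Quot I)" "b \<in> carrier (R Quot I)"
        and m: "a \<otimes>\<^bsub>R Quot I\<^esub> b \<in> (+>) I ` Q"
      then obtain x y where xy: "x \<in> carrier R" "y \<in> carrier R" "a = I +> x" "b = I +> y"
        using surj by auto
      then have "I +> (x \<otimes> y) \<in> (+>) I ` Q" using m by simp
      then have "x \<otimes> y \<in> Q" using mem[OF Q.is_ideal Q(2) m_closed[OF xy(1,2)]] by blast
      then show "a \<in> (+>) I ` Q \<or> b \<in> (+>) I ` Q" using Q.I_prime xy by blast
    qed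
  qed
qed

text \<open>Image and preimage under the quotient map match the primes of the quotient with the
  primes above \<open>I\<close>.\<close>

lemma (in cring) has_chain_Quot:
  assumes "ideal I R"
  shows "has_chain (R Quot I) {} n \<longleftrightarrow> has_chain R I n"
proof
  interpret I: ideal I R by fact
  assume "has_chain (R Quot I) {} n"
  then obtain Q where Q: "prime_chain (R Quot I) n Q" by (auto simp: has_chain_def)
  define Q' where "Q' i = {x \<in> carrier R. I +> x \<in> Q i}" for i
  have surj: "carrier (R Quot I) = (+>) I ` carrier R" by (rule carrier_Quot)
  have pr: "primeideal (Q i) (R Quot I)" if "i \<le> n" for i using Q that by (auto simp: prime_chain_def)
  have "Q' i \<subset> Q' (Suc i)" if i: "i < n" for i
  proof -
    have "Q i \<subset> Q (Suc i)" using Q i by (auto simp: prime_chain_def)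
    moreover have "Q (Suc i) \<subseteq> carrier (R Quot I)"
      using pr[of "Suc i"] i by (meson Suc_leI additive_subgroup.a_subset ideal.axioms(1) primeideal.axioms(1))
    ultimately obtain z where z: "z \<in> Q (Suc i)" "z \<notin> Q i" "z \<in> carrier (R Quot I)" by blast
    then obtain x where "x \<in> carrier R" "I +> x \<in> Q (Suc i)" "I +> x \<notin> Q i"
      unfolding surj by (auto elim: imageE)
    then show ?thesis using \<open>Q i \<subset> Q (Suc i)\<close> by (auto simp: Q'_def)
  qed
  moreover have "I \<subseteq> Q' 0"
  proof
    fix x assume "x \<in> I"
    moreover have "\<zero>\<^bsub>R Quot I\<^esub> \<in> Q 0"
      using pr[of 0] by (simp add: additive_subgroup.zero_closed ideal.axioms(1) primeideal.axioms(1))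
    ultimately show "x \<in> Q' 0" using I.a_rcos_const by (auto simp: Q'_def FactRing_def)
  qed
  moreover have "primeideal (Q' i) R" if "i \<le> n" for i
    using prime_Quot(1)[OF assms pr[OF that]] by (simp add: Q'_def)
  ultimately show "has_chain R I n"
    unfolding has_chain_def prime_chain_def by (intro exI[of _ Q']) simp
next
  assume "has_chain R I n"
  then obtain Q where Q: "prime_chain R n Q" "I \<subseteq> Q 0" by (auto simp: has_chain_def)
  have sub: "I \<subseteq> Q i" if "i \<le> n" for i
    using that
  proof (induction i)
    case (Suc i)
    moreover have "Q i \<subset> Q (Suc i)" using Q(1) Suc.prems by (simp add: prime_chain_def)
    ultimately show ?case by (meson Suc_leD psubset_imp_subset subset_trans)
  qed (use Q in auto)
  have pr: "primeideal (Q i) R" if "i \<le> n" for i using Q that by (auto simp: prime_chain_def)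
  have "(+>) I ` Q i \<subset> (+>) I ` Q (Suc i)" if i: "i < n" for i
  proof -
    have QQ: "Q i \<subset> Q (Suc i)" using Q i by (auto simp: prime_chain_def)
    then obtain x where x: "x \<in> Q (Suc i)" "x \<notin> Q i" by auto
    have id: "ideal (Q i) R" "ideal (Q (Suc i)) R" using primeideal.axioms(1)[OF pr] i by (simp_all add: Suc_leI)
    have "x \<in> carrier R" using x id ideal.Icarr by metis
    then have "I +> x \<notin> (+>) I ` Q i" using prime_Quot(3)[OF assms id(1) sub] i x by auto
    then show ?thesis using QQ x by blast
  qed
  then have "prime_chain (R Quot I) n (\<lambda>i. (+>) I ` Q i)"
    using prime_Quot(2)[OF assms pr sub] by (auto simp: prime_chain_def)
  then show "has_chain (R Quot I) {} n" by (auto simp: has_chain_def)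
qed

section \<open>Noetherian rings\<close>

text \<open>A bound of degree \<open>r - 1\<close> in \<open>t\<close>, meant for rings of dimension
  below \<open>r\<close>. The value 0 for \<open>r = 0\<close> reflects that a ring without primes
  is zero.\<close>

definition growth :: "nat \<Rightarrow> nat \<Rightarrow> nat" where
  "growth r t = (if r = 0 then 0 else (t + 1) ^ (r - 1))"

lemma growth_step: "e * t * growth r t \<le> e * growth (Suc r) t"
proof (cases r)
  case (Suc k)
  have "t * (t + 1) ^ k \<le> (t + 1) ^ Suc k" by simp
  then show ?thesis using Suc by (simp add: growth_def)
qed (simp add: growth_def)

locale acc_cring = cring R for R (structure) +
  assumes acc: "\<And>I :: nat \<Rightarrow> 'a set. \<lbrakk>\<And>n. ideal (I n) R; \<And>n. I n \<subseteq> I (Suc n)\<rbrakk> \<Longrightarrow>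
    \<exists>n0. \<forall>n\<ge>n0. I n = I n0"
begin

lemma wf_ideals: "wf {(J, I). ideal I R \<and> ideal J R \<and> I \<subset> J}"
  unfolding wf_iff_no_infinite_down_chain
proof
  assume "\<exists>f. \<forall>i. (f (Suc i), f i) \<in> {(J, I). ideal I R \<and> ideal J R \<and> I \<subset> J}"
  then obtain f where "\<forall>i. (f (Suc i), f i) \<in> {(J, I). ideal I R \<and> ideal J R \<and> I \<subset> J}" by blast
  then have f: "\<And>i. ideal (f i) R" "\<And>i. f i \<subset> f (Suc i)" by auto
  then obtain n where "\<forall>k\<ge>n. f k = f n" using acc[of f] by (metis psubset_imp_subset)
  then show False using f(2)[of n] by (metis le_Suc_eq psubsetE order_refl)
qed

lemma ideal_induct [consumes 1, case_names step]:
  assumes "ideal I R" and "\<And>I. \<lbrakk>ideal I R; \<And>J. \<lbrakk>ideal J R; I \<subset> J\<rbrakk> \<Longrightarrow> Q J\<rbrakk> \<Longrightarrow> Q I"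
  shows "Q I"
  using assms(1)
proof (induction I rule: wf_induct_rule[OF wf_ideals])
  case (1 I)
  then show ?case using assms(2)[of I] by auto
qed

lemma ideal_maximal:
  assumes "ideal I R" "Q I"
  obtains J where "ideal J R" "Q J" "\<And>K. \<lbrakk>ideal K R; J \<subset> K\<rbrakk> \<Longrightarrow> \<not> Q K"
proof -
  have "Q I \<longrightarrow> (\<exists>J. ideal J R \<and> Q J \<and> (\<forall>K. ideal K R \<longrightarrow> J \<subset> K \<longrightarrow> \<not> Q K))"
    using assms(1)
  proof (induction I rule: ideal_induct)
    case (step I)
    then show ?case by blast
  qed
  then show thesis using assms(2) that by blast
qed

text \<open>A proper non-prime ideal \<open>I\<close> contains a product \<open>a b\<close> with neither factor in \<open>I\<close>, and then \<open>R / I\<close> is an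
  extension of \<open>R / (I + (a))\<close> by \<open>R / (I : a)\<close>.\<close>

lemma prime_induct [consumes 1, case_names whole nonprime prime]:
  assumes "ideal I R" and "Q (carrier R)"
    and "\<And>I a. \<lbrakk>ideal I R; a \<in> carrier R; Q (I <+>\<^bsub>R\<^esub> PIdl a); Q (colon I a)\<rbrakk> \<Longrightarrow> Q I"
    and "\<And>I. \<lbrakk>primeideal I R; \<And>J. \<lbrakk>ideal J R; I \<subset> J\<rbrakk> \<Longrightarrow> Q J\<rbrakk> \<Longrightarrow> Q I"
  shows "Q I"
  using assms(1)
proof (induction I rule: ideal_induct)
  case (step I)
  consider "I = carrier R" | "primeideal I R" | "I \<noteq> carrier R" "\<not> primeideal I R" by blast
  then show ?case
  proof cases
    case 3
    then obtain a b where ab: "a \<in> carrier R" "b \<in> carrier R" "a \<otimes> b \<in> I" "a \<notin> I" "b \<notin> I"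
      using primeidealI[OF step(1) cring_axioms] by metis
    have "b \<in> colon I a" using ab m_comm[of a b] by (simp add: colon_def)
    moreover have "I \<subseteq> colon I a"
      using idealD(1,7)[OF step(1)] ab(1) by (auto simp: colon_def)
    ultimately have "Q (colon I a)" using step.IH ideal_colon[OF step(1) ab(1)] ab by blast
    moreover have "Q (I <+>\<^bsub>R\<^esub> PIdl a)"
      using step.IH ideal_adj[OF step(1) ab(1)] ideal_adj_psubset[OF step(1) ab(1,4)] by blast
    ultimately show ?thesis using assms(3)[OF step(1) ab(1)] by blast
  qed (use assms(2,4) step in auto)
qed

lemma set_add_right_commute:
  assumes "U \<subseteq> carrier R" "V \<subseteq> carrier R" "W \<subseteq> carrier R"
  shows "(U <+>\<^bsub>R\<^esub> V) <+>\<^bsub>R\<^esub> W = (U <+>\<^bsub>R\<^esub> W) <+>\<^bsub>R\<^esub> V"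
proof -
  have "(U <+>\<^bsub>R\<^esub> V) <+>\<^bsub>R\<^esub> W \<subseteq> (U <+>\<^bsub>R\<^esub> W) <+>\<^bsub>R\<^esub> V"
    if c: "U \<subseteq> carrier R" "V \<subseteq> carrier R" "W \<subseteq> carrier R" for U V W
  proof
    fix z assume "z \<in> (U <+>\<^bsub>R\<^esub> V) <+>\<^bsub>R\<^esub> W"
    then obtain u v w where *: "u \<in> U" "v \<in> V" "w \<in> W" "z = (u \<oplus> v) \<oplus> w" by (auto simp: mem_add)
    then have "z = (u \<oplus> w) \<oplus> v" using c by (simp add: a_ac subset_iff)
    then show "z \<in> (U <+>\<^bsub>R\<^esub> W) <+>\<^bsub>R\<^esub> V" using * mem_add by metis
  qed
  then show ?thesis using assms by blast
qed

text \<open>Multiplication by \<open>a\<close> maps \<open>R / ((I : a) + Q)\<close> onto the kernel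
  of the projection from \<open>R / (I + Q)\<close> to \<open>R / (I + (a) + Q)\<close>.\<close>

lemma lenle_colon:
  assumes P: "primeideal P R" and I: "ideal I R" and Q: "ideal Q R" and a: "a \<in> carrier R"
    and l1: "prime_action.lenle P R R (\<otimes>) ((I <+>\<^bsub>R\<^esub> PIdl a) <+>\<^bsub>R\<^esub> Q) (carrier R) n1"
    and l2: "prime_action.lenle P R R (\<otimes>) (colon I a <+>\<^bsub>R\<^esub> Q) (carrier R) n2"
  shows "prime_action.lenle P R R (\<otimes>) (I <+>\<^bsub>R\<^esub> Q) (carrier R) (n1 + n2)"
proof -
  have pa: "prime_action P R R (\<otimes>)" by (rule primeideal.self_action[OF P])
  interpret S: prime_action P R R "(\<otimes>)" by (rule pa)
  have sub: "S.submod U \<longleftrightarrow> ideal U R" for U by (rule primeideal.self_submod[OF P])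
  have "(\<lambda>x. x \<otimes> a) ` (colon I a <+>\<^bsub>R\<^esub> Q) \<subseteq> I <+>\<^bsub>R\<^esub> Q"
  proof
    fix z assume "z \<in> (\<lambda>x. x \<otimes> a) ` (colon I a <+>\<^bsub>R\<^esub> Q)"
    then obtain u v where uv: "u \<in> carrier R" "u \<otimes> a \<in> I" "v \<in> Q" "z = (u \<oplus> v) \<otimes> a"
      by (auto simp: mem_add colon_def)
    moreover have "v \<otimes> a \<in> Q" "v \<in> carrier R" using idealD[OF Q] uv a by auto
    ultimately show "z \<in> I <+>\<^bsub>R\<^esub> Q" using a by (auto simp: mem_add l_distr)
  qed
  then have "S.lenle (I <+>\<^bsub>R\<^esub> Q) ((I <+>\<^bsub>R\<^esub> Q) <+>\<^bsub>R\<^esub> (\<lambda>x. x \<otimes> a) ` carrier R) n2"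
    using a sub add_ideals[OF I Q]
    by (intro lenle_map[OF pa pa l2]) (auto simp: l_distr m_assoc)
  moreover have "(\<lambda>x. x \<otimes> a) ` carrier R = PIdl a" by (auto simp: cgenideal_def)
  moreover have "(I <+>\<^bsub>R\<^esub> Q) <+>\<^bsub>R\<^esub> PIdl a = (I <+>\<^bsub>R\<^esub> PIdl a) <+>\<^bsub>R\<^esub> Q"
    using idealD(1)[OF I] idealD(1)[OF Q] idealD(1)[OF cgenideal_ideal[OF a]]
    by (intro set_add_right_commute) auto
  ultimately show ?thesis using S.lenle_trans[OF l1] by (simp add: Groups.add.commute[of n1])
qed

lemma lenle_whole: assumes P: "primeideal P R" shows "prime_action.lenle P R R (\<otimes>) (carrier R) (carrier R) n"
proof -
  interpret S: prime_action P R R "(\<otimes>)" by (rule primeideal.self_action[OF P])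
  show ?thesis
    using S.lenle_mono[OF S.lenle_refl] oneideal primeideal.self_submod[OF P] by blast
qed

text \<open>After localisation \<open>R / I\<close> is a quotient of the residue field of
  \<open>P\<close>, generated by the class of \<open>\<one>\<close>.\<close>

lemma lenle_residue_field:
  assumes P: "primeideal P R" and I: "ideal I R" "P \<subseteq> I"
  shows "prime_action.lenle P R R (\<otimes>) I (carrier R) 1"
proof -
  interpret S: prime_action P R R "(\<otimes>)" by (rule primeideal.self_action[OF P])
  have sub: "S.submod U \<longleftrightarrow> ideal U R" for U by (rule primeideal.self_submod[OF P])
  have sI: "S.submod I" "S.submod (carrier R)" using I oneideal sub by auto
  have ad: "S.submod (S.adj I \<one>)" "\<one> \<in> S.adj I \<one>" using S.submod_adj[OF sI(1)] S.adj_self[OF sI(1)] by auto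
  have "S.lenle I (carrier R) (Suc 0)"
  proof (rule S.lenle.step[OF S.lenle_refl[OF sI(1)] sI(2), where c = \<one>])
    show "I \<subseteq> carrier R" using idealD(1)[OF I(1)] by auto
    show "\<one> \<in> carrier R" by simp
    show "p \<otimes> \<one> \<in> S.sat I" if "p \<in> P" for p
      using that S.sat_superset[OF sI(1)] I(2) idealD(1)[OF primeideal.axioms(1)[OF P]] by auto
    have "r \<in> S.adj I \<one>" if "r \<in> carrier R" for r
      using S.submodD(4)[OF ad(1) that ad(2)] that by simp
    then show "carrier R \<subseteq> S.sat (S.adj I \<one>)" using S.sat_superset[OF ad(1)] by blast
  qed
  then show ?thesis by simp
qed

text \<open>By hypothesis every element of \<open>P\<close> is nilpotent modulo \<open>J\<close>
  after localisation. Hence a prime above \<open>J\<close> either contains \<open>P\<close>, and its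
  quotient has length at most one, or meets the complement of \<open>P\<close>, and its quotient
  vanishes at \<open>P\<close>.\<close>

lemma finite_length:
  assumes P: "primeideal P R" and J: "ideal J R"
    and rad: "\<And>a. a \<in> P \<Longrightarrow> \<exists>s\<in>carrier R - P. \<exists>k::nat. s \<otimes> a [^] k \<in> J"
  shows "\<exists>n. prime_action.lenle P R R (\<otimes>) J (carrier R) n"
proof -
  interpret S: prime_action P R R "(\<otimes>)" by (rule primeideal.self_action[OF P])
  have sub: "S.submod U \<longleftrightarrow> ideal U R" for U by (rule primeideal.self_submod[OF P])
  have z: "I <+>\<^bsub>R\<^esub> {\<zero>} = I" if "ideal I R" for I
    using idealD(1)[OF that] unfolding set_add_def' by auto
  have "J \<subseteq> I \<longrightarrow> (\<exists>n. S.lenle I (carrier R) n)" if "ideal I R" for I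
    using that
  proof (induction I rule: prime_induct)
    case whole
    then show ?case using lenle_whole[OF P] by blast
  next
    case (nonprime I a)
    note IH = nonprime(3,4) and idI = nonprime(1) and a = nonprime(2)
    show ?case
    proof
      assume JI: "J \<subseteq> I"
      have "I \<subseteq> I <+>\<^bsub>R\<^esub> PIdl a" using ideal_sum_upper(1)[OF idI cgenideal_ideal[OF a]] .
      moreover have "I \<subseteq> colon I a" using idealD(1,7)[OF idI] a by (auto simp: colon_def)
      ultimately obtain n1 n2 where "S.lenle (I <+>\<^bsub>R\<^esub> PIdl a) (carrier R) n1"
        "S.lenle (colon I a) (carrier R) n2" using IH JI by (meson order_trans)
      then have "S.lenle (I <+>\<^bsub>R\<^esub> {\<zero>}) (carrier R) (n1 + n2)"
        using lenle_colon[OF P idI zeroideal a] z ideal_adj[OF idI a] ideal_colon[OF idI a] by simp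
      then show "\<exists>n. S.lenle I (carrier R) n" using z[OF idI] by auto
    qed
  next
    case (prime I)
    have idI: "ideal I R" using prime(1) primeideal.axioms(1) by blast
    show ?case
    proof
      assume JI: "J \<subseteq> I"
      show "\<exists>n. S.lenle I (carrier R) n"
      proof (cases "P \<subseteq> I")
        case True
        then show ?thesis using lenle_residue_field[OF P idI] by blast
      next
        case False
        then obtain b where b: "b \<in> P" "b \<notin> I" by blast
        have bc: "b \<in> carrier R" using idealD(1)[OF primeideal.axioms(1)[OF P]] b by blast
        obtain s and k :: nat where s: "s \<in> carrier R - P" "s \<otimes> b [^] k \<in> I" using rad[OF b(1)] JI by blast
        have "b [^] k \<notin> I" for k :: nat
        proof (induction k)
          case 0
          then show ?case using ideal.one_imp_carrier[OF idI] primeideal.I_notcarr[OF prime(1)] by auto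
        next
          case (Suc k)
          then show ?case using primeideal.I_prime[OF prime(1), of "b [^] k" b] b bc by auto
        qed
        then have "s \<in> I" using primeideal.I_prime[OF prime(1), of s "b [^] k"] s bc by auto
        then have "r \<in> S.sat I" if "r \<in> carrier R" for r
          using S.satI[of r s] s that idealD(7)[OF idI] by auto
        then have "S.lenle I (carrier R) 0"
          using sub idI oneideal idealD(1)[OF idI] by (intro S.lenle.base) auto
        then show ?thesis by blast
      qed
    qed
  qed
  then show ?thesis using J by blast
qed

text \<open>Half of the dimension theorem: the length of \<open>R / (I + q t)\<close> is bounded by a polynomial in
  \<open>t\<close> of degree \<open>dim (R / I)\<close>.  Dividing by an element \<open>b\<close> outside a prime \<open>I\<close> lowers the
  dimension, and \<open>b\<close> itself takes only linearly many steps to reach \<open>q t\<close>.\<close>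

lemma length_growth:
  assumes P: "primeideal P R" and q: "\<And>t. ideal (q t) R"
    and rad: "\<And>b. b \<in> P \<Longrightarrow> \<exists>e::nat. \<forall>t::nat. b [^] (e * t) \<in> q t"
    and I: "ideal I R" "\<not> has_chain R I r"
  shows "\<exists>c. \<forall>t. prime_action.lenle P R R (\<otimes>) (I <+>\<^bsub>R\<^esub> q t) (carrier R) (c * growth r t)"
proof -
  have pa: "prime_action P R R (\<otimes>)" by (rule primeideal.self_action[OF P])
  interpret S: prime_action P R R "(\<otimes>)" by (rule pa)
  have sub: "S.submod U \<longleftrightarrow> ideal U R" for U by (rule primeideal.self_submod[OF P])
  have "\<forall>r. \<not> has_chain R I r \<longrightarrow> (\<exists>c. \<forall>t. S.lenle (I <+>\<^bsub>R\<^esub> q t) (carrier R) (c * growth r t))"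
    using I(1)
  proof (induction I rule: prime_induct)
    case whole
    have "carrier R <+>\<^bsub>R\<^esub> q t = carrier R" for t
      using ideal_sum_upper(1)[OF oneideal q] ideal_sum_least[OF oneideal, of "carrier R" "q t"] idealD(1)[OF q] by blast
    then show ?case using lenle_whole[OF P] by auto
  next
    case (nonprime I a)
    note IH = nonprime(3,4) and idI = nonprime(1) and a = nonprime(2)
    show ?case
    proof (intro allI impI)
      fix r assume r: "\<not> has_chain R I r"
      have "I \<subseteq> I <+>\<^bsub>R\<^esub> PIdl a" using ideal_sum_upper(1)[OF idI cgenideal_ideal[OF a]] .
      moreover have "I \<subseteq> colon I a" using idealD(1,7)[OF idI] a by (auto simp: colon_def)
      ultimately have "\<not> has_chain R (I <+>\<^bsub>R\<^esub> PIdl a) r" "\<not> has_chain R (colon I a) r"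
        using has_chain_mono r by blast+
      then obtain c1 c2 where c: "\<And>t. S.lenle ((I <+>\<^bsub>R\<^esub> PIdl a) <+>\<^bsub>R\<^esub> q t) (carrier R) (c1 * growth r t)"
        "\<And>t. S.lenle (colon I a <+>\<^bsub>R\<^esub> q t) (carrier R) (c2 * growth r t)" using IH by meson
      have "S.lenle (I <+>\<^bsub>R\<^esub> q t) (carrier R) ((c1 + c2) * growth r t)" for t
        using lenle_colon[OF P idI q a c] by (simp add: algebra_simps)
      then show "\<exists>c. \<forall>t. S.lenle (I <+>\<^bsub>R\<^esub> q t) (carrier R) (c * growth r t)" by blast
    qed
  next
    case (prime I)
    have idI: "ideal I R" using prime(1) primeideal.axioms(1) by blast
    show ?case
    proof (intro allI impI)
      fix r assume r: "\<not> has_chain R I r"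
      have "has_chain R I 0" using prime(1) unfolding has_chain_from by auto
      \<comment> \<open>The prime \<open>I\<close> alone is a chain of length 0, so \<open>r\<close>
        is positive and there is room for the bound on the dimension to drop.\<close>
      then obtain r' where r': "r = Suc r'" using r by (cases r) auto
      show "\<exists>c. \<forall>t. S.lenle (I <+>\<^bsub>R\<^esub> q t) (carrier R) (c * growth r t)"
      proof (cases "P \<subseteq> I")
        case True
        then have "S.lenle (I <+>\<^bsub>R\<^esub> q t) (carrier R) 1" for t
          using lenle_residue_field[OF P add_ideals[OF idI q]] ideal_sum_upper(1)[OF idI q] by blast
        then have "S.lenle (I <+>\<^bsub>R\<^esub> q t) (carrier R) (1 * growth r t)" for t
          by (rule S.lenle_mono) (simp add: growth_def r')
        then show ?thesis by blast
      next
        case False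
        then obtain b where b: "b \<in> P" "b \<notin> I" by blast
        have bc: "b \<in> carrier R" using idealD(1)[OF primeideal.axioms(1)[OF P]] b by blast
        obtain e :: nat where e: "\<And>t::nat. b [^] (e * t) \<in> q t" using rad[OF b(1)] by blast
        have ps: "I \<subset> I <+>\<^bsub>R\<^esub> PIdl b" using ideal_adj_psubset[OF idI bc b(2)] .
        then have "\<not> has_chain R (I <+>\<^bsub>R\<^esub> PIdl b) r'"
          using r r' has_chain_Suc[OF prime(1)] by blast
        then obtain c where c: "\<And>t. S.lenle ((I <+>\<^bsub>R\<^esub> PIdl b) <+>\<^bsub>R\<^esub> q t) (carrier R) (c * growth r' t)"
          using prime(2)[OF ideal_adj[OF idI bc] ps] by blast
        \<comment> \<open>Each further factor \<open>b\<close> costs one copy of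
          \<open>R / (I + (b) + q t)\<close>, which multiplication by \<open>b [^] j\<close> maps
          onto the multiples of \<open>b [^] j\<close> modulo
          \<open>I + (b [^] Suc j) + q t\<close>.\<close>
        have pow: "S.lenle ((I <+>\<^bsub>R\<^esub> PIdl (b [^] j)) <+>\<^bsub>R\<^esub> q t) (carrier R) (j * (c * growth r' t))"
          for j t :: nat
        proof (induction j)
          case 0
          have "PIdl \<one> = carrier R" using genideal_one cgenideal_eq_genideal[OF one_closed] by simp
          moreover have "(I <+>\<^bsub>R\<^esub> carrier R) <+>\<^bsub>R\<^esub> q t = carrier R"
            using ideal_sum_upper(1)[OF add_ideals[OF idI oneideal] q]
              ideal_sum_upper(2)[OF idI oneideal] idealD(1)[OF add_ideals[OF add_ideals[OF idI oneideal] q]]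
            by blast
          ultimately show ?case using lenle_whole[OF P] by simp
        next
          case (Suc j)
          let ?I = "(I <+>\<^bsub>R\<^esub> PIdl (b [^] Suc j)) <+>\<^bsub>R\<^esub> q t"
          have bj: "b [^] j \<in> carrier R" "b [^] Suc j \<in> carrier R" using bc by auto
          have id1: "ideal (I <+>\<^bsub>R\<^esub> PIdl (b [^] Suc j)) R" and id2: "ideal ?I R"
            using add_ideals[OF _ q] ideal_adj[OF idI bj(2)] by auto
          have up: "I \<subseteq> ?I" "PIdl (b [^] Suc j) \<subseteq> ?I" "q t \<subseteq> ?I"
            using ideal_sum_upper[OF id1 q[of t]] ideal_sum_upper[OF idI cgenideal_ideal[OF bj(2)]] by auto
          have "(\<lambda>x. x \<otimes> b [^] j) ` ((I <+>\<^bsub>R\<^esub> PIdl b) <+>\<^bsub>R\<^esub> q t) \<subseteq> ?I"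
          proof
            fix z assume "z \<in> (\<lambda>x. x \<otimes> b [^] j) ` ((I <+>\<^bsub>R\<^esub> PIdl b) <+>\<^bsub>R\<^esub> q t)"
            then obtain i r u where *: "i \<in> I" "r \<in> carrier R" "u \<in> q t" "z = (i \<oplus> r \<otimes> b \<oplus> u) \<otimes> b [^] j"
              by (auto simp: mem_add mem_PIdl)
            have cc: "i \<in> carrier R" "u \<in> carrier R" using idealD(1)[OF idI] idealD(1)[OF q] * by auto
            have "z = i \<otimes> b [^] j \<oplus> r \<otimes> b [^] Suc j \<oplus> u \<otimes> b [^] j"
              using * cc bj bc m_comm[of b "b [^] j"] by (simp add: l_distr m_assoc)
            moreover have "i \<otimes> b [^] j \<in> ?I" "u \<otimes> b [^] j \<in> ?I"
              using idealD(7)[OF id2 _ bj(1)] up * by blast+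
            moreover have "r \<otimes> b [^] Suc j \<in> ?I" using * up mem_PIdl[of _ "b [^] Suc j"] by blast
            ultimately show "z \<in> ?I" using idealD(3)[OF id2] by simp
          qed
          then have "S.lenle ?I (?I <+>\<^bsub>R\<^esub> (\<lambda>x. x \<otimes> b [^] j) ` carrier R) (c * growth r' t)"
            using bj sub id2 by (intro lenle_map[OF pa pa c[of t]]) (auto simp: l_distr m_assoc)
          moreover have "(\<lambda>x. x \<otimes> b [^] j) ` carrier R = PIdl (b [^] j)" by (auto simp: cgenideal_def)
          moreover have "?I <+>\<^bsub>R\<^esub> PIdl (b [^] j) = (I <+>\<^bsub>R\<^esub> PIdl (b [^] j)) <+>\<^bsub>R\<^esub> q t"
          proof
            have id3: "ideal (I <+>\<^bsub>R\<^esub> PIdl (b [^] j)) R" using ideal_adj[OF idI bj(1)] .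
            have id4: "ideal ((I <+>\<^bsub>R\<^esub> PIdl (b [^] j)) <+>\<^bsub>R\<^esub> q t) R" using add_ideals[OF id3 q] .
            have up4: "I \<subseteq> (I <+>\<^bsub>R\<^esub> PIdl (b [^] j)) <+>\<^bsub>R\<^esub> q t"
              "PIdl (b [^] j) \<subseteq> (I <+>\<^bsub>R\<^esub> PIdl (b [^] j)) <+>\<^bsub>R\<^esub> q t"
              "q t \<subseteq> (I <+>\<^bsub>R\<^esub> PIdl (b [^] j)) <+>\<^bsub>R\<^esub> q t"
              using ideal_sum_upper[OF id3 q[of t]] ideal_sum_upper[OF idI cgenideal_ideal[OF bj(1)]] by auto
            have "b [^] Suc j \<in> PIdl (b [^] j)" using mem_PIdl bc m_comm[of "b [^] j" b] by auto
            then have "PIdl (b [^] Suc j) \<subseteq> PIdl (b [^] j)"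
              using PIdl_subset_iff[OF cgenideal_ideal[OF bj(1)] bj(2)] by simp
            then show "?I <+>\<^bsub>R\<^esub> PIdl (b [^] j) \<subseteq> (I <+>\<^bsub>R\<^esub> PIdl (b [^] j)) <+>\<^bsub>R\<^esub> q t"
              using up4 by (intro ideal_sum_least[OF id4]) auto
            have id5: "ideal (?I <+>\<^bsub>R\<^esub> PIdl (b [^] j)) R" using ideal_adj[OF id2 bj(1)] .
            show "(I <+>\<^bsub>R\<^esub> PIdl (b [^] j)) <+>\<^bsub>R\<^esub> q t \<subseteq> ?I <+>\<^bsub>R\<^esub> PIdl (b [^] j)"
              using up ideal_sum_upper[OF id2 cgenideal_ideal[OF bj(1)]] by (intro ideal_sum_least[OF id5]) auto
          qed
          ultimately show ?case using S.lenle_trans[OF Suc.IH] by (simp add: algebra_simps)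
        qed
        have "S.lenle (I <+>\<^bsub>R\<^esub> q t) (carrier R) ((e * c) * growth r t)" for t
        proof -
          have bb: "b [^] (e * t) \<in> carrier R" using bc by simp
          have "PIdl (b [^] (e * t)) \<subseteq> q t" using PIdl_subset_iff[OF q bb] e by blast
          then have "(I <+>\<^bsub>R\<^esub> PIdl (b [^] (e * t))) <+>\<^bsub>R\<^esub> q t \<subseteq> I <+>\<^bsub>R\<^esub> q t"
            using ideal_sum_upper[OF idI q[of t]]
            by (intro ideal_sum_least[OF add_ideals[OF idI q]]) auto
          moreover have "I <+>\<^bsub>R\<^esub> q t \<subseteq> (I <+>\<^bsub>R\<^esub> PIdl (b [^] (e * t))) <+>\<^bsub>R\<^esub> q t"
            using ideal_sum_upper(1)[OF idI cgenideal_ideal[OF bb]]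
              ideal_sum_upper[OF ideal_adj[OF idI bb] q[of t]]
            by (intro ideal_sum_least[OF add_ideals[OF ideal_adj[OF idI bb] q]]) auto
          ultimately have eq: "(I <+>\<^bsub>R\<^esub> PIdl (b [^] (e * t))) <+>\<^bsub>R\<^esub> q t = I <+>\<^bsub>R\<^esub> q t" by blast
          have "S.lenle (I <+>\<^bsub>R\<^esub> q t) (carrier R) (e * t * (c * growth r' t))"
            using pow[of "e * t" t] unfolding eq .
          then show ?thesis
            by (rule S.lenle_mono) (use growth_step[of "e * c" t r'] in \<open>simp add: r' algebra_simps\<close>)
        qed
        then show ?thesis by blast
      qed
    qed
  qed
  then show ?thesis using I(2) by blast
qed

end

section \<open>Krull's theorems\<close>

context acc_cring
begin

text \<open>The symbolic powers \<open>K n\<close> of \<open>(b)\<close> at \<open>p1\<close> become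
  stationary modulo \<open>J\<close>, which has finite colength at \<open>P\<close>; Nakayama's lemma then makes them
  stationary outright, contradicting \<open>b \<notin> p0\<close>.\<close>

lemma principal_ideal_theorem:
  assumes p0: "primeideal p0 R" and p1: "primeideal p1 R" and P: "primeideal P R"
    and sub: "p0 \<subset> p1" "p1 \<subseteq> P" and y: "y \<in> P" "y \<notin> p1"
    and rad: "\<And>a. a \<in> P \<Longrightarrow> \<exists>s\<in>carrier R - P. \<exists>k::nat. s \<otimes> a [^] k \<in> p0 <+>\<^bsub>R\<^esub> PIdl y"
  shows False
proof -
  interpret S: prime_action P R R "(\<otimes>)" by (rule primeideal.self_action[OF P])
  interpret T: prime_action p1 R R "(\<otimes>)" by (rule primeideal.self_action[OF p1])
  have sS: "S.submod U \<longleftrightarrow> ideal U R" for U by (rule primeideal.self_submod[OF P])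
  have sT: "T.submod U \<longleftrightarrow> ideal U R" for U by (rule primeideal.self_submod[OF p1])
  have i0: "ideal p0 R" and i1: "ideal p1 R" and iP: "ideal P R"
    using p0 p1 P primeideal.axioms(1) by blast+
  have yc: "y \<in> carrier R" using idealD(1)[OF iP] y by blast
  define J where "J = p0 <+>\<^bsub>R\<^esub> PIdl y"
  have iJ: "ideal J R" unfolding J_def using ideal_adj[OF i0 yc] .
  obtain N where N: "S.lenle J (carrier R) N" using finite_length[OF P iJ] rad unfolding J_def by blast
  obtain b where b: "b \<in> p1" "b \<notin> p0" using sub by blast
  have bc: "b \<in> carrier R" using idealD(1)[OF i1] b by blast
  define B where "B n = p0 <+>\<^bsub>R\<^esub> PIdl (b [^] n)" for n :: nat
  define K where "K n = T.sat (B n)" for n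
  have iB: "ideal (B n) R" for n unfolding B_def using ideal_adj[OF i0] bc by simp
  have iK: "ideal (K n) R" for n unfolding K_def using T.submod_sat sT iB by blast
  have p0B: "p0 \<subseteq> B n" for n unfolding B_def using ideal_sum_upper(1)[OF i0 cgenideal_ideal] bc by simp
  have p0K: "p0 \<subseteq> K n" for n unfolding K_def using p0B[of n] T.sat_superset[of "B n"] sT iB by blast
  have bB: "b [^] n \<in> B n" for n :: nat
    unfolding B_def using ideal_sum_upper(2)[OF i0 cgenideal_ideal, of "b [^] n"] bc cgenideal_self by auto
  have BB: "B (Suc n) \<subseteq> B n" for n
    unfolding B_def
  proof (rule ideal_sum_least)
    have bn: "b [^] n \<in> carrier R" "b [^] Suc n \<in> carrier R" using bc by auto
    show "ideal (p0 <+>\<^bsub>R\<^esub> PIdl (b [^] n)) R" using ideal_adj[OF i0 bn(1)] .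
    have "b [^] Suc n \<in> PIdl (b [^] n)" using mem_PIdl bc m_comm[of "b [^] n" b] by auto
    then have "PIdl (b [^] Suc n) \<subseteq> PIdl (b [^] n)"
      using PIdl_subset_iff[OF cgenideal_ideal[OF bn(1)] bn(2)] by simp
    then show "PIdl (b [^] Suc n) \<subseteq> p0 <+>\<^bsub>R\<^esub> PIdl (b [^] n)" "p0 \<subseteq> p0 <+>\<^bsub>R\<^esub> PIdl (b [^] n)"
      using ideal_sum_upper[OF i0 cgenideal_ideal[OF bn(1)]] by auto
  qed
  have KK: "K (Suc n) \<subseteq> K n" for n unfolding K_def using T.sat_mono BB .
  have Kc: "x \<in> carrier R" if "x \<in> K n" for x n using idealD(1)[OF iK that] .
  \<comment> \<open>If every passage from \<open>K n\<close> to \<open>K (Suc n)\<close> were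
    visible modulo \<open>J\<close> at \<open>P\<close>, one element \<open>g n\<close> for each
    passage would give independent lists of any length, against the finite length
    \<open>N\<close>.\<close>
  have stat: "\<exists>n. K n \<subseteq> S.sat (K (Suc n) <+>\<^bsub>R\<^esub> J)"
  proof (rule ccontr)
    assume "\<not> ?thesis"
    then have "\<forall>n. \<exists>g. g \<in> K n \<and> g \<notin> S.sat (K (Suc n) <+>\<^bsub>R\<^esub> J)" by blast
    then obtain g where g: "\<And>n. g n \<in> K n" "\<And>n. g n \<notin> S.sat (K (Suc n) <+>\<^bsub>R\<^esub> J)" by metis
    have "S.indep J (map g [n..<n + k]) \<and> S.spanl J (map g [n..<n + k]) \<subseteq> K n <+>\<^bsub>R\<^esub> J" for n k
    proof (induction k arbitrary: n)
      case 0
      then show ?case using ideal_sum_upper(2)[OF iK iJ] by simp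
    next
      case (Suc k)
      have eq: "map g [n..<n + Suc k] = g n # map g [Suc n..<Suc n + k]" by (simp add: upt_conv_Cons del: upt_Suc)
      have IH: "S.indep J (map g [Suc n..<Suc n + k])"
        "S.spanl J (map g [Suc n..<Suc n + k]) \<subseteq> K (Suc n) <+>\<^bsub>R\<^esub> J" using Suc.IH by blast+
      have "g n \<notin> S.sat (S.spanl J (map g [Suc n..<Suc n + k]))" using g S.sat_mono[OF IH(2)] by blast
      moreover have "K (Suc n) <+>\<^bsub>R\<^esub> J \<subseteq> K n <+>\<^bsub>R\<^esub> J"
        using KK ideal_sum_upper[OF iK iJ] by (intro ideal_sum_least[OF add_ideals[OF iK iJ]]) blast+
      then have "S.adj (S.spanl J (map g [Suc n..<Suc n + k])) (g n) \<subseteq> K n <+>\<^bsub>R\<^esub> J"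
        using IH(2) g(1)[of n] ideal_sum_upper(1)[OF iK iJ, of n] sS add_ideals[OF iK iJ]
        by (intro S.adj_least) blast+
      ultimately show ?case unfolding eq using IH(1) by simp
    qed
    then have "S.indep J (map g [0..<0 + Suc N])" by blast
    moreover have "set (map g [0..<0 + Suc N]) \<subseteq> carrier R" using g(1) Kc by auto
    ultimately have "length (map g [0..<0 + Suc N]) \<le> N" using S.indep_length_le[OF N] by blast
    then show False by simp
  qed
  then obtain n where n: "K n \<subseteq> S.sat (K (Suc n) <+>\<^bsub>R\<^esub> J)" ..
  \<comment> \<open>\<open>K n\<close> is saturated at \<open>p1\<close> and \<open>y\<close> is
    outside \<open>p1\<close>, so the part of \<open>s \<otimes> a\<close> in \<open>(y)\<close> is
    \<open>y\<close> times an element of \<open>K n\<close> itself. This is the input for Nakayama's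
    lemma.\<close>
  have step: "\<exists>s\<in>carrier R - P. \<exists>c\<in>K (Suc n). \<exists>r\<in>K n. s \<otimes> a = c \<oplus> y \<otimes> r" if a: "a \<in> K n" for a
  proof -
    obtain s where s: "s \<in> carrier R - P" "s \<otimes> a \<in> K (Suc n) <+>\<^bsub>R\<^esub> J" using n a by (auto simp: S.sat_def)
    then obtain c u where cu: "c \<in> K (Suc n)" "u \<in> J" "s \<otimes> a = c \<oplus> u" using mem_add by metis
    then obtain z w where zw: "z \<in> p0" "w \<in> PIdl y" "u = z \<oplus> w" using mem_add unfolding J_def by metis
    then obtain r where r: "r \<in> carrier R" "w = r \<otimes> y" using mem_PIdl by metis
    have c': "c \<oplus> z \<in> K (Suc n)" using cu zw p0K idealD(3)[OF iK] by blast
    have cc: "c \<in> carrier R" "z \<in> carrier R" "c \<oplus> z \<in> carrier R" using Kc cu c' idealD(1)[OF i0] zw by blast+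
    have e: "s \<otimes> a = (c \<oplus> z) \<oplus> y \<otimes> r" using cu zw r cc yc by (simp add: a_assoc m_comm)
    have "y \<otimes> r = s \<otimes> a \<ominus> (c \<oplus> z)" unfolding e using cc r yc by algebra
    moreover have "s \<otimes> a \<in> K n" "c \<oplus> z \<in> K n" using idealD(6)[OF iK a] s c' KK by blast+
    ultimately have "y \<otimes> r \<in> K n" using idealD(5)[OF iK] by simp
    then have "r \<in> K n" unfolding K_def using T.sat_cancel[of y r] yc y r by blast
    then show ?thesis using s c' e by blast
  qed
  have "K n \<subseteq> S.sat (K (Suc n))"
  proof (rule ccontr)
    assume neg: "\<not> K n \<subseteq> S.sat (K (Suc n))"
    \<comment> \<open>Nakayama's lemma by a maximal counterexample: for a maximal \<open>I\<close>
      with this property, \<open>K n\<close> is locally \<open>I\<close> plus the multiples of a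
      single \<open>c\<close>. Then \<open>s' \<otimes> s \<ominus> y \<otimes> t\<close>, which is
      outside \<open>P\<close>, sends \<open>c\<close> into \<open>I\<close>.\<close>
    define Q where "Q I \<longleftrightarrow> K (Suc n) \<subseteq> I \<and> I \<subseteq> K n \<and> \<not> K n \<subseteq> S.sat I" for I
    have "Q (K (Suc n))" using neg KK by (auto simp: Q_def)
    then obtain I where I: "ideal I R" "Q I" and max: "\<And>I'. \<lbrakk>ideal I' R; I \<subset> I'\<rbrakk> \<Longrightarrow> \<not> Q I'"
      using ideal_maximal[OF iK, of Q] by blast
    obtain c where c: "c \<in> K n" "c \<notin> S.sat I" using I(2) by (auto simp: Q_def)
    have cc: "c \<in> carrier R" using c Kc by blast
    have "c \<notin> I" using c S.sat_superset[of I] sS I(1) by blast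
    then have ps: "I \<subset> I <+>\<^bsub>R\<^esub> PIdl c" using ideal_adj_psubset[OF I(1) cc] by blast
    moreover have iIc: "ideal (I <+>\<^bsub>R\<^esub> PIdl c) R" using ideal_adj[OF I(1) cc] .
    ultimately have "\<not> Q (I <+>\<^bsub>R\<^esub> PIdl c)" using max by blast
    moreover have "I <+>\<^bsub>R\<^esub> PIdl c \<subseteq> K n"
      using I(2) c(1) PIdl_subset_iff[OF iK cc] by (intro ideal_sum_least[OF iK]) (auto simp: Q_def)
    ultimately have full: "K n \<subseteq> S.sat (I <+>\<^bsub>R\<^esub> PIdl c)" using ps I(2) by (auto simp: Q_def)
    obtain s d r where s: "s \<in> carrier R - P" "d \<in> K (Suc n)" "r \<in> K n" "s \<otimes> c = d \<oplus> y \<otimes> r"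
      using step[OF c(1)] by blast
    obtain s' where s': "s' \<in> carrier R - P" "s' \<otimes> r \<in> I <+>\<^bsub>R\<^esub> PIdl c"
      using full s(3) by (auto simp: S.sat_def)
    then obtain i w where "i \<in> I" "w \<in> PIdl c" "s' \<otimes> r = i \<oplus> w" using mem_add by metis
    then obtain t where t: "i \<in> I" "t \<in> carrier R" "s' \<otimes> r = i \<oplus> t \<otimes> c" using mem_PIdl by metis
    have dI: "d \<in> I" using s I(2) by (auto simp: Q_def)
    have car: "d \<in> carrier R" "i \<in> carrier R" "r \<in> carrier R" "s \<in> carrier R" "s' \<in> carrier R"
      using dI t s s' Kc idealD(1)[OF I(1)] by blast+
    have "(s' \<otimes> s \<ominus> y \<otimes> t) \<otimes> c = s' \<otimes> (s \<otimes> c) \<ominus> y \<otimes> (t \<otimes> c)" using car t(2) cc yc by algebra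
    also have "\<dots> = s' \<otimes> d \<oplus> y \<otimes> (s' \<otimes> r) \<ominus> y \<otimes> (t \<otimes> c)" unfolding s(4) using car t(2) cc yc by algebra
    also have "\<dots> = s' \<otimes> d \<oplus> y \<otimes> i" unfolding t(3) using car t(2) cc yc by algebra
    also have "\<dots> \<in> I" using idealD(3,6)[OF I(1)] dI t(1) car yc by simp
    finally have inI: "(s' \<otimes> s \<ominus> y \<otimes> t) \<otimes> c \<in> I" .
    have "s' \<otimes> s \<ominus> y \<otimes> t \<notin> P"
    proof
      assume "s' \<otimes> s \<ominus> y \<otimes> t \<in> P"
      moreover have yt: "y \<otimes> t \<in> P" using idealD(7)[OF iP y(1) t(2)] .
      ultimately have "s' \<otimes> s \<ominus> y \<otimes> t \<oplus> y \<otimes> t \<in> P" using idealD(3)[OF iP] by blast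
      moreover have "s' \<otimes> s \<ominus> y \<otimes> t \<oplus> y \<otimes> t = s' \<otimes> s" using car t yc by algebra
      ultimately show False using S.mult_not_in_prime[OF s'(1) s(1)] by simp
    qed
    then have "c \<in> S.sat I" using S.satI[OF cc _ inI] car t yc by simp
    then show False using c by blast
  qed
  moreover have "b [^] n \<in> K n" unfolding K_def using T.sat_superset[of "B n"] sT iB bB by blast
  \<comment> \<open>Cancelling \<open>b [^] n\<close> modulo the prime \<open>p0\<close> leaves a
    product of two elements outside \<open>p1\<close> that is congruent to a multiple of
    \<open>b\<close>, and so lies in \<open>p1\<close>.\<close>
  ultimately obtain s where s: "s \<in> carrier R - P" "s \<otimes> b [^] n \<in> K (Suc n)" by (auto simp: S.sat_def)
  then obtain s' where s': "s' \<in> carrier R - p1" "s' \<otimes> (s \<otimes> b [^] n) \<in> B (Suc n)"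
    unfolding K_def T.sat_def by blast
  then obtain z w where "z \<in> p0" "w \<in> PIdl (b [^] Suc n)" "s' \<otimes> (s \<otimes> b [^] n) = z \<oplus> w"
    using mem_add unfolding B_def by metis
  then obtain t where t: "z \<in> p0" "t \<in> carrier R" "s' \<otimes> (s \<otimes> b [^] n) = z \<oplus> t \<otimes> b [^] Suc n"
    using mem_PIdl by metis
  have car: "z \<in> carrier R" "s \<in> carrier R" "s' \<in> carrier R" "b [^] n \<in> carrier R"
    using t s s' idealD(1)[OF i0] bc by auto
  have "(s' \<otimes> s \<ominus> t \<otimes> b) \<otimes> b [^] n = s' \<otimes> (s \<otimes> b [^] n) \<ominus> t \<otimes> (b [^] n \<otimes> b)"
    using car t(2) bc by algebra
  also have "\<dots> = z" unfolding t(3) nat_pow_Suc using car t(2) bc by algebra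
  finally have "(s' \<otimes> s \<ominus> t \<otimes> b) \<otimes> b [^] n \<in> p0" using t by simp
  moreover have "b [^] n \<notin> p0" for n :: nat
  proof (induction n)
    case 0
    then show ?case using ideal.one_imp_carrier[OF i0] primeideal.I_notcarr[OF p0] by auto
  next
    case (Suc n)
    then show ?case using primeideal.I_prime[OF p0, of "b [^] n" b] b bc by auto
  qed
  ultimately have "s' \<otimes> s \<ominus> t \<otimes> b \<in> p0"
    using primeideal.I_prime[OF p0, of "s' \<otimes> s \<ominus> t \<otimes> b" "b [^] n"] car t bc by auto
  then have "s' \<otimes> s \<ominus> t \<otimes> b \<in> p1" using sub by blast
  moreover have "t \<otimes> b \<in> p1" using idealD(6)[OF i1 b(1) t(2)] .
  ultimately have "s' \<otimes> s \<ominus> t \<otimes> b \<oplus> t \<otimes> b \<in> p1" using idealD(3)[OF i1] by blast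
  moreover have "s' \<otimes> s \<ominus> t \<otimes> b \<oplus> t \<otimes> b = s' \<otimes> s" using car t bc by algebra
  ultimately show False using T.mult_not_in_prime[OF s'(1), of s] s(1) sub by auto
qed

text \<open>If \<open>y\<close> is not in \<open>p1\<close> and there is no such \<open>Q\<close>,
  then \<open>P\<close> is minimal over \<open>p0 + (y)\<close>, and the principal ideal theorem
  excludes \<open>p1\<close>. Minimality yields the hypothesis on powers by avoiding the
  multiplicative set of all \<open>s \<otimes> a [^] k\<close>.\<close>

lemma intermediate_prime:
  assumes p0: "primeideal p0 R" and p1: "primeideal p1 R" and P: "primeideal P R"
    and sub: "p0 \<subset> p1" "p1 \<subset> P" and y: "y \<in> P"
  shows "\<exists>Q. primeideal Q R \<and> p0 \<subset> Q \<and> Q \<subset> P \<and> y \<in> Q"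
proof (cases "y \<in> p1")
  case False
  have i0: "ideal p0 R" and iP: "ideal P R" using p0 P primeideal.axioms(1) by blast+
  have yc: "y \<in> carrier R" using idealD(1)[OF iP y] .
  show ?thesis
  proof (rule ccontr)
    assume neg: "\<not> ?thesis"
    have "\<exists>s\<in>carrier R - P. \<exists>k::nat. s \<otimes> a [^] k \<in> p0 <+>\<^bsub>R\<^esub> PIdl y" if a: "a \<in> P" for a
    proof (rule ccontr)
      assume H: "\<not> ?thesis"
      have ac: "a \<in> carrier R" using idealD(1)[OF iP a] .
      define W where "W = {s \<otimes> a [^] k | s k. s \<in> carrier R - P \<and> k \<in> (UNIV :: nat set)}"
      have oneP: "\<one> \<in> carrier R - P" using ideal.one_imp_carrier[OF iP] primeideal.I_notcarr[OF P] by auto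
      have Wp: "s \<in> W" if "s \<in> carrier R - P" for s
        unfolding W_def using that by (intro CollectI exI[of _ s] exI[of _ 0]) auto
      have Wa: "a \<in> W"
        unfolding W_def using oneP ac by (intro CollectI exI[of _ \<one>] exI[of _ 1]) auto
      have "\<exists>Q. primeideal Q R \<and> p0 <+>\<^bsub>R\<^esub> PIdl y \<subseteq> Q \<and> Q \<inter> W = {}"
      proof (rule prime_avoiding)
        show "ideal (p0 <+>\<^bsub>R\<^esub> PIdl y) R" using ideal_adj[OF i0 yc] .
        show "W \<subseteq> carrier R" unfolding W_def using ac by auto
        show "\<one> \<in> W" using Wp oneP .
        show "(p0 <+>\<^bsub>R\<^esub> PIdl y) \<inter> W = {}" unfolding W_def using H by auto
        show "u \<otimes> v \<in> W" if uv: "u \<in> W" "v \<in> W" for u v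
        proof -
          obtain s k s' k' where *: "s \<in> carrier R - P" "u = s \<otimes> a [^] (k::nat)"
            "s' \<in> carrier R - P" "v = s' \<otimes> a [^] (k'::nat)" using uv unfolding W_def by blast
          have "u \<otimes> v = (s \<otimes> s') \<otimes> (a [^] k \<otimes> a [^] k')" unfolding *(2,4) using * ac by (simp add: m_ac)
          then have "u \<otimes> v = (s \<otimes> s') \<otimes> a [^] (k + k')" using ac by (simp add: nat_pow_mult)
          moreover have "s \<otimes> s' \<in> carrier R - P" using primeideal.I_prime[OF P] * by auto
          ultimately show ?thesis unfolding W_def by blast
        qed
      qed
      then obtain Q where Q: "primeideal Q R" "p0 <+>\<^bsub>R\<^esub> PIdl y \<subseteq> Q" "Q \<inter> W = {}" by blast
      have iQ: "ideal Q R" using Q(1) primeideal.axioms(1) by blast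
      have "Q \<subset> P" using Q(3) Wp Wa a idealD(1)[OF iQ] by blast
      moreover have "p0 \<subseteq> Q" "y \<in> Q"
        using Q(2) ideal_sum_upper[OF i0 cgenideal_ideal[OF yc]] cgenideal_self[OF yc] by blast+
      moreover have "p0 \<noteq> Q" using \<open>y \<in> Q\<close> False sub by blast
      ultimately show False using neg Q(1) by blast
    qed
    then show False using principal_ideal_theorem[OF p0 p1 P sub(1) _ y False] sub by blast
  qed
qed (use assms in blast)

text \<open>From the top downwards each prime below \<open>P\<close> is exchanged for one that
  contains \<open>y\<close>. Only the bottom prime has nothing below it to permit an exchange, and
  it is dropped.\<close>

lemma chain_to_insert:
  "\<lbrakk>chain_to R I (Suc n) P; y \<in> P\<rbrakk> \<Longrightarrow> chain_to R (insert y I) n P"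
proof (induction n arbitrary: P)
  case 0
  then show ?case by auto
next
  case (Suc n)
  obtain Q where Q: "primeideal P R" "Q \<subset> P" "chain_to R I (Suc n) Q" using Suc.prems by auto
  obtain Q2 where Q2: "Q2 \<subset> Q" "chain_to R I n Q2" using Q(3) by auto
  obtain Q' where Q': "primeideal Q' R" "Q2 \<subset> Q'" "Q' \<subset> P" "y \<in> Q'"
    using intermediate_prime[OF chain_to_prime[OF Q2(2)] chain_to_prime[OF Q(3)] Q(1) Q2(1) Q(2) Suc.prems(2)] by blast
  have "chain_to R I (Suc n) Q'" using Q' Q2 by auto
  then show ?case using Suc.IH[of Q'] Q' Q(1) by auto
qed

lemma krull_height:
  "\<lbrakk>chain_to R I (length ys + n) P; set ys \<subseteq> P\<rbrakk> \<Longrightarrow> chain_to R (I \<union> set ys) n P"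
proof (induction ys arbitrary: I)
  case (Cons y ys)
  then have "chain_to R (insert y I) (length ys + n) P" using chain_to_insert[of I "length ys + n" P y] by simp
  then show ?case using Cons.IH[of "insert y I"] Cons.prems by simp
qed simp

end

section \<open>The bigraded ring\<close>

context super_ring
begin

abbreviation "Ev \<equiv> even_part R"
abbreviation "Od \<equiv> odd_part R"

lemma part_closed:
  "a \<in> Ev \<Longrightarrow> a \<in> carrier R" "a \<in> Od \<Longrightarrow> a \<in> carrier R"
  "\<zero> \<in> Ev" "\<zero> \<in> Od"
  "\<lbrakk>a \<in> Ev; b \<in> Ev\<rbrakk> \<Longrightarrow> a \<oplus> b \<in> Ev" "\<lbrakk>a \<in> Od; b \<in> Od\<rbrakk> \<Longrightarrow> a \<oplus> b \<in> Od"
  "a \<in> Ev \<Longrightarrow> \<ominus> a \<in> Ev" "a \<in> Od \<Longrightarrow> \<ominus> a \<in> Od"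
proof -
  interpret E: additive_subgroup Ev R by (rule even_subgroup)
  interpret O: additive_subgroup Od R by (rule odd_subgroup)
  show "a \<in> Ev \<Longrightarrow> a \<in> carrier R" "a \<in> Od \<Longrightarrow> a \<in> carrier R"
    "\<zero> \<in> Ev" "\<zero> \<in> Od"
    "\<lbrakk>a \<in> Ev; b \<in> Ev\<rbrakk> \<Longrightarrow> a \<oplus> b \<in> Ev" "\<lbrakk>a \<in> Od; b \<in> Od\<rbrakk> \<Longrightarrow> a \<oplus> b \<in> Od"
    by auto
  show "a \<in> Ev \<Longrightarrow> \<ominus> a \<in> Ev" using E.a_inv_closed by simp
  show "a \<in> Od \<Longrightarrow> \<ominus> a \<in> Od" using O.a_inv_closed by simp
qed

lemma decompose:
  assumes "x \<in> carrier R" obtains a b where "a \<in> Ev" "b \<in> Od" "x = a \<oplus> b"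
  using assms parts_sum unfolding set_add_def' by blast

lemma even_component_unique:
  assumes "x \<in> Ev" "a \<in> Ev" "b \<in> Od" "x = a \<oplus> b" shows "x = a"
proof -
  have c: "x \<in> carrier R" "a \<in> carrier R" "b \<in> carrier R" using assms part_closed by auto
  have "b = \<ominus> a \<oplus> x" using assms(4) c r_neg1 by simp
  then have "b \<in> Ev" using assms(1,2) part_closed(5,7) by metis
  then have "b = \<zero>" using assms(3) parts_inter by auto
  then show ?thesis using assms(4) c by simp
qed

text \<open>\<open>r'\<close> is \<open>r\<close>, with the sign of its odd component changed if
  \<open>h\<close> is odd. This is why the products of homogeneous elements with an ideal span a
  two-sided ideal.\<close>

lemma homogeneous_commute:
  assumes "h \<in> Ev \<union> Od" "r \<in> carrier R"
  shows "\<exists>r'\<in>carrier R. r \<otimes> h = h \<otimes> r'"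
proof -
  obtain a b where r: "a \<in> Ev" "b \<in> Od" "r = a \<oplus> b" using decompose assms(2) .
  have c: "a \<in> carrier R" "b \<in> carrier R" "h \<in> carrier R" using r assms part_closed by auto
  show ?thesis
  proof (cases "h \<in> Ev")
    case True
    then have "r \<otimes> h = h \<otimes> r" using r c even_comm[of h a] even_comm[of h b] by (simp add: l_distr r_distr)
    then show ?thesis using assms by blast
  next
    case False
    then have h: "h \<in> Od" using assms by auto
    have "r \<otimes> h = h \<otimes> (a \<oplus> \<ominus> b)"
      using r c even_comm[of a h] odd_anticomm[of b h] h by (simp add: l_distr r_distr r_minus)
    then show ?thesis using c by auto
  qed
qed

lemma ideal_prod_homogeneous:
  assumes H: "H \<subseteq> Ev \<union> Od" "H \<noteq> {}" and J: "ideal J R"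
  shows "ideal (ideal_prod R H J) R"
proof (rule idealI[OF ring_axioms])
  have Hc: "h \<in> carrier R" if "h \<in> H" for h using that H part_closed by auto
  have car: "x \<in> carrier R" if "x \<in> ideal_prod R H J" for x
    using that by induction (use Hc idealD(1)[OF J] in auto)
  have neg: "\<ominus> x \<in> ideal_prod R H J" if "x \<in> ideal_prod R H J" for x
    using that
  proof induction
    case (prod i j)
    have "\<ominus> (i \<otimes> j) = i \<otimes> (\<ominus> j)" using Hc[OF prod(1)] idealD(1)[OF J prod(2)] by (simp add: r_minus)
    then show ?case using ideal_prod.prod[OF prod(1) idealD(4)[OF J prod(2)]] by simp
  next
    case (sum x y)
    then show ?case using car ideal_prod.sum[of _ R] by (simp add: minus_add)
  qed
  obtain h where h: "h \<in> H" using H by blast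
  have "h \<otimes> \<zero> \<in> ideal_prod R H J" using ideal_prod.prod[OF h idealD(2)[OF J]] .
  then have zero: "\<zero> \<in> ideal_prod R H J" using Hc[OF h] by simp
  show "subgroup (ideal_prod R H J) (add_monoid R)"
    by (rule subgroup.intro) (use car neg zero ideal_prod.sum[of _ R] in \<open>auto simp flip: a_inv_def\<close>)
  fix a x assume a: "a \<in> ideal_prod R H J" and x: "x \<in> carrier R"
  show "x \<otimes> a \<in> ideal_prod R H J"
    using a
  proof induction
    case (prod i j)
    obtain r' where r': "r' \<in> carrier R" "x \<otimes> i = i \<otimes> r'"
      using homogeneous_commute[of i x] prod(1) H x by blast
    have "x \<otimes> (i \<otimes> j) = i \<otimes> (r' \<otimes> j)"
      using r' x Hc[OF prod(1)] idealD(1)[OF J prod(2)] by (simp flip: m_assoc)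
    then show ?case using ideal_prod.prod[OF prod(1) idealD(6)[OF J prod(2) r'(1)]] by simp
  next
    case (sum s t)
    then show ?case using car x ideal_prod.sum[of _ R] by (simp add: r_distr)
  qed
  show "a \<otimes> x \<in> ideal_prod R H J"
    using a
  proof induction
    case (prod i j)
    have "i \<otimes> j \<otimes> x = i \<otimes> (j \<otimes> x)" using x Hc[OF prod(1)] idealD(1)[OF J prod(2)] by (simp add: m_assoc)
    then show ?case using ideal_prod.prod[OF prod(1) idealD(7)[OF J prod(2) x]] by simp
  next
    case (sum s t)
    then show ?case using car x ideal_prod.sum[of _ R] by (simp add: l_distr)
  qed
qed

end

section \<open>The filtration by bidegrees\<close>

locale super_ring_ideal = super_ring R for R :: "('a, 'b) super_ring_scheme" (structure) +
  fixes N :: "'a set"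
  assumes superideal: "superideal N R"
begin

abbreviation "Bi \<equiv> bipower R N"
abbreviation "Nx \<equiv> bipower_next R N"
abbreviation "S \<equiv> bgr R N"

lemma ideal_N: "ideal N R" using superideal by (simp add: superideal_def)

lemma Bi_0_0: "Bi 0 0 = carrier R" by (simp add: bipower_def)
lemma Bi_0_Suc: "Bi 0 (Suc l) = ideal_prod R (N \<inter> Od) (Bi 0 l)" by (simp add: bipower_def)
lemma Bi_Suc: "Bi (Suc k) l = ideal_prod R (N \<inter> Ev) (Bi k l)" by (simp add: bipower_def)

lemma ideal_Bi: "ideal (Bi k l) R"
proof (induction k)
  case 0
  show ?case
  proof (induction l)
    case (Suc l)
    have "\<zero> \<in> N \<inter> Od" using idealD(2)[OF ideal_N] part_closed by auto
    then show ?case using ideal_prod_homogeneous[of "N \<inter> Od", OF _ _ Suc] by (auto simp: Bi_0_Suc)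
  qed (simp add: Bi_0_0 oneideal)
next
  case (Suc k)
  have "\<zero> \<in> N \<inter> Ev" using idealD(2)[OF ideal_N] part_closed by auto
  then show ?case using ideal_prod_homogeneous[of "N \<inter> Ev", OF _ _ Suc] by (auto simp: Bi_Suc)
qed

lemma Bi_closed:
  "x \<in> Bi k l \<Longrightarrow> x \<in> carrier R" "\<zero> \<in> Bi k l" "\<lbrakk>x \<in> Bi k l; y \<in> Bi k l\<rbrakk> \<Longrightarrow> x \<oplus> y \<in> Bi k l"
  "x \<in> Bi k l \<Longrightarrow> \<ominus> x \<in> Bi k l"
  using idealD[OF ideal_Bi] by blast+

lemma N0_mult: "\<lbrakk>h \<in> N \<inter> Ev; x \<in> Bi k l\<rbrakk> \<Longrightarrow> h \<otimes> x \<in> Bi (Suc k) l"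
  unfolding Bi_Suc by (rule ideal_prod.prod)

text \<open>In \<open>bipower\<close> the even factors are applied outermost, so the odd factor has
  to be moved past them, which even elements permit without a sign.\<close>

lemma N1_mult: assumes "h \<in> N \<inter> Od" "x \<in> Bi k l" shows "h \<otimes> x \<in> Bi k (Suc l)"
  using assms(2)
proof (induction k arbitrary: x)
  case 0
  then show ?case unfolding Bi_0_Suc using assms(1) by (intro ideal_prod.prod)
next
  case (Suc k)
  have hc: "h \<in> carrier R" using assms part_closed by auto
  have car: "z \<in> carrier R" if "z \<in> ideal_prod R (N \<inter> Ev) (Bi k l)" for z
    using that Bi_closed(1)[of z "Suc k" l] unfolding Bi_Suc by blast
  show ?case
    using Suc.prems unfolding Bi_Suc[of k l]
  proof induction
    case (prod i j)
    have ic: "i \<in> carrier R" using prod part_closed by auto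
    have jc: "j \<in> carrier R" using Bi_closed(1)[OF prod(2)] .
    have "h \<otimes> i = i \<otimes> h" using prod(1) assms(1) even_comm[of i h] by auto
    then have "h \<otimes> (i \<otimes> j) = i \<otimes> (h \<otimes> j)" using hc ic jc by (simp flip: m_assoc)
    then show ?case using N0_mult[OF prod(1) Suc.IH[OF prod(2)]] by simp
  next
    case (sum s t)
    then show ?case using car hc Bi_closed(3)[of "h \<otimes> s" "Suc k" "Suc l" "h \<otimes> t"] by (simp add: r_distr)
  qed
qed

lemma Bi_mult: assumes "a \<in> Bi k l" "b \<in> Bi k' l'" shows "a \<otimes> b \<in> Bi (k + k') (l + l')"
  using assms(1)
proof (induction k arbitrary: a)
  case 0
  show ?case
    using 0
  proof (induction l arbitrary: a)
    case 0
    then show ?case using idealD(6)[OF ideal_Bi assms(2)] by (simp add: Bi_0_0)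
  next
    case (Suc l)
    have car: "z \<in> carrier R" if "z \<in> ideal_prod R (N \<inter> Od) (Bi 0 l)" for z
      using that Bi_closed(1)[of z 0 "Suc l"] unfolding Bi_0_Suc by blast
    have bc: "b \<in> carrier R" using Bi_closed(1)[OF assms(2)] .
    show ?case
      using Suc.prems unfolding Bi_0_Suc
    proof induction
      case (prod i j)
      have "i \<otimes> j \<otimes> b = i \<otimes> (j \<otimes> b)" using prod bc part_closed Bi_closed(1)[OF prod(2)] by (simp add: m_assoc)
      then show ?case using N1_mult[OF prod(1) Suc.IH[OF prod(2)]] by simp
    next
      case (sum s t)
      then show ?case using car bc Bi_closed(3)[of "s \<otimes> b" _ _ "t \<otimes> b"] by (simp add: l_distr)
    qed
  qed
next
  case (Suc k)
  have car: "z \<in> carrier R" if "z \<in> ideal_prod R (N \<inter> Ev) (Bi k l)" for z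
    using that Bi_closed(1)[of z "Suc k" l] unfolding Bi_Suc by blast
  have bc: "b \<in> carrier R" using Bi_closed(1)[OF assms(2)] .
  show ?case
    using Suc.prems unfolding Bi_Suc[of k l]
  proof induction
    case (prod i j)
    have "i \<otimes> j \<otimes> b = i \<otimes> (j \<otimes> b)" using prod bc part_closed Bi_closed(1)[OF prod(2)] by (simp add: m_assoc)
    then show ?case using N0_mult[OF prod(1) Suc.IH[OF prod(2)]] by simp
  next
    case (sum s t)
    then show ?case using car bc Bi_closed(3)[of "s \<otimes> b" _ _ "t \<otimes> b"] by (simp add: l_distr)
  qed
qed

lemma Bi_Suc_subset: "Bi (Suc k) l \<subseteq> Bi k l"
proof
  fix x assume "x \<in> Bi (Suc k) l"
  then show "x \<in> Bi k l"
    unfolding Bi_Suc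
  proof induction
    case (prod i j)
    then show ?case using idealD(6)[OF ideal_Bi prod(2)] part_closed by auto
  qed (rule Bi_closed(3))
qed

lemma Bi_Suc2_subset: "Bi k (Suc l) \<subseteq> Bi k l"
proof (induction k)
  case 0
  show ?case
  proof
    fix x assume "x \<in> Bi 0 (Suc l)"
    then show "x \<in> Bi 0 l"
      unfolding Bi_0_Suc
    proof induction
      case (prod i j)
      then show ?case using idealD(6)[OF ideal_Bi prod(2)] part_closed by auto
    qed (rule Bi_closed(3))
  qed
next
  case (Suc k)
  show ?case
  proof
    fix x assume "x \<in> Bi (Suc k) (Suc l)"
    then show "x \<in> Bi (Suc k) l"
      unfolding Bi_Suc[of k "Suc l"]
    proof induction
      case (prod i j)
      then show ?case using N0_mult Suc by blast
    qed (rule Bi_closed(3))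
  qed
qed

lemma mem_Nx: "x \<in> Nx k l \<longleftrightarrow> (\<exists>a\<in>Bi (Suc k) l. \<exists>b\<in>Bi k (Suc l). x = a \<oplus> b)"
  by (auto simp: bipower_next_def set_add_def')

lemma ideal_Nx: "ideal (Nx k l) R"
  unfolding bipower_next_def by (rule add_ideals[OF ideal_Bi ideal_Bi])

lemma Nx_closed:
  "x \<in> Nx k l \<Longrightarrow> x \<in> carrier R" "\<zero> \<in> Nx k l" "\<lbrakk>x \<in> Nx k l; y \<in> Nx k l\<rbrakk> \<Longrightarrow> x \<oplus> y \<in> Nx k l"
  "x \<in> Nx k l \<Longrightarrow> \<ominus> x \<in> Nx k l"
  using idealD[OF ideal_Nx] by blast+

lemma Bi_in_Nx: "x \<in> Bi (Suc k) l \<Longrightarrow> x \<in> Nx k l" "x \<in> Bi k (Suc l) \<Longrightarrow> x \<in> Nx k l"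
  unfolding mem_Nx using Bi_closed(1,2) r_zero l_zero by metis+

lemma Nx_mult_left: assumes "x \<in> Nx i j" "b \<in> Bi k l" shows "x \<otimes> b \<in> Nx (i + k) (j + l)"
proof -
  obtain u v where uv: "u \<in> Bi (Suc i) j" "v \<in> Bi i (Suc j)" "x = u \<oplus> v" using assms mem_Nx by auto
  have "u \<otimes> b \<in> Bi (Suc (i + k)) (j + l)" "v \<otimes> b \<in> Bi (i + k) (Suc (j + l))"
    using Bi_mult[OF uv(1) assms(2)] Bi_mult[OF uv(2) assms(2)] by simp_all
  moreover have "x \<otimes> b = u \<otimes> b \<oplus> v \<otimes> b" using uv assms Bi_closed(1) by (metis l_distr)
  ultimately show ?thesis unfolding mem_Nx by blast
qed

lemma Nx_mult_right: assumes "x \<in> Nx i j" "b \<in> Bi k l" shows "b \<otimes> x \<in> Nx (k + i) (l + j)"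
proof -
  obtain u v where uv: "u \<in> Bi (Suc i) j" "v \<in> Bi i (Suc j)" "x = u \<oplus> v" using assms mem_Nx by auto
  have "b \<otimes> u \<in> Bi (Suc (k + i)) (l + j)" "b \<otimes> v \<in> Bi (k + i) (Suc (l + j))"
    using Bi_mult[OF assms(2) uv(1)] Bi_mult[OF assms(2) uv(2)] by simp_all
  moreover have "b \<otimes> x = b \<otimes> u \<oplus> b \<otimes> v" using uv assms Bi_closed(1) by (metis r_distr)
  ultimately show ?thesis unfolding mem_Nx by blast
qed

lemma Nx_coset_eq_iff:
  "\<lbrakk>a \<in> carrier R; b \<in> carrier R\<rbrakk> \<Longrightarrow> Nx k l +> a = Nx k l +> b \<longleftrightarrow> a \<ominus> b \<in> Nx k l"
  using quotient_eq_iff_same_a_r_cos[OF ideal_Nx] by blast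

lemma Nx_coset_zero: "Nx k l +> \<zero> = Nx k l"
  using a_coset_add_zero Nx_closed(1) by blast

text \<open>Elements of the bigraded ring are handled through families of representatives in
  \<open>R\<close>. Almost all representatives, not merely their classes, are zero, which permits
  induction on the support. The set \<open>E\<close> will be the carrier or one of the two
  parts.\<close>

definition rep :: "'a set \<Rightarrow> (nat \<Rightarrow> nat \<Rightarrow> 'a) \<Rightarrow> bool" where
  "rep E p \<longleftrightarrow> (\<forall>k l. p k l \<in> E \<inter> Bi k l) \<and> finite {(k, l). p k l \<noteq> \<zero>}"

definition cls :: "(nat \<Rightarrow> nat \<Rightarrow> 'a) \<Rightarrow> nat \<Rightarrow> nat \<Rightarrow> 'a set" where
  "cls p = (\<lambda>k l. Nx k l +> p k l)"

definition conv :: "(nat \<Rightarrow> nat \<Rightarrow> 'a) \<Rightarrow> (nat \<Rightarrow> nat \<Rightarrow> 'a) \<Rightarrow> nat \<Rightarrow> nat \<Rightarrow> 'a" where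
  "conv p q k l = finsum R (\<lambda>(i, j). p i j \<otimes> q (k - i) (l - j)) ({..k} \<times> {..l})"

lemma families_eq:
  assumes "\<zero> \<in> E" shows "bgr_families R N E = cls ` {p. rep E p}"
proof
  show "cls ` {p. rep E p} \<subseteq> bgr_families R N E"
  proof
    fix f assume "f \<in> cls ` {p. rep E p}"
    then obtain p where p: "rep E p" "f = cls p" by auto
    have "{(k, l). f k l \<noteq> Nx k l} \<subseteq> {(k, l). p k l \<noteq> \<zero>}"
      unfolding p(2) cls_def using Nx_coset_zero by auto
    then have "finite {(k, l). f k l \<noteq> Nx k l}" using p(1) finite_subset unfolding rep_def by blast
    moreover have "\<forall>k l. \<exists>a\<in>E \<inter> Bi k l. f k l = Nx k l +> a" using p unfolding rep_def cls_def by blast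
    ultimately show "f \<in> bgr_families R N E" unfolding bgr_families_def by blast
  qed
  show "bgr_families R N E \<subseteq> cls ` {p. rep E p}"
  proof
    fix f assume "f \<in> bgr_families R N E"
    then have f: "\<forall>k l. \<exists>a\<in>E \<inter> Bi k l. f k l = Nx k l +> a" and fin: "finite {(k, l). f k l \<noteq> Nx k l}"
      unfolding bgr_families_def by blast+
    obtain p where p: "\<And>k l. p k l \<in> E \<inter> Bi k l" "\<And>k l. f k l = Nx k l +> p k l" using f by metis
    \<comment> \<open>A vanishing class may have received a nonzero representative; exchanging it
      for \<open>\<zero>\<close> makes the support finite.\<close>
    define p' where "p' k l = (if f k l = Nx k l then \<zero> else p k l)" for k l
    have "rep E p'"
      unfolding rep_def
    proof
      show "\<forall>k l. p' k l \<in> E \<inter> Bi k l" using p assms Bi_closed(2) by (simp add: p'_def)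
      have "{(k, l). p' k l \<noteq> \<zero>} \<subseteq> {(k, l). f k l \<noteq> Nx k l}" by (auto simp: p'_def)
      then show "finite {(k, l). p' k l \<noteq> \<zero>}" using fin finite_subset by blast
    qed
    moreover have "f = cls p'"
      unfolding cls_def
    proof (intro ext)
      fix k l show "f k l = Nx k l +> p' k l"
        using p(2)[of k l] Nx_coset_zero[of k l] by (cases "f k l = Nx k l") (simp_all add: p'_def)
    qed
    ultimately show "f \<in> cls ` {p. rep E p}" by blast
  qed
qed

lemma rep_carrier: "rep E p \<Longrightarrow> rep (carrier R) p"
  unfolding rep_def using Bi_closed(1) by blast

lemma rep_Bi: "rep E p \<Longrightarrow> p k l \<in> Bi k l" "rep E p \<Longrightarrow> p k l \<in> carrier R" "rep E p \<Longrightarrow> p k l \<in> E"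
  unfolding rep_def using Bi_closed(1) by blast+

lemma conv_terms: "\<lbrakk>rep E p; rep E' q\<rbrakk> \<Longrightarrow>
  (\<lambda>(i, j). p i j \<otimes> q (k - i) (l - j)) \<in> ({..k} \<times> {..l}) \<rightarrow> carrier R"
  using rep_Bi(2) by (auto intro!: m_closed)

lemma finsum_in_additive:
  assumes "H \<subseteq> carrier R" "\<zero> \<in> H" "\<And>x y. \<lbrakk>x \<in> H; y \<in> H\<rbrakk> \<Longrightarrow> x \<oplus> y \<in> H"
    and "finite A" "\<And>i. i \<in> A \<Longrightarrow> f i \<in> H"
  shows "finsum R f A \<in> H"
  using assms(4,5)
proof (induction A rule: finite_induct)
  case (insert x F)
  have "f \<in> F \<rightarrow> carrier R" "f x \<in> carrier R" using insert.prems assms(1) by auto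
  then have "finsum R f (insert x F) = f x \<oplus> finsum R f F" using insert.hyps by simp
  then show ?case using insert assms(3) by simp
qed (use assms(2) in simp)

lemma rep_conv:
  assumes p: "rep E p" and q: "rep E' q"
    and E: "E'' \<subseteq> carrier R" "\<zero> \<in> E''" "\<And>x y. \<lbrakk>x \<in> E''; y \<in> E''\<rbrakk> \<Longrightarrow> x \<oplus> y \<in> E''"
    and m: "\<And>a b. \<lbrakk>a \<in> E; b \<in> E'\<rbrakk> \<Longrightarrow> a \<otimes> b \<in> E''"
  shows "rep E'' (conv p q)"
  unfolding rep_def
proof (intro conjI allI)
  fix k l
  show "conv p q k l \<in> E'' \<inter> Bi k l"
    unfolding conv_def
  proof (rule finsum_in_additive)
    show "E'' \<inter> Bi k l \<subseteq> carrier R" "\<zero> \<in> E'' \<inter> Bi k l" using E Bi_closed by auto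
    show "x \<oplus> y \<in> E'' \<inter> Bi k l" if "x \<in> E'' \<inter> Bi k l" "y \<in> E'' \<inter> Bi k l" for x y
      using that E Bi_closed by auto
    fix ij assume "ij \<in> {..k} \<times> {..l}"
    then obtain i j where ij: "ij = (i, j)" "i \<le> k" "j \<le> l" by auto
    have "p i j \<otimes> q (k - i) (l - j) \<in> Bi (i + (k - i)) (j + (l - j))"
      using Bi_mult rep_Bi(1)[OF p] rep_Bi(1)[OF q] by blast
    then show "(case ij of (i, j) \<Rightarrow> p i j \<otimes> q (k - i) (l - j)) \<in> E'' \<inter> Bi k l"
      using ij m rep_Bi(3)[OF p] rep_Bi(3)[OF q] by auto
  qed simp
next
  have "finite {(k, l). p k l \<noteq> \<zero>}" "finite {(k, l). q k l \<noteq> \<zero>}" using p q by (auto simp: rep_def)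
  then have fin: "finite ({(k, l). p k l \<noteq> \<zero>} \<union> {(k, l). q k l \<noteq> \<zero>})" (is "finite ?U") by simp
  \<comment> \<open>\<open>B\<close> bounds the indices in both supports, so a nonzero term of the
    convolution has both degrees at most \<open>2 * B\<close>. The inserted 0 keeps the maximum
    meaningful for empty supports.\<close>
  define B where "B = Max (insert 0 (fst ` ?U \<union> snd ` ?U))"
  have B: "k \<le> B \<and> l \<le> B" if "p k l \<noteq> \<zero> \<or> q k l \<noteq> \<zero>" for k l
  proof -
    have "(k, l) \<in> ?U" using that by auto
    then have "k \<in> insert 0 (fst ` ?U \<union> snd ` ?U)" "l \<in> insert 0 (fst ` ?U \<union> snd ` ?U)" by force+
    then show ?thesis unfolding B_def using fin by (auto intro!: Max_ge)
  qed
  have "{(k, l). conv p q k l \<noteq> \<zero>} \<subseteq> {..2 * B} \<times> {..2 * B}"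
  proof
    fix z assume "z \<in> {(k, l). conv p q k l \<noteq> \<zero>}"
    then obtain k l where z: "z = (k, l)" and nz: "conv p q k l \<noteq> \<zero>" by blast
    have "\<exists>i\<le>k. \<exists>j\<le>l. p i j \<otimes> q (k - i) (l - j) \<noteq> \<zero>"
    proof (rule ccontr)
      assume "\<not> ?thesis"
      then have "conv p q k l = finsum R (\<lambda>_. \<zero>) ({..k} \<times> {..l})"
        unfolding conv_def by (intro add.finprod_cong') auto
      then show False using nz by simp
    qed
    then obtain i j where ij: "i \<le> k" "j \<le> l" "p i j \<otimes> q (k - i) (l - j) \<noteq> \<zero>" by blast
    then have "p i j \<noteq> \<zero>" "q (k - i) (l - j) \<noteq> \<zero>" using rep_Bi(2)[OF p] rep_Bi(2)[OF q] by auto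
    then have "i \<le> B" "j \<le> B" "k - i \<le> B" "l - j \<le> B" using B by blast+
    then show "z \<in> {..2 * B} \<times> {..2 * B}" using z by auto
  qed
  then show "finite {(k, l). conv p q k l \<noteq> \<zero>}" using finite_subset by blast
qed

text \<open>The factors are cosets of ideals that belong to other bidegrees, and
  \<open>rcoset_mult\<close> collects the target cosets of all products of their elements. There is
  only one such coset, because a change of representatives alters the product by
  \<open>u \<otimes> (v \<oplus> b) \<oplus> a \<otimes> v\<close>.\<close>

lemma rcoset_mult_Nx:
  assumes "a \<in> Bi i j" "b \<in> Bi k l"
  shows "rcoset_mult R (Nx (i + k) (j + l)) (Nx i j +> a) (Nx k l +> b) = Nx (i + k) (j + l) +> (a \<otimes> b)"
proof -
  have c: "a \<in> carrier R" "b \<in> carrier R" using assms Bi_closed by auto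
  have const: "Nx (i + k) (j + l) +> (x \<otimes> y) = Nx (i + k) (j + l) +> (a \<otimes> b)"
    if x: "x \<in> Nx i j +> a" and y: "y \<in> Nx k l +> b" for x y
  proof -
    obtain u v where uv: "u \<in> Nx i j" "x = u \<oplus> a" "v \<in> Nx k l" "y = v \<oplus> b"
      using x y unfolding a_r_coset_def' by blast
    have uvc: "u \<in> carrier R" "v \<in> carrier R" using uv Nx_closed by auto
    have vB: "v \<oplus> b \<in> Bi k l"
    proof -
      obtain v1 v2 where "v1 \<in> Bi (Suc k) l" "v2 \<in> Bi k (Suc l)" "v = v1 \<oplus> v2"
        using uv(3) unfolding mem_Nx by auto
      then have "v \<in> Bi k l" using subsetD[OF Bi_Suc_subset] subsetD[OF Bi_Suc2_subset] Bi_closed(3) by metis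
      then show ?thesis using assms Bi_closed(3) by blast
    qed
    have "u \<otimes> (v \<oplus> b) \<in> Nx (i + k) (j + l)" "a \<otimes> v \<in> Nx (i + k) (j + l)"
      using Nx_mult_left[OF uv(1) vB] Nx_mult_right[OF uv(3) assms(1)] .
    then have "u \<otimes> (v \<oplus> b) \<oplus> a \<otimes> v \<in> Nx (i + k) (j + l)" by (rule Nx_closed(3))
    moreover have "x \<otimes> y \<ominus> a \<otimes> b = u \<otimes> (v \<oplus> b) \<oplus> a \<otimes> v"
      unfolding uv(2,4) using c uvc
      by (simp add: l_distr r_distr minus_eq a_assoc r_neg a_comm[of "a \<otimes> v" "u \<otimes> b"])
    ultimately show ?thesis using Nx_coset_eq_iff c uvc uv by simp
  qed
  have self: "a \<in> Nx i j +> a" "b \<in> Nx k l +> b"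
    using Nx_closed(2) c by (auto simp: a_r_coset_def' intro!: bexI[of _ \<zero>])
  show ?thesis
    unfolding rcoset_mult_def
    by (rule subset_antisym; intro UN_least subsetI) (simp add: const, rule UN_I[OF self(1) UN_I[OF self(2)]])
qed

text \<open>Passing to the quotient is a ring homomorphism, so the convolution sum may be formed in
  \<open>R\<close> before taking classes.\<close>

lemma cls_mult:
  assumes p: "rep E p" and q: "rep E' q"
  shows "cls p \<otimes>\<^bsub>S\<^esub> cls q = cls (conv p q)"
proof (intro ext)
  fix k l
  let ?A = "{..k} \<times> {..l}" and ?Q = "R Quot Nx k l"
  interpret h: ring_hom_ring R ?Q "(+>) (Nx k l)" by (rule ideal.rcos_ring_hom_ring[OF ideal_Nx])
  have "(cls p \<otimes>\<^bsub>S\<^esub> cls q) k l =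
      finsum ?Q (\<lambda>(i, j). rcoset_mult R (Nx k l) (cls p i j) (cls q (k - i) (l - j))) ?A"
    by (simp add: bgr_def)
  also have "\<dots> = finsum ?Q ((\<lambda>x. Nx k l +> x) \<circ> (\<lambda>(i, j). p i j \<otimes> q (k - i) (l - j))) ?A"
  proof (rule h.S.add.finprod_cong'[OF refl])
    show "(+>) (Nx k l) \<circ> (\<lambda>(i, j). p i j \<otimes> q (k - i) (l - j)) \<in> ?A \<rightarrow> carrier ?Q"
      using conv_terms[OF p q, of k l] h.hom_closed by (auto simp: Pi_def)
    fix ij assume "ij \<in> ?A"
    then obtain i j where ij: "ij = (i, j)" "i + (k - i) = k" "j + (l - j) = l" by auto
    have "rcoset_mult R (Nx k l) (cls p i j) (cls q (k - i) (l - j)) = Nx k l +> (p i j \<otimes> q (k - i) (l - j))"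
      using rcoset_mult_Nx[OF rep_Bi(1)[OF p, of i j] rep_Bi(1)[OF q, of "k - i" "l - j"]]
      unfolding ij(2,3) cls_def .
    then show "(case ij of (i, j) \<Rightarrow> rcoset_mult R (Nx k l) (cls p i j) (cls q (k - i) (l - j))) =
        ((+>) (Nx k l) \<circ> (\<lambda>(i, j). p i j \<otimes> q (k - i) (l - j))) ij" using ij by simp
  qed
  also have "\<dots> = Nx k l +> conv p q k l"
    unfolding conv_def using h.hom_finsum[OF conv_terms[OF p q, of k l]] by simp
  finally show "(cls p \<otimes>\<^bsub>S\<^esub> cls q) k l = cls (conv p q) k l" by (simp add: cls_def)
qed

lemma cls_add:
  assumes "rep E p" "rep E' q"
  shows "cls p \<oplus>\<^bsub>S\<^esub> cls q = cls (\<lambda>k l. p k l \<oplus> q k l)"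
  using ideal.a_rcos_sum[OF ideal_Nx] rep_Bi(2)[OF assms(1)] rep_Bi(2)[OF assms(2)]
  by (simp add: bgr_def cls_def)

lemma cls_zero: "\<zero>\<^bsub>S\<^esub> = cls (\<lambda>_ _. \<zero>)"
  by (simp add: bgr_def cls_def Nx_coset_zero)

definition homog :: "nat \<Rightarrow> nat \<Rightarrow> 'a \<Rightarrow> nat \<Rightarrow> nat \<Rightarrow> 'a set" where
  "homog k l a = cls (\<lambda>i j. if i = k \<and> j = l then a else \<zero>)"

lemma rep_single:
  assumes "\<zero> \<in> E" "a \<in> E" "a \<in> Bi k l" shows "rep E (\<lambda>i j. if i = k \<and> j = l then a else \<zero>)"
proof -
  have "{(i, j). (if i = k \<and> j = l then a else \<zero>) \<noteq> \<zero>} \<subseteq> {(k, l)}" by auto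
  then have "finite {(i, j). (if i = k \<and> j = l then a else \<zero>) \<noteq> \<zero>}" by (rule finite_subset) simp
  then show ?thesis unfolding rep_def using assms Bi_closed(2) by simp
qed

lemma one_S: "\<one>\<^bsub>S\<^esub> = homog 0 0 \<one>"
  by (simp add: bgr_def homog_def cls_def, intro ext) (simp add: Nx_coset_zero)

lemma rep_add:
  assumes "rep E p" "rep E q" "\<And>x y. \<lbrakk>x \<in> E; y \<in> E\<rbrakk> \<Longrightarrow> x \<oplus> y \<in> E"
  shows "rep E (\<lambda>k l. p k l \<oplus> q k l)"
proof -
  have "{(k, l). p k l \<oplus> q k l \<noteq> \<zero>} \<subseteq> {(k, l). p k l \<noteq> \<zero>} \<union> {(k, l). q k l \<noteq> \<zero>}" by auto
  then show ?thesis using assms Bi_closed(3) unfolding rep_def by (auto intro: finite_subset)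
qed

lemma carrier_S: "carrier S = cls ` {p. rep (carrier R) p}"
  and even_S: "even_part S = cls ` {p. rep Ev p}"
  and odd_S: "odd_part S = cls ` {p. rep Od p}"
  using families_eq part_closed by (simp_all add: bgr_def)

lemma conv_single:
  assumes "rep E q" "a \<in> carrier R"
  shows "conv (\<lambda>i j. if i = k \<and> j = l then a else \<zero>) q m n =
    (if k \<le> m \<and> l \<le> n then a \<otimes> q (m - k) (n - l) else \<zero>)"
proof -
  have qc: "q i j \<in> carrier R" for i j using rep_Bi(2)[OF assms(1)] .
  have "conv (\<lambda>i j. if i = k \<and> j = l then a else \<zero>) q m n =
      finsum R (\<lambda>ij. if ij = (k, l) then a \<otimes> q (m - fst ij) (n - snd ij) else \<zero>) ({..m} \<times> {..n})"
    unfolding conv_def using qc assms(2) by (intro add.finprod_cong') (auto split: if_splits)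
  also have "\<dots> = (if k \<le> m \<and> l \<le> n then a \<otimes> q (m - k) (n - l) else \<zero>)"
  proof (cases "k \<le> m \<and> l \<le> n")
    case True
    then show ?thesis
      using add.finprod_singleton_swap[of "(k, l)" "{..m} \<times> {..n}" "\<lambda>ij. a \<otimes> q (m - fst ij) (n - snd ij)"]
        qc assms(2) by auto
  next
    case False
    then have "finsum R (\<lambda>ij. if ij = (k, l) then a \<otimes> q (m - fst ij) (n - snd ij) else \<zero>) ({..m} \<times> {..n}) =
      finsum R (\<lambda>_. \<zero>) ({..m} \<times> {..n})" by (intro add.finprod_cong') auto
    then show ?thesis using False by auto
  qed
  finally show ?thesis .
qed

lemma homog_mult:
  assumes "a \<in> Bi k l" "b \<in> Bi k' l'"
  shows "homog k l a \<otimes>\<^bsub>S\<^esub> homog k' l' b = homog (k + k') (l + l') (a \<otimes> b)"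
proof -
  have c: "a \<in> carrier R" "b \<in> carrier R" using assms Bi_closed by auto
  have r: "rep (carrier R) (\<lambda>i j. if i = k' \<and> j = l' then b else \<zero>)"
    "rep (carrier R) (\<lambda>i j. if i = k \<and> j = l then a else \<zero>)" using assms c by (auto intro: rep_single)
  have "conv (\<lambda>i j. if i = k \<and> j = l then a else \<zero>) (\<lambda>i j. if i = k' \<and> j = l' then b else \<zero>) =
      (\<lambda>i j. if i = k + k' \<and> j = l + l' then a \<otimes> b else \<zero>)"
    by (intro ext, subst conv_single[OF r(1) c(1)]) (use c in auto)
  then show ?thesis unfolding homog_def cls_mult[OF r(2,1)] by simp
qed

lemma homog_add:
  assumes "a \<in> Bi k l" "b \<in> Bi k l"
  shows "homog k l a \<oplus>\<^bsub>S\<^esub> homog k l b = homog k l (a \<oplus> b)"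
proof -
  have c: "a \<in> carrier R" "b \<in> carrier R" using assms Bi_closed by auto
  have r: "rep (carrier R) (\<lambda>i j. if i = k \<and> j = l then a else \<zero>)"
    "rep (carrier R) (\<lambda>i j. if i = k \<and> j = l then b else \<zero>)" using assms c by (auto intro: rep_single)
  show ?thesis unfolding homog_def cls_add[OF r] by (rule arg_cong[of _ _ cls], intro ext) auto
qed

lemma homog_zero: "homog k l \<zero> = \<zero>\<^bsub>S\<^esub>"
  unfolding homog_def cls_zero by (rule arg_cong[of _ _ cls]) auto

lemma homog_eq_zero: assumes "a \<in> Nx k l" shows "homog k l a = \<zero>\<^bsub>S\<^esub>"
proof -
  have "a \<ominus> \<zero> \<in> Nx k l" using assms Nx_closed by (simp add: minus_eq)
  then have "Nx k l +> a = Nx k l +> \<zero>" using Nx_coset_eq_iff Nx_closed(1)[OF assms] by simp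
  then show ?thesis by (simp add: homog_def cls_def bgr_def, intro ext) (simp add: Nx_coset_zero)
qed

lemma homog_closed:
  "\<lbrakk>a \<in> Bi k l\<rbrakk> \<Longrightarrow> homog k l a \<in> carrier S"
  "\<lbrakk>a \<in> Bi k l; a \<in> Ev\<rbrakk> \<Longrightarrow> homog k l a \<in> even_part S"
  "\<lbrakk>a \<in> Bi k l; a \<in> Od\<rbrakk> \<Longrightarrow> homog k l a \<in> odd_part S"
  unfolding carrier_S even_S odd_S homog_def
  using rep_single[of "carrier R" a k l] rep_single[of Ev a k l] rep_single[of Od a k l]
    Bi_closed(1) part_closed by auto

text \<open>One entry of the finite support is split off at a time. The set \<open>E\<close> keeps
  track of the parity, so even elements are built from even homogeneous ones and odd elements from
  odd ones.\<close>

lemma homog_induct: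
  assumes "rep E p" "\<zero> \<in> E"
    and m: "\<And>k l a. \<lbrakk>a \<in> E; a \<in> Bi k l\<rbrakk> \<Longrightarrow> Q (homog k l a)"
    and s: "\<And>f g. \<lbrakk>f \<in> cls ` {p. rep E p}; g \<in> cls ` {p. rep E p}; Q f; Q g\<rbrakk> \<Longrightarrow> Q (f \<oplus>\<^bsub>S\<^esub> g)"
  shows "Q (cls p)"
proof -
  define D where "D = {(k, l). p k l \<noteq> \<zero>}"
  have "finite D" using assms(1) unfolding D_def rep_def by blast
  then show ?thesis using D_def assms(1)
  proof (induction D arbitrary: p rule: finite_induct)
    case empty
    then have "p = (\<lambda>_ _. \<zero>)" by fastforce
    then show ?case using m[OF assms(2), of 0 0] Bi_closed(2) by (simp add: homog_zero cls_zero)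
  next
    case (insert x F)
    obtain k l where x: "x = (k, l)" by (cases x)
    define p' where "p' i j = (if i = k \<and> j = l then \<zero> else p i j)" for i j
    define u where "u i j = (if i = k \<and> j = l then p k l else \<zero>)" for i j
    have "F = {(i, j). p' i j \<noteq> \<zero>}" using insert.prems(1) insert.hyps(2) unfolding x p'_def by auto
    moreover have rp': "rep E p'"
    proof -
      have "finite {(i, j). p' i j \<noteq> \<zero>}" using insert.hyps(1) calculation by simp
      then show ?thesis using insert.prems(2) assms(2) Bi_closed(2) unfolding rep_def p'_def by auto
    qed
    ultimately have Q': "Q (cls p')" using insert.IH by blast
    have ru: "rep E u" unfolding u_def using rep_single[OF assms(2)] rep_Bi[OF insert.prems(2)] by blast
    have "Q (cls u)" using m[of "p k l" k l] rep_Bi[OF insert.prems(2)] unfolding homog_def u_def by blast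
    then have "Q (cls u \<oplus>\<^bsub>S\<^esub> cls p')" using s Q' ru rp' by blast
    moreover have "(\<lambda>i j. u i j \<oplus> p' i j) = p"
      using rep_Bi(2)[OF insert.prems(2)] unfolding u_def p'_def by (intro ext) auto
    ultimately show ?case unfolding cls_add[OF ru rp'] by simp
  qed
qed

end

lemma even_ring_simps:
  "carrier (even_ring T) = even_part T" "monoid.mult (even_ring T) = monoid.mult T" "monoid.one (even_ring T) = monoid.one T"
  "ring.add (even_ring T) = ring.add T" "ring.zero (even_ring T) = ring.zero T"
  by (simp_all add: even_ring_def)

section \<open>Ring axioms of the bigraded ring\<close>

context super_ring_ideal
begin

lemma in_carrier_S: assumes "f \<in> carrier S" obtains p where "rep (carrier R) p" "f = cls p"
  using assms unfolding carrier_S by blast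

lemma cls_in_carrier: "rep E p \<Longrightarrow> cls p \<in> carrier S"
  unfolding carrier_S using rep_carrier by blast

lemma rep_conv_carrier: "\<lbrakk>rep E p; rep E' q\<rbrakk> \<Longrightarrow> rep (carrier R) (conv p q)"
  by (rule rep_conv[OF rep_carrier rep_carrier]) auto

lemma rep_add_carrier: "\<lbrakk>rep E p; rep E' q\<rbrakk> \<Longrightarrow> rep (carrier R) (\<lambda>k l. p k l \<oplus> q k l)"
  by (rule rep_add[OF rep_carrier rep_carrier]) auto

lemma rep_minus:
  assumes "rep E p" "\<And>x. x \<in> E \<Longrightarrow> \<ominus> x \<in> E" shows "rep E (\<lambda>k l. \<ominus> p k l)"
proof -
  have "{(k, l). \<ominus> p k l \<noteq> \<zero>} = {(k, l). p k l \<noteq> \<zero>}" using rep_Bi(2)[OF assms(1)] by auto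
  then show ?thesis using assms Bi_closed(4) unfolding rep_def by auto
qed

lemma abelian_group_S: "abelian_group S"
proof (rule abelian_groupI)
  fix f g h assume "f \<in> carrier S" "g \<in> carrier S" "h \<in> carrier S"
  then obtain p q r where p: "rep (carrier R) p" "f = cls p" and q: "rep (carrier R) q" "g = cls q"
    and r: "rep (carrier R) r" "h = cls r" using in_carrier_S by metis
  note c = rep_Bi(2)[OF p(1)] rep_Bi(2)[OF q(1)] rep_Bi(2)[OF r(1)]
  show "f \<oplus>\<^bsub>S\<^esub> g \<in> carrier S"
    unfolding p q cls_add[OF p(1) q(1)] using cls_in_carrier rep_add_carrier[OF p(1) q(1)] by blast
  show "f \<oplus>\<^bsub>S\<^esub> g = g \<oplus>\<^bsub>S\<^esub> f"
    unfolding p q cls_add[OF p(1) q(1)] cls_add[OF q(1) p(1)]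
    by (rule arg_cong[of _ _ cls], intro ext) (simp add: c a_comm)
  show "f \<oplus>\<^bsub>S\<^esub> g \<oplus>\<^bsub>S\<^esub> h = f \<oplus>\<^bsub>S\<^esub> (g \<oplus>\<^bsub>S\<^esub> h)"
    unfolding p q r cls_add[OF p(1) q(1)] cls_add[OF q(1) r(1)]
      cls_add[OF rep_add_carrier[OF p(1) q(1)] r(1)] cls_add[OF p(1) rep_add_carrier[OF q(1) r(1)]]
    by (rule arg_cong[of _ _ cls], intro ext) (simp add: c a_assoc)
next
  have rz: "rep (carrier R) (\<lambda>_ _. \<zero>)" by (simp add: rep_def Bi_closed)
  show "\<zero>\<^bsub>S\<^esub> \<in> carrier S" unfolding cls_zero using cls_in_carrier[OF rz] .
  fix f assume "f \<in> carrier S"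
  then obtain p where p: "rep (carrier R) p" "f = cls p" using in_carrier_S by blast
  note c = rep_Bi(2)[OF p(1)]
  show "\<zero>\<^bsub>S\<^esub> \<oplus>\<^bsub>S\<^esub> f = f"
    unfolding p cls_zero cls_add[OF rz p(1)] by (rule arg_cong[of _ _ cls], intro ext) (simp add: c)
  have rm: "rep (carrier R) (\<lambda>k l. \<ominus> p k l)" using rep_minus[OF p(1)] by simp
  have "cls (\<lambda>k l. \<ominus> p k l) \<oplus>\<^bsub>S\<^esub> f = \<zero>\<^bsub>S\<^esub>"
    unfolding p cls_zero cls_add[OF rm p(1)] by (rule arg_cong[of _ _ cls], intro ext) (simp add: c l_neg)
  then show "\<exists>y\<in>carrier S. y \<oplus>\<^bsub>S\<^esub> f = \<zero>\<^bsub>S\<^esub>" using cls_in_carrier[OF rm] by blast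
qed

lemma S_distr:
  assumes "f \<in> carrier S" "g \<in> carrier S" "h \<in> carrier S"
  shows "(f \<oplus>\<^bsub>S\<^esub> g) \<otimes>\<^bsub>S\<^esub> h = f \<otimes>\<^bsub>S\<^esub> h \<oplus>\<^bsub>S\<^esub> g \<otimes>\<^bsub>S\<^esub> h"
    and "h \<otimes>\<^bsub>S\<^esub> (f \<oplus>\<^bsub>S\<^esub> g) = h \<otimes>\<^bsub>S\<^esub> f \<oplus>\<^bsub>S\<^esub> h \<otimes>\<^bsub>S\<^esub> g"
proof -
  obtain p q r where p: "rep (carrier R) p" "f = cls p" and q: "rep (carrier R) q" "g = cls q"
    and r: "rep (carrier R) r" "h = cls r" using in_carrier_S assms by metis
  note c = rep_Bi(2)[OF p(1)] rep_Bi(2)[OF q(1)] rep_Bi(2)[OF r(1)]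
  have "conv (\<lambda>k l. p k l \<oplus> q k l) r k l = conv p r k l \<oplus> conv q r k l" for k l
  proof -
    have "conv (\<lambda>k l. p k l \<oplus> q k l) r k l =
        finsum R (\<lambda>x. (\<lambda>(i, j). p i j \<otimes> r (k - i) (l - j)) x \<oplus> (\<lambda>(i, j). q i j \<otimes> r (k - i) (l - j)) x) ({..k} \<times> {..l})"
      unfolding conv_def by (rule add.finprod_cong') (auto simp: c l_distr)
    then show ?thesis
      unfolding conv_def using finsum_addf[OF conv_terms[OF p(1) r(1)] conv_terms[OF q(1) r(1)]] by simp
  qed
  then show "(f \<oplus>\<^bsub>S\<^esub> g) \<otimes>\<^bsub>S\<^esub> h = f \<otimes>\<^bsub>S\<^esub> h \<oplus>\<^bsub>S\<^esub> g \<otimes>\<^bsub>S\<^esub> h"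
    unfolding p q r cls_add[OF p(1) q(1)] cls_mult[OF rep_add_carrier[OF p(1) q(1)] r(1)]
      cls_mult[OF p(1) r(1)] cls_mult[OF q(1) r(1)]
      cls_add[OF rep_conv_carrier[OF p(1) r(1)] rep_conv_carrier[OF q(1) r(1)]]
    by (intro arg_cong[of _ _ cls] ext)
  have "conv r (\<lambda>k l. p k l \<oplus> q k l) k l = conv r p k l \<oplus> conv r q k l" for k l
  proof -
    have "conv r (\<lambda>k l. p k l \<oplus> q k l) k l =
        finsum R (\<lambda>x. (\<lambda>(i, j). r i j \<otimes> p (k - i) (l - j)) x \<oplus> (\<lambda>(i, j). r i j \<otimes> q (k - i) (l - j)) x) ({..k} \<times> {..l})"
      unfolding conv_def by (rule add.finprod_cong') (auto simp: c r_distr)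
    then show ?thesis
      unfolding conv_def using finsum_addf[OF conv_terms[OF r(1) p(1)] conv_terms[OF r(1) q(1)]] by simp
  qed
  then show "h \<otimes>\<^bsub>S\<^esub> (f \<oplus>\<^bsub>S\<^esub> g) = h \<otimes>\<^bsub>S\<^esub> f \<oplus>\<^bsub>S\<^esub> h \<otimes>\<^bsub>S\<^esub> g"
    unfolding p q r cls_add[OF p(1) q(1)] cls_mult[OF r(1) rep_add_carrier[OF p(1) q(1)]]
      cls_mult[OF r(1) p(1)] cls_mult[OF r(1) q(1)]
      cls_add[OF rep_conv_carrier[OF r(1) p(1)] rep_conv_carrier[OF r(1) q(1)]]
    by (intro arg_cong[of _ _ cls] ext)
qed

lemma S_mult_closed: "\<lbrakk>f \<in> carrier S; g \<in> carrier S\<rbrakk> \<Longrightarrow> f \<otimes>\<^bsub>S\<^esub> g \<in> carrier S"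
  by (elim in_carrier_S) (simp add: cls_mult cls_in_carrier[OF rep_conv_carrier])

lemma S_add_closed: "\<lbrakk>f \<in> carrier S; g \<in> carrier S\<rbrakk> \<Longrightarrow> f \<oplus>\<^bsub>S\<^esub> g \<in> carrier S"
  by (elim in_carrier_S) (simp add: cls_add cls_in_carrier[OF rep_add_carrier])

lemma carrier_S_induct [consumes 1, case_names homog add]:
  assumes "f \<in> carrier S"
    and "\<And>k l a. a \<in> Bi k l \<Longrightarrow> Q (homog k l a)"
    and "\<And>f g. \<lbrakk>f \<in> carrier S; g \<in> carrier S; Q f; Q g\<rbrakk> \<Longrightarrow> Q (f \<oplus>\<^bsub>S\<^esub> g)"
  shows "Q f"
proof -
  obtain p where p: "rep (carrier R) p" "f = cls p" using in_carrier_S assms(1) by blast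
  show ?thesis unfolding p(2)
    by (rule homog_induct[OF p(1)]) (use assms(2,3) in \<open>auto simp: carrier_S\<close>)
qed

lemma even_S_induct [consumes 1, case_names homog add]:
  assumes "f \<in> even_part S"
    and "\<And>k l a. \<lbrakk>a \<in> Ev; a \<in> Bi k l\<rbrakk> \<Longrightarrow> Q (homog k l a)"
    and "\<And>f g. \<lbrakk>f \<in> even_part S; g \<in> even_part S; Q f; Q g\<rbrakk> \<Longrightarrow> Q (f \<oplus>\<^bsub>S\<^esub> g)"
  shows "Q f"
proof -
  obtain p where p: "rep Ev p" "f = cls p" using assms(1) unfolding even_S by blast
  show ?thesis unfolding p(2)
    by (rule homog_induct[OF p(1)]) (use assms(2,3) part_closed in \<open>auto simp: even_S\<close>)
qed

lemma odd_S_induct [consumes 1, case_names homog add]: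
  assumes "f \<in> odd_part S"
    and "\<And>k l a. \<lbrakk>a \<in> Od; a \<in> Bi k l\<rbrakk> \<Longrightarrow> Q (homog k l a)"
    and "\<And>f g. \<lbrakk>f \<in> odd_part S; g \<in> odd_part S; Q f; Q g\<rbrakk> \<Longrightarrow> Q (f \<oplus>\<^bsub>S\<^esub> g)"
  shows "Q f"
proof -
  obtain p where p: "rep Od p" "f = cls p" using assms(1) unfolding odd_S by blast
  show ?thesis unfolding p(2)
    by (rule homog_induct[OF p(1)]) (use assms(2,3) part_closed in \<open>auto simp: odd_S\<close>)
qed

text \<open>By biadditivity it suffices to treat homogeneous elements, where associativity is
  inherited from \<open>R\<close>; no double sums have to be rearranged.\<close>

lemma S_mult_assoc:
  assumes "f \<in> carrier S" "g \<in> carrier S" "h \<in> carrier S"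
  shows "(f \<otimes>\<^bsub>S\<^esub> g) \<otimes>\<^bsub>S\<^esub> h = f \<otimes>\<^bsub>S\<^esub> (g \<otimes>\<^bsub>S\<^esub> h)"
  using assms(1)
proof (induction rule: carrier_S_induct)
  case (homog k l a)
  note a = homog
  show ?case
    using assms(2)
  proof (induction rule: carrier_S_induct)
    case (homog k' l' b)
    note b = homog
    show ?case
      using assms(3)
    proof (induction rule: carrier_S_induct)
      case (homog k'' l'' c)
      have "a \<otimes> b \<in> Bi (k + k') (l + l')" "b \<otimes> c \<in> Bi (k' + k'') (l' + l'')"
        using Bi_mult a b homog by blast+
      then show ?case
        using a b homog Bi_closed(1)[OF a] Bi_closed(1)[OF b] Bi_closed(1)[OF homog]
        by (simp add: homog_mult m_assoc Groups.add.assoc)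
    next
      case (add f g)
      then show ?case using a b by (simp add: S_distr S_mult_closed homog_closed)
    qed
  next
    case (add f g)
    then show ?case using a assms by (simp add: S_distr S_mult_closed homog_closed)
  qed
next
  case (add f g)
  then show ?case using assms by (simp add: S_distr S_mult_closed)
qed

lemma one_in_Bi: "\<one> \<in> Bi 0 0" by (simp add: Bi_0_0)

lemma ring_S: "ring S"
proof (rule ringI[OF abelian_group_S])
  show "monoid S"
  proof (rule monoidI)
    show "\<one>\<^bsub>S\<^esub> \<in> carrier S" unfolding one_S using homog_closed(1)[OF one_in_Bi] .
    show "\<one>\<^bsub>S\<^esub> \<otimes>\<^bsub>S\<^esub> f = f" if "f \<in> carrier S" for f
      using that
    proof (induction rule: carrier_S_induct)
      case (homog k l a)
      then show ?case unfolding one_S using homog_mult[OF one_in_Bi homog] Bi_closed(1)[OF homog] by simp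
    next
      case (add f g)
      then show ?case unfolding one_S using homog_closed(1)[OF one_in_Bi] by (simp add: S_distr)
    qed
    show "f \<otimes>\<^bsub>S\<^esub> \<one>\<^bsub>S\<^esub> = f" if "f \<in> carrier S" for f
      using that
    proof (induction rule: carrier_S_induct)
      case (homog k l a)
      then show ?case unfolding one_S using homog_mult[OF homog one_in_Bi] Bi_closed(1)[OF homog] by simp
    next
      case (add f g)
      then show ?case unfolding one_S using homog_closed(1)[OF one_in_Bi] by (simp add: S_distr)
    qed
  qed (simp_all add: S_mult_closed S_mult_assoc)
qed (simp_all add: S_distr)

lemma part_S_subset: "even_part S \<subseteq> carrier S" "odd_part S \<subseteq> carrier S"
  unfolding carrier_S even_S odd_S using rep_carrier by blast+

lemma even_S_mult: assumes "f \<in> even_part S" "g \<in> even_part S" shows "f \<otimes>\<^bsub>S\<^esub> g \<in> even_part S"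
proof -
  obtain p q where p: "rep Ev p" "f = cls p" "rep Ev q" "g = cls q" using assms unfolding even_S by blast
  have "rep Ev (conv p q)" using part_closed even_even by (intro rep_conv[OF p(1,3)]) auto
  then show ?thesis unfolding p(2,4) cls_mult[OF p(1,3)] even_S by blast
qed

lemma even_S_add: assumes "f \<in> even_part S" "g \<in> even_part S" shows "f \<oplus>\<^bsub>S\<^esub> g \<in> even_part S"
proof -
  obtain p q where p: "rep Ev p" "f = cls p" "rep Ev q" "g = cls q" using assms unfolding even_S by blast
  have "rep Ev (\<lambda>k l. p k l \<oplus> q k l)" using part_closed by (intro rep_add[OF p(1,3)]) auto
  then show ?thesis unfolding p(2,4) cls_add[OF p(1,3)] even_S by blast
qed

lemma even_S_commute: assumes "f \<in> even_part S" "g \<in> even_part S" shows "f \<otimes>\<^bsub>S\<^esub> g = g \<otimes>\<^bsub>S\<^esub> f"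
  using assms(1)
proof (induction rule: even_S_induct)
  case (homog k l a)
  note a = homog
  show ?case
    using assms(2)
  proof (induction rule: even_S_induct)
    case (homog k' l' b)
    then show ?case using a homog even_comm[of a b]
      by (simp add: homog_mult Groups.add.commute[of k] Groups.add.commute[of l])
  next
    case (add f g)
    then show ?case using homog_closed(1)[OF a(2)] part_S_subset by (simp add: S_distr subset_iff)
  qed
next
  case (add f g)
  then show ?case using assms part_S_subset by (simp add: S_distr subset_iff)
qed

lemma cring_even_S: "cring (even_ring S)"
proof -
  interpret SR: ring S by (rule ring_S)
  have "\<ominus>\<^bsub>S\<^esub> f \<in> even_part S" if f: "f \<in> even_part S" for f
  proof -
    obtain p where p: "rep Ev p" "f = cls p" using f unfolding even_S by blast
    have rm: "rep Ev (\<lambda>k l. \<ominus> p k l)" using rep_minus[OF p(1)] part_closed by blast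
    have "cls (\<lambda>k l. \<ominus> p k l) \<oplus>\<^bsub>S\<^esub> f = \<zero>\<^bsub>S\<^esub>"
      unfolding p cls_zero cls_add[OF rm p(1)]
      by (rule arg_cong[of _ _ cls], intro ext) (simp add: rep_Bi(2)[OF p(1)] l_neg)
    then have "\<ominus>\<^bsub>S\<^esub> f = cls (\<lambda>k l. \<ominus> p k l)"
      using SR.minus_equality cls_in_carrier[OF rm] f part_S_subset by blast
    then show ?thesis using rm unfolding even_S by blast
  qed
  moreover have "\<one>\<^bsub>S\<^esub> \<in> even_part S" unfolding one_S using homog_closed(2)[OF one_in_Bi] one_even .
  ultimately have "subring (even_part S) S"
    using part_S_subset even_S_mult even_S_add by (intro SR.subringI) auto
  then have "subcring (even_part S) S" using even_S_commute by (rule SR.subcringI)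
  then show ?thesis unfolding even_ring_def using SR.subcring_iff part_S_subset by blast
qed

text \<open>Second degree 0 is enough for counting, because even elements of positive second degree
  lie in every prime of the even ring. The first degree then plays the role of the degree in a
  Hilbert function.\<close>

inductive_set fil :: "nat \<Rightarrow> (nat \<Rightarrow> nat \<Rightarrow> 'a set) set" for t where
  zero: "\<zero>\<^bsub>S\<^esub> \<in> fil t"
| homog: "\<lbrakk>k \<le> t; a \<in> Ev; a \<in> Bi k 0\<rbrakk> \<Longrightarrow> homog k 0 a \<in> fil t"
| add: "\<lbrakk>f \<in> fil t; g \<in> fil t\<rbrakk> \<Longrightarrow> f \<oplus>\<^bsub>S\<^esub> g \<in> fil t"

lemma zero_even_S: "\<zero>\<^bsub>S\<^esub> \<in> even_part S"
  using homog_closed(2)[OF Bi_closed(2)[of 0 0] part_closed(3)] by (simp add: homog_zero)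

lemma fil_even: "f \<in> fil t \<Longrightarrow> f \<in> even_part S"
  by (induction rule: fil.induct) (auto intro: homog_closed even_S_add zero_even_S)

lemma fil_mono: "\<lbrakk>f \<in> fil t; t \<le> u\<rbrakk> \<Longrightarrow> f \<in> fil u"
  by (induction rule: fil.induct) (auto intro: fil.intros)

lemma fil_mult: assumes "f \<in> fil t" "g \<in> fil u" shows "f \<otimes>\<^bsub>S\<^esub> g \<in> fil (t + u)"
proof -
  interpret SR: ring S by (rule ring_S)
  have ec: "h \<in> carrier S" if "h \<in> fil t" for h t using fil_even[OF that] part_S_subset by blast
  show ?thesis using assms(1)
  proof induction
    case zero
    then show ?case using ec[OF assms(2)] fil.zero by simp
  next
    case (homog k a)
    note a = homog
    show ?case using assms(2)
    proof induction
      case zero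
      then show ?case using homog_closed(1)[OF a(3)] fil.zero by simp
    next
      case (homog l b)
      then show ?case using a fil.homog[of "k + l" "t + u" "a \<otimes> b"] Bi_mult[OF a(3) homog(3)] even_even
        by (simp add: homog_mult)
    next
      case (add f g)
      then show ?case using homog_closed(1)[OF a(3)] ec fil.add by (simp add: S_distr)
    qed
  next
    case (add f g)
    then show ?case using ec ec[OF assms(2)] fil.add by (simp add: S_distr)
  qed
qed

lemma one_fil: "\<one>\<^bsub>S\<^esub> \<in> fil t"
  unfolding one_S using fil.homog[OF _ one_even one_in_Bi] by simp

text \<open>Expanding a product of \<open>s\<close> odd elements of \<open>S\<close> gives such a
  sum, and each summand comes from a product of \<open>s\<close> odd elements of \<open>R\<close>,
  to whose annihilator the length bound applies. The factors \<open>zs\<close> are odd in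
  \<open>R\<close>, whatever the bidegree of their product.\<close>

inductive_set osum :: "nat \<Rightarrow> (nat \<Rightarrow> nat \<Rightarrow> 'a set) set" for s where
  homog: "\<lbrakk>length zs = s; set zs \<subseteq> Od; list_product R zs \<in> Bi i j\<rbrakk> \<Longrightarrow> homog i j (list_product R zs) \<in> osum s"
| add: "\<lbrakk>f \<in> osum s; g \<in> osum s\<rbrakk> \<Longrightarrow> f \<oplus>\<^bsub>S\<^esub> g \<in> osum s"

lemma osum_carrier: "f \<in> osum s \<Longrightarrow> f \<in> carrier S"
  by (induction rule: osum.induct) (auto intro: homog_closed S_add_closed)

lemma list_product_osum: "set ys \<subseteq> odd_part S \<Longrightarrow> list_product S ys \<in> osum (length ys)"
proof (induction ys)
  case Nil
  have "homog 0 0 (list_product R []) \<in> osum 0"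
    by (rule osum.homog) (simp_all add: list_product_def one_in_Bi)
  then show ?case by (simp add: list_product_def one_S)
next
  case (Cons y ys)
  have IH: "list_product S ys \<in> osum (length ys)" and y: "y \<in> odd_part S" using Cons by auto
  have "y \<otimes>\<^bsub>S\<^esub> list_product S ys \<in> osum (Suc (length ys))"
    using y
  proof (induction rule: odd_S_induct)
    case (homog k l a)
    note a = homog
    show ?case using IH
    proof induction
      case (homog zs i j)
      have "homog (k + i) (l + j) (list_product R (a # zs)) \<in> osum (Suc (length ys))"
        using homog a Bi_mult[OF a(2) homog(3)] by (intro osum.homog) (auto simp: list_product_def)
      then show ?case using homog_mult[OF a(2) homog(3)] by (simp add: list_product_def)
    next
      case (add f g)
      then show ?case using homog_closed(1)[OF a(2)] osum_carrier by (simp add: S_distr osum.add)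
    qed
  next
    case (add f g)
    then show ?case using osum_carrier[OF IH] part_S_subset by (simp add: S_distr osum.add subset_iff)
  qed
  then show ?case by (simp add: list_product_def)
qed

text \<open>A product of two odd elements squares to zero:
  \<open>u v u v = - (u u) (v v) = 0\<close>.\<close>

lemma prime_contains_osq:
  assumes "primeideal P (even_ring R)" shows "odd_square_ideal R \<subseteq> P"
proof
  interpret A: primeideal P "even_ring R" by fact
  fix x assume "x \<in> odd_square_ideal R"
  then show "x \<in> P"
    unfolding odd_square_ideal_def
  proof induction
    case (prod u v)
    have c: "u \<in> carrier R" "v \<in> carrier R" using prod part_closed by auto
    have "(u \<otimes> v) \<otimes> (u \<otimes> v) = u \<otimes> ((v \<otimes> u) \<otimes> v)" using c by (simp add: m_assoc)
    also have "\<dots> = \<ominus> ((u \<otimes> u) \<otimes> (v \<otimes> v))"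
      using c prod odd_anticomm[of v u] by (simp add: l_minus r_minus m_assoc)
    also have "\<dots> = \<zero>" using odd_square prod by simp
    finally have "(u \<otimes> v) \<otimes> (u \<otimes> v) \<in> P"
      using additive_subgroup.zero_closed[OF ideal.axioms(1)[OF primeideal.axioms(1)[OF assms]]]
      by (simp add: even_ring_simps)
    then show ?case using A.I_prime[of "u \<otimes> v" "u \<otimes> v"] odd_odd[OF prod] by (auto simp: even_ring_simps)
  next
    case (sum x y)
    then show ?case using A.idealD(3)[OF A.is_ideal, of x y] by (simp add: even_ring_simps)
  qed
qed

end

lemma (in cring) nilpotent_if_in_primes:
  assumes x: "x \<in> carrier R" and "\<And>P. primeideal P R \<Longrightarrow> x \<in> P"
  shows "\<exists>n::nat. x [^] n = \<zero>"
proof (rule ccontr)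
  assume H: "\<not> ?thesis"
  have "\<exists>P. primeideal P R \<and> {\<zero>} \<subseteq> P \<and> P \<inter> range (\<lambda>n::nat. x [^] n) = {}"
  proof (rule prime_avoiding[OF zeroideal])
    show "range (\<lambda>n::nat. x [^] n) \<subseteq> carrier R" using x by auto
    show "\<one> \<in> range (\<lambda>n::nat. x [^] n)" using nat_pow_0[of x] by (metis rangeI)
    show "s \<otimes> t \<in> range (\<lambda>n::nat. x [^] n)"
      if "s \<in> range (\<lambda>n::nat. x [^] n)" "t \<in> range (\<lambda>n::nat. x [^] n)" for s t
      using that x by (auto simp: nat_pow_mult)
  qed (use H in auto)
  moreover have "x \<in> range (\<lambda>n::nat. x [^] n)" using x nat_pow_eone[of x] by (metis rangeI)
  ultimately show False using assms(2) by blast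
qed

lemma (in primeideal) prime_power: "\<lbrakk>x \<in> carrier R; x [^] (n::nat) \<in> I\<rbrakk> \<Longrightarrow> x \<in> I"
proof (induction n)
  case 0
  then show ?case using one_imp_carrier I_notcarr by auto
next
  case (Suc n)
  then show ?case using I_prime[of "x [^] n" x] by auto
qed

section \<open>Super-rings with a local even part\<close>

context super_ring
begin

definition extension :: "'a set \<Rightarrow> 'a set" where
  "extension I = ideal_prod R I (carrier R)"

text \<open>The even component of \<open>i \<otimes> r\<close> is \<open>i\<close> times that of
  \<open>r\<close>, which is again in \<open>I\<close>. Hence the extension is graded and its even
  part is no larger than \<open>I\<close>.\<close>

lemma extension_decompose:
  assumes "ideal I (even_ring R)" "x \<in> extension I"
  shows "\<exists>a\<in>I. \<exists>b\<in>extension I \<inter> Od. x = a \<oplus> b"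
proof -
  interpret I: ideal I "even_ring R" by fact
  have IE: "i \<in> Ev" if "i \<in> I" for i using I.Icarr[OF that] by (simp add: even_ring_simps)
  have add: "i \<oplus> j \<in> I" if "i \<in> I" "j \<in> I" for i j using I.idealD(3)[OF I.is_ideal that] by (simp add: even_ring_simps)
  have odd_car: "b \<in> carrier R" if "b \<in> extension I \<inter> Od" for b using that part_closed by auto
  show ?thesis
    using assms(2) unfolding extension_def
  proof induction
    case (prod i r)
    obtain a b where ab: "a \<in> Ev" "b \<in> Od" "r = a \<oplus> b" using decompose[OF prod(2)] .
    have c: "i \<in> carrier R" "a \<in> carrier R" "b \<in> carrier R" using ab IE[OF prod(1)] part_closed by auto
    have "i \<otimes> a \<in> I" using I.I_r_closed[OF prod(1)] ab by (simp add: even_ring_simps)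
    moreover have "i \<otimes> b \<in> ideal_prod R I (carrier R) \<inter> Od"
      using ideal_prod.prod[OF prod(1) c(3)] even_odd[OF IE[OF prod(1)] ab(2)] by blast
    ultimately show ?case unfolding ab(3) using r_distr[OF c(2,3,1)] by blast
  next
    case (sum x y)
    then obtain a b c d where *: "a \<in> I" "b \<in> ideal_prod R I (carrier R) \<inter> Od" "x = a \<oplus> b"
      "c \<in> I" "d \<in> ideal_prod R I (carrier R) \<inter> Od" "y = c \<oplus> d" by blast
    have "a \<in> carrier R" "b \<in> carrier R" "c \<in> carrier R" "d \<in> carrier R"
      using * IE part_closed by auto
    then have "x \<oplus> y = (a \<oplus> c) \<oplus> (b \<oplus> d)" unfolding *(3,6) by (simp add: a_ac)
    moreover have "b \<oplus> d \<in> ideal_prod R I (carrier R) \<inter> Od"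
      using *(2,5) ideal_prod.sum[of b R I "carrier R" d] part_closed(6)[of b d] by blast
    ultimately show ?case using add[OF *(1,4)] by blast
  qed
qed

lemma subset_extension: assumes "ideal I (even_ring R)" shows "I \<subseteq> extension I"
proof
  fix i assume i: "i \<in> I"
  have "i \<in> Ev" using ideal.Icarr[OF assms i] by (simp add: even_ring_simps)
  then have "i \<otimes> \<one> = i" using part_closed(1) by simp
  then show "i \<in> extension I" unfolding extension_def using ideal_prod.prod[OF i one_closed] by metis
qed

lemma superideal_extension: assumes "ideal I (even_ring R)" shows "superideal (extension I) R"
proof -
  have IE: "I \<subseteq> Ev" using ideal.Icarr[OF assms] by (auto simp: even_ring_simps)
  have "\<zero> \<in> I" using additive_subgroup.zero_closed[OF ideal.axioms(1)[OF assms]] by (simp add: even_ring_simps)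
  then have "ideal (extension I) R"
    unfolding extension_def using IE by (intro ideal_prod_homogeneous oneideal) auto
  moreover have "extension I = (extension I \<inter> Ev) <+>\<^bsub>R\<^esub> (extension I \<inter> Od)"
  proof
    show "extension I \<subseteq> (extension I \<inter> Ev) <+>\<^bsub>R\<^esub> (extension I \<inter> Od)"
    proof
      fix x assume "x \<in> extension I"
      then obtain a b where "a \<in> I" "b \<in> extension I \<inter> Od" "x = a \<oplus> b"
        using extension_decompose[OF assms] by blast
      then show "x \<in> (extension I \<inter> Ev) <+>\<^bsub>R\<^esub> (extension I \<inter> Od)"
        using subset_extension[OF assms] IE unfolding set_add_def' by blast
    qed
    show "(extension I \<inter> Ev) <+>\<^bsub>R\<^esub> (extension I \<inter> Od) \<subseteq> extension I"
      using idealD(3)[OF \<open>ideal (extension I) R\<close>] unfolding set_add_def' by auto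
  qed
  ultimately show ?thesis by (simp add: superideal_def)
qed

lemma extension_Int_even: assumes "ideal I (even_ring R)" shows "extension I \<inter> Ev = I"
proof
  have IE: "I \<subseteq> Ev" using ideal.Icarr[OF assms] by (auto simp: even_ring_simps)
  then show "I \<subseteq> extension I \<inter> Ev" using subset_extension[OF assms] by blast
  show "extension I \<inter> Ev \<subseteq> I"
  proof
    fix x assume x: "x \<in> extension I \<inter> Ev"
    then obtain a b where "a \<in> I" "b \<in> extension I \<inter> Od" "x = a \<oplus> b"
      using extension_decompose[OF assms] by blast
    then show "x \<in> I" using even_component_unique[of x a b] x IE by auto
  qed
qed

text \<open>\<open>I\<close> is recovered as the even part of the superideal \<open>I R\<close>, so
  an ascending chain of ideals becomes stationary as soon as its extensions do.\<close>

lemma acc_even_ring: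
  assumes "cring (even_ring R)" "noetherian_super_ring R" shows "acc_cring (even_ring R)"
proof (rule acc_cring.intro[OF assms(1)], unfold_locales)
  fix I :: "nat \<Rightarrow> 'a set"
  assume I: "\<And>n. ideal (I n) (even_ring R)" and inc: "\<And>n. I n \<subseteq> I (Suc n)"
  have "extension (I n) \<subseteq> extension (I (Suc n))" for n
  proof
    fix x assume "x \<in> extension (I n)"
    then show "x \<in> extension (I (Suc n))"
      unfolding extension_def by induction (use inc in \<open>auto intro: ideal_prod.intros\<close>)
  qed
  then have "\<forall>n. superideal (extension (I n)) R \<and> extension (I n) \<subseteq> extension (I (Suc n))"
    using superideal_extension[OF I] by simp
  then obtain n0 where "\<forall>n\<ge>n0. extension (I n) = extension (I n0)"
    using assms(2) unfolding noetherian_super_ring_def by (elim conjE allE[of _ "\<lambda>n. extension (I n)"]) auto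
  then show "\<exists>n0. \<forall>n\<ge>n0. I n = I n0" using extension_Int_even[OF I] by metis
qed

end

locale local_super_ring_ideal = super_ring_ideal R N
  for R :: "('a, 'b) super_ring_scheme" (structure) and N +
  fixes m :: "'a set"
  assumes local: "local_ring (even_ring R) m"
    and noetherian: "noetherian_super_ring R"
    and radical: "ideal_radical (even_ring R) (N \<inter> even_part R) = m"
begin

abbreviation "A \<equiv> even_ring R"
text \<open>The ideal \<open>n^t\<close> of \<open>A\<close>, where
  \<open>n = N \<inter> Ev\<close>, obtained as the even part of \<open>n^t R\<close>.\<close>

abbreviation "q \<equiv> \<lambda>t. Ev \<inter> Bi t 0"

lemma cring_A: "cring A" using local by (simp add: local_ring_def)

sublocale A: acc_cring A using acc_even_ring[OF cring_A noetherian] .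

lemma maximal_m: "maximalideal m A" using local by (simp add: local_ring_def)

lemma prime_m: "primeideal m A" using A.maximalideal_prime[OF maximal_m] .

lemma m_even: "x \<in> m \<Longrightarrow> x \<in> Ev"
  using A.idealD(1)[OF primeideal.axioms(1)[OF prime_m]] by (simp add: even_ring_simps)

lemma ideal_q: "ideal (q t) A"
proof (rule A.idealI_closed)
  show "q t \<subseteq> carrier A" by (auto simp: even_ring_simps)
  show "\<zero>\<^bsub>A\<^esub> \<in> q t" using part_closed Bi_closed by (simp add: even_ring_simps)
  show "x \<oplus>\<^bsub>A\<^esub> y \<in> q t" if "x \<in> q t" "y \<in> q t" for x y
    using that part_closed Bi_closed(3) by (simp add: even_ring_simps)
  show "r \<otimes>\<^bsub>A\<^esub> x \<in> q t" if "x \<in> q t" "r \<in> carrier A" for x r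
    using that even_even idealD(6)[OF ideal_Bi] part_closed(1) by (simp add: even_ring_simps)
qed

text \<open>Some power \<open>b^e\<close> lies in \<open>n\<close>. That one \<open>e\<close> serves
  all \<open>t\<close> is the linear bound required by \<open>length_growth\<close>.\<close>

lemma q_power: assumes "b \<in> m" shows "\<exists>e::nat. \<forall>t::nat. b [^]\<^bsub>A\<^esub> (e * t) \<in> q t"
proof -
  have b: "b \<in> carrier A" using m_even[OF assms] by (simp add: even_ring_simps)
  obtain e :: nat where e: "b [^]\<^bsub>A\<^esub> e \<in> N \<inter> Ev"
    using assms radical unfolding ideal_radical_def by blast
  have "b [^]\<^bsub>A\<^esub> (e * t) \<in> q t" for t
  proof (induction t)
    case 0
    then show ?case using one_even one_in_Bi by (simp add: even_ring_simps)
  next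
    case (Suc t)
    have "b [^]\<^bsub>A\<^esub> (e * Suc t) = b [^]\<^bsub>A\<^esub> e \<otimes>\<^bsub>A\<^esub> b [^]\<^bsub>A\<^esub> (e * t)" using b by (simp add: A.nat_pow_mult)
    also have "\<dots> = b [^]\<^bsub>A\<^esub> e \<otimes> b [^]\<^bsub>A\<^esub> (e * t)" by (simp add: even_ring_simps)
    also have "\<dots> \<in> q (Suc t)" using N0_mult[OF e, of "b [^]\<^bsub>A\<^esub> (e * t)" t 0] Suc e even_even by auto
    finally show ?case .
  qed
  then show ?thesis by blast
qed

lemma growth_A:
  assumes "ideal I A" "\<not> has_chain A I r"
  shows "\<exists>c. \<forall>t. prime_action.lenle m A A (\<otimes>\<^bsub>A\<^esub>) (I <+>\<^bsub>A\<^esub> q t) (carrier A) (c * growth r t)"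
  using A.length_growth[OF prime_m ideal_q q_power assms] .

definition act :: "'a \<Rightarrow> (nat \<Rightarrow> nat \<Rightarrow> 'a set) \<Rightarrow> nat \<Rightarrow> nat \<Rightarrow> 'a set" where
  "act r f = homog 0 0 r \<otimes>\<^bsub>S\<^esub> f"

sublocale SR: ring S by (rule ring_S)
sublocale SE: cring "even_ring S" by (rule cring_even_S)

lemma homog00: "r \<in> carrier A \<Longrightarrow> homog 0 0 r \<in> carrier S" "r \<in> carrier A \<Longrightarrow> homog 0 0 r \<in> even_part S"
  "r \<in> carrier A \<Longrightarrow> r \<in> Bi 0 0" "r \<in> carrier A \<Longrightarrow> r \<in> Ev"
  using homog_closed[of r 0 0] part_closed by (auto simp: even_ring_simps Bi_0_0)

sublocale SM: prime_action m A S act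
proof (intro prime_action.intro prime_action_axioms.intro prime_m SR.abelian_group_axioms)
  show "act r x \<in> carrier S" if "r \<in> carrier A" "x \<in> carrier S" for r x
    using homog00 that by (simp add: act_def S_mult_closed)
  show "act r (x \<oplus>\<^bsub>S\<^esub> y) = act r x \<oplus>\<^bsub>S\<^esub> act r y"
    if "r \<in> carrier A" "x \<in> carrier S" "y \<in> carrier S" for r x y
    using homog00 that by (simp add: act_def S_distr)
  show "act (r \<oplus>\<^bsub>A\<^esub> s) x = act r x \<oplus>\<^bsub>S\<^esub> act s x"
    if r: "r \<in> carrier A" and s: "s \<in> carrier A" and x: "x \<in> carrier S" for r s x
    unfolding act_def using homog_add[OF homog00(3)[OF r] homog00(3)[OF s]] S_distr(1)[OF homog00(1)[OF r] homog00(1)[OF s] x]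
    by (simp add: even_ring_simps)
  show "act (r \<otimes>\<^bsub>A\<^esub> s) x = act r (act s x)"
    if r: "r \<in> carrier A" and s: "s \<in> carrier A" and x: "x \<in> carrier S" for r s x
    unfolding act_def using homog_mult[OF homog00(3)[OF r] homog00(3)[OF s]] S_mult_assoc[OF homog00(1)[OF r] homog00(1)[OF s] x]
    by (simp add: even_ring_simps)
  show "act \<one>\<^bsub>A\<^esub> x = x" if "x \<in> carrier S" for x
    unfolding act_def using that SR.l_one by (simp add: even_ring_simps flip: one_S)
qed

lemma A_action: "prime_action m A A (\<otimes>\<^bsub>A\<^esub>)"
  by (rule primeideal.self_action[OF prime_m])

lemma ideal_even_annihilator: assumes "z \<in> carrier R" shows "ideal (even_annihilator R z) A"
proof (rule A.idealI_closed)
  show "even_annihilator R z \<subseteq> carrier A" by (auto simp: even_annihilator_def even_ring_simps)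
  show "\<zero>\<^bsub>A\<^esub> \<in> even_annihilator R z" using assms part_closed by (simp add: even_annihilator_def even_ring_simps)
  show "x \<oplus>\<^bsub>A\<^esub> y \<in> even_annihilator R z" if "x \<in> even_annihilator R z" "y \<in> even_annihilator R z" for x y
    using that assms part_closed by (simp add: even_annihilator_def even_ring_simps l_distr)
  show "r \<otimes>\<^bsub>A\<^esub> x \<in> even_annihilator R z" if "x \<in> even_annihilator R z" "r \<in> carrier A" for x r
    using that assms part_closed even_even by (simp add: even_annihilator_def even_ring_simps m_assoc)
qed

text \<open>Multiplication by \<open>z\<close> maps \<open>Ann z + n^k\<close> into bidegree
  \<open>(k + i, j)\<close> of \<open>S\<close> and kills \<open>Ann z + n^(k + 1)\<close>. The
  images for all \<open>k < T\<close> together therefore have at most the length of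
  \<open>A / (Ann z + n^T)\<close>; \<open>V\<close> collects them degree by degree.\<close>

lemma graded_pieces:
  assumes z: "z \<in> Bi i j"
  shows "prime_action.lenle m A A (\<otimes>\<^bsub>A\<^esub>) (even_annihilator R z <+>\<^bsub>A\<^esub> q T) (carrier A) n \<Longrightarrow>
    \<exists>V. SM.lenle {\<zero>\<^bsub>S\<^esub>} V n \<and> (\<forall>k<T. \<forall>a\<in>q k. homog (k + i) j (a \<otimes> z) \<in> V)"
proof (induction T arbitrary: n)
  interpret AM: prime_action m A A "(\<otimes>\<^bsub>A\<^esub>)" by (rule A_action)
  case 0
  have "SM.submod {\<zero>\<^bsub>S\<^esub>}" using SM.act_zero_right by (simp add: SM.submod_def)
  then have "SM.lenle {\<zero>\<^bsub>S\<^esub>} {\<zero>\<^bsub>S\<^esub>} n" using SM.lenle_mono[OF SM.lenle_refl] by blast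
  then show ?case by blast
next
  interpret AM: prime_action m A A "(\<otimes>\<^bsub>A\<^esub>)" by (rule A_action)
  have sub: "AM.submod U \<longleftrightarrow> ideal U A" for U by (rule primeideal.self_submod[OF prime_m])
  have zc: "z \<in> carrier R" using Bi_closed z by blast
  let ?I = "even_annihilator R z"
  have idI: "ideal ?I A" using ideal_even_annihilator[OF zc] .
  case (Suc T)
  have idq: "ideal (?I <+>\<^bsub>A\<^esub> q t) A" for t using A.add_ideals[OF idI ideal_q] .
  have qq: "q (Suc T) \<subseteq> q T" using Bi_Suc_subset by blast
  have sub1: "?I <+>\<^bsub>A\<^esub> q (Suc T) \<subseteq> ?I <+>\<^bsub>A\<^esub> q T"
    using A.ideal_sum_upper[OF idI ideal_q[of T]] qq by (intro A.ideal_sum_least[OF idq]) auto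
  have sub2: "?I <+>\<^bsub>A\<^esub> q T \<subseteq> carrier A" using A.idealD(1)[OF idq] by blast
  obtain n1 n2 where n: "n1 + n2 \<le> n" "AM.lenle (?I <+>\<^bsub>A\<^esub> q (Suc T)) (?I <+>\<^bsub>A\<^esub> q T) n1"
    "AM.lenle (?I <+>\<^bsub>A\<^esub> q T) (carrier A) n2"
    using AM.lenle_split[OF Suc.prems _ sub1 sub2] sub idq by blast
  obtain V where V: "SM.lenle {\<zero>\<^bsub>S\<^esub>} V n2" "\<And>k a. \<lbrakk>k < T; a \<in> q k\<rbrakk> \<Longrightarrow> homog (k + i) j (a \<otimes> z) \<in> V"
    using Suc.IH[OF n(3)] by blast
  have sV: "SM.submod V" using SM.lenle_submod[OF V(1)] by blast
  \<comment> \<open>On \<open>Ann z + n^T\<close> the product with \<open>z\<close> lies in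
    \<open>Bi (T + i) j\<close>, because the summand from the annihilator disappears. Only there
    does \<phi> take a meaningful class.\<close>
  define \<phi> where "\<phi> x = homog (T + i) j (x \<otimes> z)" for x
  have mem: "x \<in> Ev \<and> (\<exists>b\<in>q t. x \<otimes> z = b \<otimes> z)" if x: "x \<in> ?I <+>\<^bsub>A\<^esub> q t" for x t
  proof -
    obtain u b where ub: "u \<in> ?I" "b \<in> q t" "x = u \<oplus>\<^bsub>A\<^esub> b" using x A.mem_add by metis
    have u: "u \<in> Ev" "u \<otimes> z = \<zero>" using ub by (auto simp: even_annihilator_def)
    have "x = u \<oplus> b" using ub by (simp add: even_ring_simps)
    moreover have "(u \<oplus> b) \<otimes> z = b \<otimes> z" using u ub zc part_closed(1) by (simp add: l_distr)
    ultimately show ?thesis using u ub part_closed(5) by auto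
  qed
  have xz: "x \<otimes> z \<in> Bi (t + i) j" if x: "x \<in> ?I <+>\<^bsub>A\<^esub> q t" for x t
  proof -
    obtain b where "b \<in> q t" "x \<otimes> z = b \<otimes> z" using mem[OF x] by blast
    then show ?thesis using Bi_mult[of b t 0 z i j] z by simp
  qed
  have "SM.lenle V (V <+>\<^bsub>S\<^esub> \<phi> ` (?I <+>\<^bsub>A\<^esub> q T)) n1"
  proof (rule lenle_map[OF A_action SM.prime_action_axioms n(2) _ _ _ sV])
    show "\<phi> x \<in> carrier S" if "x \<in> ?I <+>\<^bsub>A\<^esub> q T" for x
      unfolding \<phi>_def using homog_closed(1)[OF xz[OF that]] .
    show "\<phi> (x \<oplus>\<^bsub>A\<^esub> y) = \<phi> x \<oplus>\<^bsub>S\<^esub> \<phi> y" if "x \<in> ?I <+>\<^bsub>A\<^esub> q T" "y \<in> ?I <+>\<^bsub>A\<^esub> q T" for x y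
    proof -
      have "(x \<oplus> y) \<otimes> z = x \<otimes> z \<oplus> y \<otimes> z" using mem[OF that(1)] mem[OF that(2)] zc part_closed(1) by (simp add: l_distr)
      then show ?thesis unfolding \<phi>_def using homog_add[OF xz[OF that(1)] xz[OF that(2)]] by (simp add: even_ring_simps)
    qed
    show "\<phi> (r \<otimes>\<^bsub>A\<^esub> x) = act r (\<phi> x)" if r: "r \<in> carrier A" and x: "x \<in> ?I <+>\<^bsub>A\<^esub> q T" for r x
    proof -
      have "r \<otimes> (x \<otimes> z) = (r \<otimes> x) \<otimes> z" using homog00(4)[OF r] mem[OF x] zc part_closed(1) by (simp add: m_assoc)
      then show ?thesis
        unfolding \<phi>_def act_def using homog_mult[OF homog00(3)[OF r] xz[OF x]] by (simp add: even_ring_simps)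
    qed
    show "\<phi> ` (?I <+>\<^bsub>A\<^esub> q (Suc T)) \<subseteq> V"
    proof
      fix f assume "f \<in> \<phi> ` (?I <+>\<^bsub>A\<^esub> q (Suc T))"
      then obtain x where x: "x \<in> ?I <+>\<^bsub>A\<^esub> q (Suc T)" "f = \<phi> x" by blast
      have "x \<otimes> z \<in> Nx (T + i) j" using Bi_in_Nx(1) xz[OF x(1)] by simp
      then have "f = \<zero>\<^bsub>S\<^esub>" unfolding x(2) \<phi>_def using homog_eq_zero by blast
      then show "f \<in> V" using SM.submodD(2)[OF sV] by simp
    qed
  qed
  then have len: "SM.lenle {\<zero>\<^bsub>S\<^esub>} (V <+>\<^bsub>S\<^esub> \<phi> ` (?I <+>\<^bsub>A\<^esub> q T)) n"
    using SM.lenle_mono[OF SM.lenle_trans[OF _ V(1)], of _ n1 n] n(1) by simp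
  have "homog (k + i) j (a \<otimes> z) \<in> V <+>\<^bsub>S\<^esub> \<phi> ` (?I <+>\<^bsub>A\<^esub> q T)" if k: "k < Suc T" and a: "a \<in> q k" for k a
  proof (cases "k < T")
    case True
    have "V \<subseteq> V <+>\<^bsub>S\<^esub> \<phi> ` (?I <+>\<^bsub>A\<^esub> q T)"
      using SM.lenle_submod[OF \<open>SM.lenle V (V <+>\<^bsub>S\<^esub> \<phi> ` (?I <+>\<^bsub>A\<^esub> q T)) n1\<close>] by blast
    then show ?thesis using V(2)[OF True a] by blast
  next
    case False
    then have kT: "k = T" using k by simp
    have "a \<in> ?I <+>\<^bsub>A\<^esub> q T" using A.ideal_sum_upper(2)[OF idI ideal_q] a kT by blast
    moreover have "\<phi> a = \<zero>\<^bsub>S\<^esub> \<oplus>\<^bsub>S\<^esub> \<phi> a" using homog_closed(1)[OF xz[OF calculation]] unfolding \<phi>_def by simp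
    ultimately show ?thesis using SM.submodD(2)[OF sV] kT unfolding SM.mem_set_add \<phi>_def by blast
  qed
  then show ?case using len by blast
qed

text \<open>\<open>Suc t\<close> counts the degrees from 0 to \<open>t\<close>. The submodule
  \<open>V\<close> may exceed the products that it has to contain; this makes the property pass to
  sums, by adding the submodules.\<close>

definition bounded_growth :: "nat \<Rightarrow> (nat \<Rightarrow> nat \<Rightarrow> 'a set) \<Rightarrow> bool" where
  "bounded_growth d y \<longleftrightarrow> (\<exists>c. \<forall>t. \<exists>V. SM.lenle {\<zero>\<^bsub>S\<^esub>} V (c * growth d (Suc t)) \<and> (\<forall>f\<in>fil t. f \<otimes>\<^bsub>S\<^esub> y \<in> V))"

lemma bounded_growth_homog:
  assumes z: "z \<in> Bi i j" and no: "\<not> has_chain A (even_annihilator R z) d" and id: "ideal (even_annihilator R z) A"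
  shows "bounded_growth d (homog i j z)"
proof -
  obtain c where c: "\<And>t. prime_action.lenle m A A (\<otimes>\<^bsub>A\<^esub>) (even_annihilator R z <+>\<^bsub>A\<^esub> q t) (carrier A) (c * growth d t)"
    using growth_A[OF id no] by blast
  have "\<exists>V. SM.lenle {\<zero>\<^bsub>S\<^esub>} V (c * growth d (Suc t)) \<and> (\<forall>f\<in>fil t. f \<otimes>\<^bsub>S\<^esub> homog i j z \<in> V)" for t
  proof -
    obtain V where V: "SM.lenle {\<zero>\<^bsub>S\<^esub>} V (c * growth d (Suc t))"
      "\<And>k a. \<lbrakk>k < Suc t; a \<in> q k\<rbrakk> \<Longrightarrow> homog (k + i) j (a \<otimes> z) \<in> V"
      using graded_pieces[OF z c] by blast
    have sV: "SM.submod V" using SM.lenle_submod[OF V(1)] by blast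
    have mc: "homog i j z \<in> carrier S" using homog_closed(1)[OF z] .
    have "f \<otimes>\<^bsub>S\<^esub> homog i j z \<in> V" if "f \<in> fil t" for f
      using that
    proof induction
      case zero
      then show ?case using mc SM.submodD(2)[OF sV] by simp
    next
      case (homog k a)
      then show ?case using V(2)[of k a] z by (simp add: homog_mult)
    next
      case (add f g)
      then show ?case using mc fil_even part_S_subset SM.submodD(3)[OF sV] by (simp add: S_distr subset_iff)
    qed
    then show ?thesis using V(1) by blast
  qed
  then show ?thesis unfolding bounded_growth_def by blast
qed

lemma bounded_growth_add:
  assumes "y \<in> carrier S" "y' \<in> carrier S" "bounded_growth d y" "bounded_growth d y'"
  shows "bounded_growth d (y \<oplus>\<^bsub>S\<^esub> y')"
proof -
  obtain c c' where c: "\<And>t. \<exists>V. SM.lenle {\<zero>\<^bsub>S\<^esub>} V (c * growth d (Suc t)) \<and> (\<forall>f\<in>fil t. f \<otimes>\<^bsub>S\<^esub> y \<in> V)"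
    "\<And>t. \<exists>V. SM.lenle {\<zero>\<^bsub>S\<^esub>} V (c' * growth d (Suc t)) \<and> (\<forall>f\<in>fil t. f \<otimes>\<^bsub>S\<^esub> y' \<in> V)"
    using assms(3,4) unfolding bounded_growth_def by metis
  have "\<exists>V. SM.lenle {\<zero>\<^bsub>S\<^esub>} V ((c + c') * growth d (Suc t)) \<and> (\<forall>f\<in>fil t. f \<otimes>\<^bsub>S\<^esub> (y \<oplus>\<^bsub>S\<^esub> y') \<in> V)" for t
  proof -
    obtain V V' where V: "SM.lenle {\<zero>\<^bsub>S\<^esub>} V (c * growth d (Suc t))" "\<forall>f\<in>fil t. f \<otimes>\<^bsub>S\<^esub> y \<in> V"
      and V': "SM.lenle {\<zero>\<^bsub>S\<^esub>} V' (c' * growth d (Suc t))" "\<forall>f\<in>fil t. f \<otimes>\<^bsub>S\<^esub> y' \<in> V'" using c by metis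
    have sV: "SM.submod V" using SM.lenle_submod[OF V(1)] by blast
    have "SM.lenle V (V <+>\<^bsub>S\<^esub> V') (c' * growth d (Suc t))"
      using SM.lenle_add[OF V'(1) sV] SM.submodD(2)[OF sV] by simp
    then have "SM.lenle {\<zero>\<^bsub>S\<^esub>} (V <+>\<^bsub>S\<^esub> V') ((c + c') * growth d (Suc t))"
      using SM.lenle_trans[OF _ V(1)] by (simp add: algebra_simps)
    moreover have "f \<otimes>\<^bsub>S\<^esub> (y \<oplus>\<^bsub>S\<^esub> y') \<in> V <+>\<^bsub>S\<^esub> V'" if f: "f \<in> fil t" for f
    proof -
      have "f \<otimes>\<^bsub>S\<^esub> (y \<oplus>\<^bsub>S\<^esub> y') = f \<otimes>\<^bsub>S\<^esub> y \<oplus>\<^bsub>S\<^esub> f \<otimes>\<^bsub>S\<^esub> y'"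
        using fil_even[OF f] part_S_subset assms by (simp add: S_distr subset_iff)
      then show ?thesis using V(2) V'(2) f unfolding SM.mem_set_add by blast
    qed
    ultimately show ?thesis by blast
  qed
  then show ?thesis unfolding bounded_growth_def by blast
qed

end

section \<open>Chains of primes in the bigraded ring\<close>

context local_super_ring_ideal
begin

section \<open>Nilpotence in positive second degree\<close>

lemma osq_even: "a \<in> odd_square_ideal R \<Longrightarrow> a \<in> Ev"
  unfolding odd_square_ideal_def by (induction rule: ideal_prod.induct) (auto intro: odd_odd part_closed)

lemma even_mult_osq:
  assumes "i \<in> Ev" "a \<in> odd_square_ideal R" shows "i \<otimes> a \<in> odd_square_ideal R"
  using assms(2) unfolding odd_square_ideal_def
proof induction
  case (prod u v)
  have "i \<otimes> (u \<otimes> v) = (i \<otimes> u) \<otimes> v" using assms(1) prod part_closed by (simp add: m_assoc)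
  then show ?case using ideal_prod.prod[OF even_odd[OF assms(1) prod(1)] prod(2), of R] by simp
next
  case (sum s t)
  have "s \<in> carrier R" "t \<in> carrier R" using sum(1,2) osq_even part_closed(1) by (auto simp: odd_square_ideal_def)
  then show ?case using sum ideal_prod.sum[of "i \<otimes> s" R] assms(1) part_closed(1) by (simp add: r_distr)
qed

lemma osq_add: "\<lbrakk>a \<in> odd_square_ideal R; b \<in> odd_square_ideal R\<rbrakk> \<Longrightarrow> a \<oplus> b \<in> odd_square_ideal R"
  unfolding odd_square_ideal_def by (rule ideal_prod.sum)

lemma zero_osq: "\<zero> \<in> odd_square_ideal R"
  using ideal_prod.prod[of \<zero> Od \<zero> Od R] part_closed by (simp add: odd_square_ideal_def)

lemma ideal_osq: "ideal (odd_square_ideal R) A"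
  by (rule A.idealI_closed)
    (use osq_even zero_osq osq_add even_mult_osq in \<open>auto simp: even_ring_simps\<close>)

lemma osq_decompose_add:
  assumes "\<exists>a\<in>odd_square_ideal R. \<exists>b\<in>Od. s = a \<oplus> b" "\<exists>a\<in>odd_square_ideal R. \<exists>b\<in>Od. t = a \<oplus> b"
  shows "\<exists>a\<in>odd_square_ideal R. \<exists>b\<in>Od. s \<oplus> t = a \<oplus> b"
proof -
  obtain a b c d where *: "a \<in> odd_square_ideal R" "b \<in> Od" "s = a \<oplus> b" "c \<in> odd_square_ideal R" "d \<in> Od" "t = c \<oplus> d"
    using assms by blast
  have "a \<in> carrier R" "b \<in> carrier R" "c \<in> carrier R" "d \<in> carrier R" using * osq_even part_closed by auto
  then have "s \<oplus> t = (a \<oplus> c) \<oplus> (b \<oplus> d)" unfolding *(3,6) by (simp add: a_ac)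
  then show ?thesis using osq_add[OF *(1,4)] part_closed(6)[OF *(2,5)] by blast
qed

text \<open>A single factor from the odd part of \<open>N\<close> is enough: times the odd component
  of the other factor it gives an element of \<open>R_1^2\<close>, times the even component an odd
  element. Even factors preserve such sums.\<close>

lemma Bi_odd_decompose:
  "x \<in> Bi k (Suc l) \<Longrightarrow> \<exists>a\<in>odd_square_ideal R. \<exists>b\<in>Od. x = a \<oplus> b"
proof (induction k arbitrary: x)
  case 0
  then show ?case
    unfolding Bi_0_Suc
  proof induction
    case (prod i j)
    obtain a b where ab: "a \<in> Ev" "b \<in> Od" "j = a \<oplus> b" using decompose[OF Bi_closed(1)[OF prod(2)]] .
    have "i \<otimes> j = i \<otimes> b \<oplus> i \<otimes> a" unfolding ab(3) using ab prod part_closed by (simp add: r_distr a_comm)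
    moreover have "i \<otimes> b \<in> odd_square_ideal R"
      unfolding odd_square_ideal_def using prod(1) ab(2) by (intro ideal_prod.prod) auto
    moreover have "i \<otimes> a \<in> Od" using odd_even prod(1) ab(1) by blast
    ultimately show ?case by blast
  qed (rule osq_decompose_add)
next
  case (Suc k)
  note IH = Suc.IH
  show ?case
    using Suc.prems unfolding Bi_Suc[of k "Suc l"]
  proof induction
    case (prod i j)
    obtain a b where ab: "a \<in> odd_square_ideal R" "b \<in> Od" "j = a \<oplus> b" using IH[OF prod(2)] by blast
    have "i \<otimes> j = i \<otimes> a \<oplus> i \<otimes> b" unfolding ab(3) using ab prod part_closed osq_even by (simp add: r_distr)
    then show ?case using even_mult_osq[OF _ ab(1), of i] even_odd[OF _ ab(2), of i] prod(1) by blast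
  qed (rule osq_decompose_add)
qed

lemma even_Bi_osq: assumes "a \<in> Ev" "a \<in> Bi k (Suc l)" shows "a \<in> odd_square_ideal R"
proof -
  obtain c b where "c \<in> odd_square_ideal R" "b \<in> Od" "a = c \<oplus> b" using Bi_odd_decompose[OF assms(2)] by blast
  then show ?thesis using even_component_unique[OF assms(1), of c b] osq_even by auto
qed

lemma homog_pow:
  assumes "a \<in> Ev" "a \<in> Bi k l"
  shows "a [^]\<^bsub>A\<^esub> (n::nat) \<in> Bi (n * k) (n * l) \<and>
    homog k l a [^]\<^bsub>even_ring S\<^esub> n = homog (n * k) (n * l) (a [^]\<^bsub>A\<^esub> n)"
proof (induction n)
  case 0
  then show ?case using one_in_Bi by (simp add: even_ring_simps one_S nat_pow_def)
next
  case (Suc n)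
  have "a [^]\<^bsub>A\<^esub> Suc n = a [^]\<^bsub>A\<^esub> n \<otimes> a"
    "homog k l a [^]\<^bsub>even_ring S\<^esub> Suc n = homog k l a [^]\<^bsub>even_ring S\<^esub> n \<otimes>\<^bsub>S\<^esub> homog k l a"
    by (simp_all add: nat_pow_def even_ring_simps)
  then show ?case
    using Suc Bi_mult[of "a [^]\<^bsub>A\<^esub> n" "n * k" "n * l" a k l] homog_mult[of "a [^]\<^bsub>A\<^esub> n" "n * k" "n * l" a k l] assms(2)
    by (simp add: Groups.add.commute)
qed

text \<open>By \<open>even_Bi_osq\<close> the representative lies in \<open>R_1^2\<close>, so in all
  primes of \<open>A\<close>, so it is nilpotent; its class is then nilpotent as well.\<close>

lemma homog_odd_in_prime:
  assumes P: "primeideal P (even_ring S)" and a: "a \<in> Ev" "a \<in> Bi k (Suc l)"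
  shows "homog k (Suc l) a \<in> P"
proof -
  have "a \<in> Q" if "primeideal Q A" for Q using prime_contains_osq[OF that] even_Bi_osq[OF a] by blast
  then obtain n :: nat where "a [^]\<^bsub>A\<^esub> n = \<zero>" using A.nilpotent_if_in_primes[of a] a(1) by (auto simp: even_ring_simps)
  then have "homog k (Suc l) a [^]\<^bsub>even_ring S\<^esub> n = \<zero>\<^bsub>S\<^esub>" using homog_pow[OF a, of n] by (simp add: homog_zero)
  moreover have "\<zero>\<^bsub>S\<^esub> \<in> P" using SE.idealD(2)[OF primeideal.axioms(1)[OF P]] by (simp add: even_ring_simps)
  ultimately show ?thesis
    using primeideal.prime_power[OF P, of "homog k (Suc l) a" n] homog_closed(2)[OF a(2,1)] by (simp add: even_ring_simps)
qed

text \<open>Chains of primes see an even element only modulo the intersection of all primes; this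
  allows it to be replaced by an element of \<open>fil\<close>, which has a degree.\<close>

lemma even_S_reduce:
  assumes "f \<in> even_part S"
  shows "\<exists>t. \<exists>g\<in>fil t. \<exists>h\<in>even_part S. f = g \<oplus>\<^bsub>S\<^esub> h \<and> (\<forall>P. primeideal P (even_ring S) \<longrightarrow> h \<in> P)"
  using assms
proof (induction rule: even_S_induct)
  case (homog k l a)
  have mc: "homog k l a \<in> even_part S" "homog k l a \<in> carrier S" using homog_closed homog by blast+
  show ?case
  proof (cases l)
    case 0
    have "homog k l a \<in> fil k" using homog 0 by (auto intro: fil.homog)
    moreover have "\<zero>\<^bsub>S\<^esub> \<in> P" if "primeideal P (even_ring S)" for P
      using SE.idealD(2)[OF primeideal.axioms(1)[OF that]] by (simp add: even_ring_simps)
    moreover have "homog k l a = homog k l a \<oplus>\<^bsub>S\<^esub> \<zero>\<^bsub>S\<^esub>" using mc by simp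
    ultimately show ?thesis using zero_even_S by blast
  next
    case (Suc l')
    have "homog k l a \<in> P" if "primeideal P (even_ring S)" for P
      using homog_odd_in_prime[OF that] homog Suc by blast
    moreover have "homog k l a = \<zero>\<^bsub>S\<^esub> \<oplus>\<^bsub>S\<^esub> homog k l a" using mc by simp
    ultimately show ?thesis using mc fil.zero by blast
  qed
next
  case (add f f')
  obtain t g h where 1: "g \<in> fil t" "h \<in> even_part S" "f = g \<oplus>\<^bsub>S\<^esub> h"
    "\<And>P. primeideal P (even_ring S) \<Longrightarrow> h \<in> P" using add.IH(1) by blast
  obtain t' g' h' where 2: "g' \<in> fil t'" "h' \<in> even_part S" "f' = g' \<oplus>\<^bsub>S\<^esub> h'"
    "\<And>P. primeideal P (even_ring S) \<Longrightarrow> h' \<in> P" using add.IH(2) by blast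
  have "g \<in> carrier S" "g' \<in> carrier S" "h \<in> carrier S" "h' \<in> carrier S"
    using 1 2 fil_even part_S_subset by blast+
  then have "f \<oplus>\<^bsub>S\<^esub> f' = (g \<oplus>\<^bsub>S\<^esub> g') \<oplus>\<^bsub>S\<^esub> (h \<oplus>\<^bsub>S\<^esub> h')" unfolding 1(3) 2(3) by (simp add: SR.a_ac)
  moreover have "g \<oplus>\<^bsub>S\<^esub> g' \<in> fil (t + t')"
    using fil_mono[OF 1(1), of "t + t'"] fil_mono[OF 2(1), of "t + t'"] fil.add by simp
  moreover have "h \<oplus>\<^bsub>S\<^esub> h' \<in> P" if P: "primeideal P (even_ring S)" for P
    using SE.idealD(3)[OF primeideal.axioms(1)[OF P] 1(4)[OF P] 2(4)[OF P]] by (simp add: even_ring_simps)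
  ultimately show ?case using even_S_add[OF 1(2) 2(2)] by blast
qed

text \<open>In bidegree \<open>(0, 0)\<close> the elements of \<open>m\<close> become nilpotent,
  since their powers reach \<open>n\<close>. As \<open>s\<close> is invertible modulo
  \<open>m\<close>, a prime containing its class would contain the unit. Hence localising at
  \<open>m\<close> loses nothing modulo a prime of the even ring of \<open>S\<close>.\<close>

lemma homog00_not_in_prime:
  assumes P: "primeideal P (even_ring S)" and s: "s \<in> carrier A - m"
  shows "homog 0 0 s \<notin> P"
proof
  assume sP: "homog 0 0 s \<in> P"
  have iP: "ideal P (even_ring S)" using P primeideal.axioms(1) by blast
  have mP: "homog 0 0 b \<in> P" if b: "b \<in> m" for b
  proof -
    obtain e :: nat where e: "b [^]\<^bsub>A\<^esub> e \<in> N \<inter> Ev" using b radical unfolding ideal_radical_def by blast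
    have bE: "b \<in> Ev" "b \<in> Bi 0 0" using m_even[OF b] part_closed by (auto simp: Bi_0_0)
    have "b [^]\<^bsub>A\<^esub> e \<otimes> \<one> \<in> Bi 1 0" using N0_mult[OF e one_in_Bi] by simp
    then have "b [^]\<^bsub>A\<^esub> e \<in> Bi (Suc 0) 0" using e part_closed(1) by auto
    then have "homog 0 0 b [^]\<^bsub>even_ring S\<^esub> e = \<zero>\<^bsub>S\<^esub>"
      using homog_pow[OF bE, of e] homog_eq_zero[OF Bi_in_Nx(1)] by simp
    then show ?thesis
      using primeideal.prime_power[OF P, of "homog 0 0 b" e] homog_closed(2)[OF bE(2,1)] SE.idealD(2)[OF iP]
      by (simp add: even_ring_simps)
  qed
  have sc: "s \<in> carrier A" using s by blast
  have im: "ideal m A" using maximal_m maximalideal.axioms(1) by blast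
  have "m \<subset> m <+>\<^bsub>A\<^esub> PIdl\<^bsub>A\<^esub> s" using A.ideal_adj_psubset[OF im sc] s by blast
  then have "m <+>\<^bsub>A\<^esub> PIdl\<^bsub>A\<^esub> s = carrier A"
    using maximalideal.I_maximal[OF maximal_m A.ideal_adj[OF im sc]] A.idealD(1)[OF A.ideal_adj[OF im sc]] by blast
  then obtain b w where bw: "b \<in> m" "w \<in> PIdl\<^bsub>A\<^esub> s" "\<one>\<^bsub>A\<^esub> = b \<oplus>\<^bsub>A\<^esub> w" using A.one_closed A.mem_add by metis
  then obtain r where r: "r \<in> carrier A" "w = r \<otimes>\<^bsub>A\<^esub> s" using A.mem_PIdl by metis
  have bc: "b \<in> carrier A" using bw m_even by (simp add: even_ring_simps)
  have "homog 0 0 \<one> = homog 0 0 b \<oplus>\<^bsub>S\<^esub> homog 0 0 r \<otimes>\<^bsub>S\<^esub> homog 0 0 s"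
    using bw(3) r homog_add[OF homog00(3)[OF bc], of w] homog_mult[OF homog00(3)[OF r(1)] homog00(3)[OF sc]]
      homog00(3)[of w] A.m_closed[OF r(1) sc] by (simp add: even_ring_simps)
  also have "\<dots> \<in> P"
    using SE.idealD(3)[OF iP mP[OF bw(1)]] SE.idealD(6)[OF iP sP, of "homog 0 0 r"] homog00(2)[OF r(1)]
    by (simp add: even_ring_simps)
  finally have "\<one>\<^bsub>even_ring S\<^esub> \<in> P" by (simp add: even_ring_simps one_S)
  then show False using ideal.one_imp_carrier[OF iP] primeideal.I_notcarr[OF P] by blast
qed

section \<open>Independent elements along a chain of primes\<close>

lemma submod_prime: assumes "ideal P (even_ring S)" shows "SM.submod P"
  unfolding SM.submod_def
proof (intro conjI ballI)
  note D = SE.idealD[OF assms, unfolded even_ring_simps]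
  show "P \<subseteq> carrier S" using D(1) part_S_subset by blast
  show "\<zero>\<^bsub>S\<^esub> \<in> P" using D(2) .
  show "x \<oplus>\<^bsub>S\<^esub> y \<in> P" if "x \<in> P" "y \<in> P" for x y using D(3) that .
  show "act r x \<in> P" if "r \<in> carrier A" "x \<in> P" for r x
    unfolding act_def using D(6) that homog00(2) by blast
qed

lemma spanl_even:
  assumes "ideal P (even_ring S)" "set L \<subseteq> even_part S" shows "SM.spanl P L \<subseteq> even_part S"
proof (rule SM.spanl_least[OF _ _ assms(2)])
  have "ideal (even_part S) (even_ring S)" using SE.oneideal by (simp add: even_ring_simps)
  then show "SM.submod (even_part S)" by (rule submod_prime)
  show "P \<subseteq> even_part S" using SE.idealD(1)[OF assms(1)] by (auto simp: even_ring_simps)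
qed

lemma spanl_mult:
  assumes "ideal P (even_ring S)" "f \<in> even_part S" "set L \<subseteq> even_part S"
    and "z \<in> SM.spanl P (map (\<lambda>g. f \<otimes>\<^bsub>S\<^esub> g) L)"
  shows "\<exists>p\<in>P. \<exists>w\<in>SM.spanl P L. z = p \<oplus>\<^bsub>S\<^esub> f \<otimes>\<^bsub>S\<^esub> w"
  using assms(3,4)
proof (induction L arbitrary: z)
  case Nil
  have "z \<in> carrier S" using Nil SM.submodD(1)[OF submod_prime[OF assms(1)]] by simp
  then have "z = z \<oplus>\<^bsub>S\<^esub> f \<otimes>\<^bsub>S\<^esub> \<zero>\<^bsub>S\<^esub>" using assms(2) part_S_subset by (simp add: subset_iff)
  then show ?case using Nil SM.submodD(2)[OF submod_prime[OF assms(1)]] by auto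
next
  case (Cons g L)
  obtain u r where u: "u \<in> SM.spanl P (map (\<lambda>g. f \<otimes>\<^bsub>S\<^esub> g) L)" "r \<in> carrier A"
    "z = u \<oplus>\<^bsub>S\<^esub> act r (f \<otimes>\<^bsub>S\<^esub> g)" using Cons.prems by (auto simp: SM.adj_def)
  obtain p w where p: "p \<in> P" "w \<in> SM.spanl P L" "u = p \<oplus>\<^bsub>S\<^esub> f \<otimes>\<^bsub>S\<^esub> w"
    using Cons.IH[OF _ u(1)] Cons.prems by auto
  have c: "f \<in> carrier S" "g \<in> carrier S" "p \<in> carrier S" "w \<in> carrier S" "homog 0 0 r \<in> carrier S"
    using assms(2) Cons.prems p part_S_subset SE.idealD(1)[OF assms(1) p(1)] spanl_even[OF assms(1), of L] homog00(1)[OF u(2)]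
    by (auto simp: even_ring_simps)
  have "act r (f \<otimes>\<^bsub>S\<^esub> g) = f \<otimes>\<^bsub>S\<^esub> act r g"
    using c even_S_commute[OF assms(2) homog00(2)[OF u(2)]] by (simp add: act_def SR.m_assoc[symmetric])
  then have "z = p \<oplus>\<^bsub>S\<^esub> f \<otimes>\<^bsub>S\<^esub> (w \<oplus>\<^bsub>S\<^esub> act r g)"
    unfolding u(3) p(3) using c SM.act_closed[OF u(2) c(2)] by (simp add: SR.r_distr SR.a_assoc)
  moreover have "w \<oplus>\<^bsub>S\<^esub> act r g \<in> SM.spanl P (g # L)" using p u by (auto simp: SM.adj_def)
  ultimately show ?case using p(1) by blast
qed

text \<open>Multiplication by \<open>f\<close> is injective modulo the prime \<open>P\<close>, so a
  relation among the products can be divided by \<open>f\<close>.\<close>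

lemma indep_mult:
  assumes P: "primeideal P (even_ring S)" and f: "f \<in> even_part S" "f \<notin> P" and L: "set L \<subseteq> even_part S"
    and ind: "SM.indep P L"
  shows "SM.indep P (map (\<lambda>g. f \<otimes>\<^bsub>S\<^esub> g) L)"
  using L ind
proof (induction L)
  case (Cons g L)
  have iP: "ideal P (even_ring S)" using P primeideal.axioms(1) by blast
  note D = SE.idealD[OF iP, unfolded even_ring_simps]
  have g: "g \<in> even_part S" "set L \<subseteq> even_part S" using Cons.prems by auto
  have "f \<otimes>\<^bsub>S\<^esub> g \<notin> SM.sat (SM.spanl P (map (\<lambda>g. f \<otimes>\<^bsub>S\<^esub> g) L))"
  proof
    assume "f \<otimes>\<^bsub>S\<^esub> g \<in> SM.sat (SM.spanl P (map (\<lambda>g. f \<otimes>\<^bsub>S\<^esub> g) L))"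
    then obtain s where s: "s \<in> carrier A - m" "act s (f \<otimes>\<^bsub>S\<^esub> g) \<in> SM.spanl P (map (\<lambda>g. f \<otimes>\<^bsub>S\<^esub> g) L)"
      by (auto simp: SM.sat_def)
    then obtain p w where p: "p \<in> P" "w \<in> SM.spanl P L" "act s (f \<otimes>\<^bsub>S\<^esub> g) = p \<oplus>\<^bsub>S\<^esub> f \<otimes>\<^bsub>S\<^esub> w"
      using spanl_mult[OF iP f(1) g(2)] by blast
    have sc: "s \<in> carrier A" using s by blast
    have wE: "w \<in> even_part S" using spanl_even[OF iP g(2)] p(2) by blast
    have agE: "act s g \<in> even_part S" unfolding act_def using even_S_mult[OF homog00(2)[OF sc] g(1)] .
    have c: "f \<in> carrier S" "g \<in> carrier S" "p \<in> carrier S" "w \<in> carrier S" "homog 0 0 s \<in> carrier S" "act s g \<in> carrier S"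
      using f g wE D(1)[OF p(1)] agE part_S_subset homog00(1)[OF sc] by auto
    have "act s (f \<otimes>\<^bsub>S\<^esub> g) = f \<otimes>\<^bsub>S\<^esub> act s g"
      using c even_S_commute[OF f(1) homog00(2)[OF sc]] by (simp add: act_def SR.m_assoc[symmetric])
    then have "f \<otimes>\<^bsub>S\<^esub> (act s g \<ominus>\<^bsub>S\<^esub> w) = p \<oplus>\<^bsub>S\<^esub> f \<otimes>\<^bsub>S\<^esub> w \<ominus>\<^bsub>S\<^esub> f \<otimes>\<^bsub>S\<^esub> w"
      using p(3) c by (simp add: SR.minus_eq SR.r_distr SR.r_minus)
    also have "\<dots> = p" using c by (simp add: SR.minus_eq SR.a_assoc SR.r_neg)
    finally have inP: "f \<otimes>\<^bsub>S\<^esub> (act s g \<ominus>\<^bsub>S\<^esub> w) \<in> P" using p(1) by simp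
    have "SM.submod (even_part S)" using SE.oneideal submod_prime by (simp add: even_ring_simps)
    then have dE: "act s g \<ominus>\<^bsub>S\<^esub> w \<in> even_part S" using SM.submodD(6) agE wE by blast
    then have "act s g \<ominus>\<^bsub>S\<^esub> w \<in> P"
      using primeideal.I_prime[OF P, of f "act s g \<ominus>\<^bsub>S\<^esub> w"] inP f by (simp add: even_ring_simps)
    moreover have "set L \<subseteq> carrier S" using g part_S_subset by blast
    ultimately have "act s g \<ominus>\<^bsub>S\<^esub> w \<in> SM.spanl P L" using SM.spanl_upper[OF submod_prime[OF iP]] by blast
    then have "act s g \<ominus>\<^bsub>S\<^esub> w \<oplus>\<^bsub>S\<^esub> w \<in> SM.spanl P L"
      using SM.submodD(3)[OF SM.submod_spanl[OF submod_prime[OF iP] \<open>set L \<subseteq> carrier S\<close>]] p(2) by blast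
    moreover have "act s g \<ominus>\<^bsub>S\<^esub> w \<oplus>\<^bsub>S\<^esub> w = act s g" using c by (simp add: SR.minus_eq SR.a_assoc SR.l_neg)
    ultimately have "g \<in> SM.sat (SM.spanl P L)" using SM.satI[OF c(2) s(1)] by simp
    then show False using Cons.prems by simp
  qed
  then show ?case using Cons by simp
qed simp

lemma spanl_append_subset:
  assumes "ideal P (even_ring S)" "ideal P' (even_ring S)" "P \<subseteq> P'" "set M \<subseteq> P'"
  shows "SM.spanl P (L @ M) \<subseteq> SM.spanl P' L"
proof (induction L)
  case Nil
  then show ?case using SM.spanl_least[OF submod_prime[OF assms(2)] assms(3,4)] by simp
next
  case (Cons g L)
  then show ?case by (auto simp: SM.adj_def)
qed

text \<open>\<open>spanl\<close> takes up \<open>M\<close> before \<open>L\<close>. Since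
  \<open>M\<close> vanishes modulo \<open>P'\<close>, the entries of \<open>L\<close> still enlarge
  the span.\<close>

lemma indep_append:
  assumes "ideal P (even_ring S)" "ideal P' (even_ring S)" "P \<subseteq> P'" "set M \<subseteq> P'"
    and "SM.indep P M" "SM.indep P' L"
  shows "SM.indep P (L @ M)"
  using assms(6)
proof (induction L)
  case (Cons g L)
  then show ?case using SM.sat_mono[OF spanl_append_subset[OF assms(1-4), of L]] by auto
qed (use assms(5) in simp)

text \<open>A chain of primes \<open>P = P\<^sub>0 \<subset> \<dots> \<subset> P\<^sub>n\<close> and elements \<open>f\<^sub>i \<in> P\<^sub>i - P\<^sub>i\<^sub>-\<^sub>1\<close> give, ordered
  lexicographically, \<open>T\<^sup>n\<close> monomials in the \<open>f\<^sub>i\<close> that are independent modulo \<open>P\<close>.\<close>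

lemma chain_independent:
  "chain_from (even_ring S) n P \<Longrightarrow>
    \<exists>\<delta>. \<forall>T. \<exists>L. length L = T ^ n \<and> set L \<subseteq> fil (\<delta> * T) \<and> SM.indep P L"
proof (induction n arbitrary: P)
  case 0
  then have P: "primeideal P (even_ring S)" by simp
  have "\<one>\<^bsub>S\<^esub> \<notin> SM.sat P"
  proof
    assume "\<one>\<^bsub>S\<^esub> \<in> SM.sat P"
    then obtain s where s: "s \<in> carrier A - m" "act s \<one>\<^bsub>S\<^esub> \<in> P" by (auto simp: SM.sat_def)
    then show False using homog00_not_in_prime[OF P s(1)] homog00(1)[of s] by (simp add: act_def)
  qed
  then have "SM.indep P [\<one>\<^bsub>S\<^esub>]" by simp
  moreover have "set [\<one>\<^bsub>S\<^esub>] \<subseteq> fil t" for t using one_fil by simp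
  ultimately have "length [\<one>\<^bsub>S\<^esub>] = T ^ 0 \<and> set [\<one>\<^bsub>S\<^esub>] \<subseteq> fil (0 * T) \<and> SM.indep P [\<one>\<^bsub>S\<^esub>]" for T :: nat
    by simp
  then show ?case by blast
next
  case (Suc n)
  obtain P' where P: "primeideal P (even_ring S)" and P': "P \<subset> P'" "chain_from (even_ring S) n P'"
    using Suc.prems by auto
  have prP': "primeideal P' (even_ring S)" using chain_from_prime[OF P'(2)] .
  have iP: "ideal P (even_ring S)" and iP': "ideal P' (even_ring S)" using P prP' primeideal.axioms(1) by blast+
  obtain \<delta> where \<delta>: "\<And>T. \<exists>L. length L = T ^ n \<and> set L \<subseteq> fil (\<delta> * T) \<and> SM.indep P' L" using Suc.IH[OF P'(2)] by blast
  obtain f where f: "f \<in> P'" "f \<notin> P" using P'(1) by blast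
  have "f \<in> even_part S" using SE.idealD(1)[OF iP' f(1)] by (simp add: even_ring_simps)
  \<comment> \<open>\<open>f\<close> is exchanged for an element \<open>g\<close> of bounded degree.
    The difference \<open>h\<close> lies in both primes, so \<open>g\<close> separates them as
    well.\<close>
  then obtain e g h where gh: "g \<in> fil e" "h \<in> even_part S" "f = g \<oplus>\<^bsub>S\<^esub> h" "h \<in> P" "h \<in> P'"
    using even_S_reduce P prP' by blast
  have gE: "g \<in> even_part S" using fil_even gh(1) .
  have "g \<notin> P" using SE.idealD(3)[OF iP, of g h] gh f by (auto simp: even_ring_simps)
  have "g = f \<ominus>\<^bsub>S\<^esub> h" using gh gE part_S_subset by (simp add: SR.minus_eq SR.a_assoc SR.r_neg subset_iff)
  then have "g \<in> P'" using SM.submodD(6)[OF submod_prime[OF iP'] f(1) gh(5)] by metis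
  \<comment> \<open>The list consists of \<open>j\<close> blocks: one that is independent modulo
    \<open>P'\<close>, followed by \<open>g\<close> times the previous blocks, which lies in
    \<open>P'\<close>. Each factor \<open>g\<close> adds \<open>e\<close> to the degree, so
    \<open>j = T\<close> gives the claim with slope \<open>\<delta> + e\<close>.\<close>
  have "\<exists>L. length L = j * T ^ n \<and> set L \<subseteq> fil (\<delta> * T + e * j) \<and> SM.indep P L" for T j
  proof (induction j)
    case 0
    then show ?case by simp
  next
    case (Suc j)
    obtain M where M: "length M = j * T ^ n" "set M \<subseteq> fil (\<delta> * T + e * j)" "SM.indep P M" using Suc by blast
    obtain L where L: "length L = T ^ n" "set L \<subseteq> fil (\<delta> * T)" "SM.indep P' L" using \<delta> by blast
    have ME: "set M \<subseteq> even_part S" using M fil_even by blast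
    let ?K = "L @ map (\<lambda>u. g \<otimes>\<^bsub>S\<^esub> u) M"
    have "set (map (\<lambda>u. g \<otimes>\<^bsub>S\<^esub> u) M) \<subseteq> P'"
      using SE.idealD(7)[OF iP' \<open>g \<in> P'\<close>] ME by (auto simp: even_ring_simps)
    then have "SM.indep P ?K"
      using indep_append[OF iP iP' _ _ indep_mult[OF P gE \<open>g \<notin> P\<close> ME M(3)] L(3)] P'(1) by blast
    moreover have "set L \<subseteq> fil (\<delta> * T + e * Suc j)" using L(2) fil_mono by fastforce
    moreover have "g \<otimes>\<^bsub>S\<^esub> u \<in> fil (\<delta> * T + e * Suc j)" if "u \<in> set M" for u
      using fil_mult[OF gh(1), of u "\<delta> * T + e * j"] M(2) that by (auto simp: algebra_simps)
    ultimately have "length ?K = Suc j * T ^ n \<and> set ?K \<subseteq> fil (\<delta> * T + e * Suc j) \<and> SM.indep P ?K"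
      using L(1) M(1) by auto
    then show ?case by blast
  qed
  then have "\<exists>L. length L = T ^ Suc n \<and> set L \<subseteq> fil ((\<delta> + e) * T) \<and> SM.indep P L" for T
    by (metis distrib_right power_Suc)
  then show ?case by blast
qed

text \<open>A relation among the multiples of \<open>y\<close> is a relation among the factors
  modulo \<open>Ann y\<close>, and so modulo \<open>P\<close>.\<close>

lemma indep_times:
  assumes P: "ideal P (even_ring S)" and y: "y \<in> carrier S" and ann: "even_annihilator S y \<subseteq> P"
    and L: "set L \<subseteq> even_part S" and ind: "SM.indep P L"
  shows "SM.indep {\<zero>\<^bsub>S\<^esub>} (map (\<lambda>g. g \<otimes>\<^bsub>S\<^esub> y) L)"
  using L ind
proof (induction L)
  case (Cons g L)
  have g: "g \<in> even_part S" "set L \<subseteq> even_part S" using Cons.prems by auto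
  have zP: "\<zero>\<^bsub>S\<^esub> \<in> P" using SE.idealD(2)[OF P] by (simp add: even_ring_simps)
  have span: "\<exists>u\<in>SM.spanl P L. z = u \<otimes>\<^bsub>S\<^esub> y"
    if "z \<in> SM.spanl {\<zero>\<^bsub>S\<^esub>} (map (\<lambda>g. g \<otimes>\<^bsub>S\<^esub> y) L)" "set L \<subseteq> even_part S" for z L
    using that
  proof (induction L arbitrary: z)
    case Nil
    then show ?case using zP y by (intro bexI[of _ "\<zero>\<^bsub>S\<^esub>"]) auto
  next
    case (Cons h L)
    obtain v r where v: "v \<in> SM.spanl {\<zero>\<^bsub>S\<^esub>} (map (\<lambda>g. g \<otimes>\<^bsub>S\<^esub> y) L)" "r \<in> carrier A"
      "z = v \<oplus>\<^bsub>S\<^esub> act r (h \<otimes>\<^bsub>S\<^esub> y)" using Cons.prems(1) by (auto simp: SM.adj_def)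
    obtain u where u: "u \<in> SM.spanl P L" "v = u \<otimes>\<^bsub>S\<^esub> y" using Cons.IH[OF v(1)] Cons.prems(2) by auto
    have c: "h \<in> carrier S" "u \<in> carrier S" "homog 0 0 r \<in> carrier S"
      using Cons.prems(2) u spanl_even[OF P, of L] part_S_subset homog00(1)[OF v(2)] by auto
    have "z = (u \<oplus>\<^bsub>S\<^esub> act r h) \<otimes>\<^bsub>S\<^esub> y"
      unfolding v(3) u(2) act_def using c y by (simp add: SR.l_distr SR.m_assoc)
    moreover have "u \<oplus>\<^bsub>S\<^esub> act r h \<in> SM.spanl P (h # L)" using u v by (auto simp: SM.adj_def)
    ultimately show ?case by blast
  qed
  have "g \<otimes>\<^bsub>S\<^esub> y \<notin> SM.sat (SM.spanl {\<zero>\<^bsub>S\<^esub>} (map (\<lambda>g. g \<otimes>\<^bsub>S\<^esub> y) L))"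
  proof
    assume "g \<otimes>\<^bsub>S\<^esub> y \<in> SM.sat (SM.spanl {\<zero>\<^bsub>S\<^esub>} (map (\<lambda>g. g \<otimes>\<^bsub>S\<^esub> y) L))"
    then obtain s where s: "s \<in> carrier A - m" "act s (g \<otimes>\<^bsub>S\<^esub> y) \<in> SM.spanl {\<zero>\<^bsub>S\<^esub>} (map (\<lambda>g. g \<otimes>\<^bsub>S\<^esub> y) L)"
      by (auto simp: SM.sat_def)
    obtain u where u: "u \<in> SM.spanl P L" "act s (g \<otimes>\<^bsub>S\<^esub> y) = u \<otimes>\<^bsub>S\<^esub> y" using span[OF s(2) g(2)] by blast
    have sc: "s \<in> carrier A" using s by blast
    have uE: "u \<in> even_part S" using spanl_even[OF P g(2)] u by blast
    have agE: "act s g \<in> even_part S" unfolding act_def using even_S_mult[OF homog00(2)[OF sc] g(1)] .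
    have c: "u \<in> carrier S" "act s g \<in> carrier S" "g \<in> carrier S" "homog 0 0 s \<in> carrier S"
      using uE agE g part_S_subset homog00(1)[OF sc] by auto
    have "act s g \<otimes>\<^bsub>S\<^esub> y = u \<otimes>\<^bsub>S\<^esub> y" using u(2) c y by (simp add: act_def SR.m_assoc)
    then have "(act s g \<ominus>\<^bsub>S\<^esub> u) \<otimes>\<^bsub>S\<^esub> y = \<zero>\<^bsub>S\<^esub>"
      using c y by (simp add: SR.minus_eq SR.l_distr SR.l_minus SR.r_neg)
    moreover have "SM.submod (even_part S)" using SE.oneideal submod_prime by (simp add: even_ring_simps)
    then have "act s g \<ominus>\<^bsub>S\<^esub> u \<in> even_part S" using SM.submodD(6) agE uE by blast
    ultimately have "act s g \<ominus>\<^bsub>S\<^esub> u \<in> P" using ann by (auto simp: even_annihilator_def)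
    moreover have Lc: "set L \<subseteq> carrier S" using g part_S_subset by blast
    ultimately have "act s g \<ominus>\<^bsub>S\<^esub> u \<oplus>\<^bsub>S\<^esub> u \<in> SM.spanl P L"
      using SM.spanl_upper[OF submod_prime[OF P] Lc] SM.submodD(3)[OF SM.submod_spanl[OF submod_prime[OF P] Lc]] u(1) by blast
    moreover have "act s g \<ominus>\<^bsub>S\<^esub> u \<oplus>\<^bsub>S\<^esub> u = act s g" using c by (simp add: SR.minus_eq SR.a_assoc SR.l_neg)
    ultimately have "g \<in> SM.sat (SM.spanl P L)" using SM.satI[OF c(3) s(1)] by simp
    then show False using Cons.prems by simp
  qed
  then show ?case using Cons by simp
qed simp

lemma bounded_growth_no_chain:
  assumes y: "y \<in> carrier S" and bg: "bounded_growth d y"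
  shows "\<not> has_chain (even_ring S) (even_annihilator S y) d"
proof
  assume "has_chain (even_ring S) (even_annihilator S y) d"
  then obtain P where P: "even_annihilator S y \<subseteq> P" "chain_from (even_ring S) d P" unfolding has_chain_from by blast
  have iP: "ideal P (even_ring S)" using chain_from_prime[OF P(2)] primeideal.axioms(1) by blast
  obtain \<delta> where \<delta>: "\<And>T. \<exists>L. length L = T ^ d \<and> set L \<subseteq> fil (\<delta> * T) \<and> SM.indep P L"
    using chain_independent[OF P(2)] by blast
  obtain c where c: "\<And>t. \<exists>V. SM.lenle {\<zero>\<^bsub>S\<^esub>} V (c * growth d (Suc t)) \<and> (\<forall>f\<in>fil t. f \<otimes>\<^bsub>S\<^esub> y \<in> V)"
    using bg unfolding bounded_growth_def by blast
  have bound: "T ^ d \<le> c * growth d (Suc (\<delta> * T))" for T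
  proof -
    obtain L where L: "length L = T ^ d" "set L \<subseteq> fil (\<delta> * T)" "SM.indep P L" using \<delta> by blast
    obtain V where V: "SM.lenle {\<zero>\<^bsub>S\<^esub>} V (c * growth d (Suc (\<delta> * T)))" "\<forall>f\<in>fil (\<delta> * T). f \<otimes>\<^bsub>S\<^esub> y \<in> V"
      using c by blast
    have "set L \<subseteq> even_part S" using L(2) fil_even by blast
    then have "SM.indep {\<zero>\<^bsub>S\<^esub>} (map (\<lambda>g. g \<otimes>\<^bsub>S\<^esub> y) L)" using indep_times[OF iP y P(1) _ L(3)] by blast
    then have "length (map (\<lambda>g. g \<otimes>\<^bsub>S\<^esub> y) L) \<le> c * growth d (Suc (\<delta> * T))"
      using SM.indep_length_le[OF V(1)] V(2) L(2) by (metis (no_types, lifting) image_subset_iff list.set_map subsetD)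
    then show ?thesis using L(1) by simp
  qed
  show False
  proof (cases d)
    case 0
    \<comment> \<open>For \<open>d = 0\<close> the left side is 1, while \<open>growth\<close> is
      0.\<close>
    then show False using bound[of 0] by (simp add: growth_def)
  next
    case (Suc d')
    \<comment> \<open>The bound reads \<open>T^(d' + 1) \<le> c (\<delta> T + 2)^d'\<close>, and
      \<open>\<delta> T + 2 \<le> (\<delta> + 2) T\<close> for \<open>T \<ge> 1\<close>. Dividing by
      \<open>T^d'\<close> leaves a constant, which this \<open>T\<close> exceeds by one.\<close>
    define T where "T = c * (\<delta> + 2) ^ d' + 1"
    have "T * T ^ d' \<le> c * (\<delta> * T + 2) ^ d'" using bound[of T] Suc by (simp add: growth_def)
    also have "\<delta> * T + 2 \<le> (\<delta> + 2) * T" by (simp add: T_def)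
    then have "c * (\<delta> * T + 2) ^ d' \<le> c * ((\<delta> + 2) * T) ^ d'" by (intro mult_left_mono power_mono) auto
    also have "\<dots> = (c * (\<delta> + 2) ^ d') * T ^ d'" by (simp only: power_mult_distrib mult.assoc)
    finally have "T \<le> c * (\<delta> + 2) ^ d'" by (simp add: T_def)
    then show False by (simp add: T_def)
  qed
qed

lemma chain_lift:
  assumes "set ys \<subseteq> odd_part S" "has_chain (even_ring S) (even_annihilator S (list_product S ys)) d"
  shows "\<exists>zs. length zs = length ys \<and> set zs \<subseteq> Od \<and> has_chain A (even_annihilator R (list_product R zs)) d"
proof (rule ccontr)
  assume H: "\<not> ?thesis"
  have "f \<in> carrier S \<and> bounded_growth d f" if "f \<in> osum (length ys)" for f
    using that
  proof induction
    case (homog zs i j)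
    then have "\<not> has_chain A (even_annihilator R (list_product R zs)) d" using H by blast
    then show ?case
      using bounded_growth_homog[OF homog(3)] ideal_even_annihilator[OF Bi_closed(1)[OF homog(3)]] homog_closed(1)[OF homog(3)] by blast
  next
    case (add f g)
    then show ?case using bounded_growth_add S_add_closed by blast
  qed
  then show False using bounded_growth_no_chain list_product_osum[OF assms(1)] assms(2) by blast
qed

end

section \<open>Analytic independence of parameters\<close>

text \<open>Each variable gets an excess that is one more than the total excess of all exponents
  after it, and this is the sum of exponents times excesses. One more power of a variable thus
  outweighs everything behind it. With \<open>W\<close> added to each excess, the monomial with
  exponents \<open>hs\<close> has weight \<open>sum_list hs * W + lex_total hs\<close>.\<close>

fun lex_total :: "nat list \<Rightarrow> nat" where
  "lex_total [] = 0"
| "lex_total (h # hs) = Suc (lex_total hs) * h + lex_total hs"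

text \<open>The perturbations are chosen so that, among the monomials of the degree of \<open>hs\<close>, those that
  follow \<open>hs\<close> in the lexicographic order are heavier than \<open>hs\<close>.\<close>

fun weights :: "nat \<Rightarrow> nat list \<Rightarrow> nat list" where
  "weights W [] = []"
| "weights W (h # hs) = (W + Suc (lex_total hs)) # weights W hs"

lemma weights_length [simp]: "length (weights W hs) = length hs"
  by (induction hs) auto

lemma weights_bounds: "w \<in> set (weights W hs) \<Longrightarrow> Suc W \<le> w"
  by (induction hs) auto

context cring
begin

text \<open>Written out, the elements are
  \<open>f_1^h_1 (f_2^h_2 (... f_r^h_r (1 + f_r c_r) ...) + f_1 c_1)\<close>: the iterated boundary
  monoid of the elementary theory of Krull dimension.\<close>

fun boundary_monoid :: "'a list \<Rightarrow> 'a set" where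
  "boundary_monoid [] = {\<one>}"
| "boundary_monoid (f # fs) = {f [^] h \<otimes> (w \<oplus> f \<otimes> c) | (h::nat) w c. w \<in> boundary_monoid fs \<and> c \<in> carrier R}"

lemma boundary_monoid_closed:
  assumes "set fs \<subseteq> carrier R"
  shows "boundary_monoid fs \<subseteq> carrier R" "\<one> \<in> boundary_monoid fs" "\<lbrakk>s \<in> boundary_monoid fs; t \<in> boundary_monoid fs\<rbrakk> \<Longrightarrow> s \<otimes> t \<in> boundary_monoid fs"
proof -
  have "boundary_monoid fs \<subseteq> carrier R \<and> \<one> \<in> boundary_monoid fs \<and> (\<forall>s\<in>boundary_monoid fs. \<forall>t\<in>boundary_monoid fs. s \<otimes> t \<in> boundary_monoid fs)"
    using assms
  proof (induction fs)
    case (Cons f fs)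
    have f: "f \<in> carrier R" and IH: "boundary_monoid fs \<subseteq> carrier R" "\<one> \<in> boundary_monoid fs"
      "\<And>s t. \<lbrakk>s \<in> boundary_monoid fs; t \<in> boundary_monoid fs\<rbrakk> \<Longrightarrow> s \<otimes> t \<in> boundary_monoid fs" using Cons by auto
    have memI: "f [^] h \<otimes> (w \<oplus> f \<otimes> c) \<in> boundary_monoid (f # fs)" if "w \<in> boundary_monoid fs" "c \<in> carrier R" for h :: nat and w c
      using that by auto
    have "f [^] (0::nat) \<otimes> (\<one> \<oplus> f \<otimes> \<zero>) = \<one>" using f by simp
    then have one: "\<one> \<in> boundary_monoid (f # fs)" using memI[OF IH(2) zero_closed, of 0] by metis
    have "s \<otimes> t \<in> boundary_monoid (f # fs)" if st: "s \<in> boundary_monoid (f # fs)" "t \<in> boundary_monoid (f # fs)" for s t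
    proof -
      obtain h w c where s: "s = f [^] (h::nat) \<otimes> (w \<oplus> f \<otimes> c)" "w \<in> boundary_monoid fs" "c \<in> carrier R" using st by auto
      obtain h' w' c' where t: "t = f [^] (h'::nat) \<otimes> (w' \<oplus> f \<otimes> c')" "w' \<in> boundary_monoid fs" "c' \<in> carrier R" using st by auto
      have c: "w \<in> carrier R" "w' \<in> carrier R" "f [^] h \<in> carrier R" "f [^] h' \<in> carrier R" using s t IH(1) f by auto
      have "s \<otimes> t = (f [^] h \<otimes> f [^] h') \<otimes> (w \<otimes> w' \<oplus> f \<otimes> (w \<otimes> c' \<oplus> c \<otimes> w' \<oplus> f \<otimes> (c \<otimes> c')))"
        unfolding s(1) t(1) using c s(3) t(3) f by algebra
      also have "\<dots> = f [^] (h + h') \<otimes> (w \<otimes> w' \<oplus> f \<otimes> (w \<otimes> c' \<oplus> c \<otimes> w' \<oplus> f \<otimes> (c \<otimes> c')))"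
        using f by (simp add: nat_pow_mult)
      also have "\<dots> \<in> boundary_monoid (f # fs)" using memI IH(3)[OF s(2) t(2)] c s(3) t(3) f by simp
      finally show ?thesis .
    qed
    moreover have "boundary_monoid (f # fs) \<subseteq> carrier R" using f IH(1) by auto
    ultimately show ?case using one by blast
  qed simp
  then show "boundary_monoid fs \<subseteq> carrier R" "\<one> \<in> boundary_monoid fs" "\<lbrakk>s \<in> boundary_monoid fs; t \<in> boundary_monoid fs\<rbrakk> \<Longrightarrow> s \<otimes> t \<in> boundary_monoid fs" by blast+
qed

text \<open>The prime-chain criterion of Coquand and Lombardi, in the direction that produces chains.\<close>

lemma chain_of_boundary_monoid:
  "\<lbrakk>ideal I R; set fs \<subseteq> carrier R; boundary_monoid fs \<inter> I = {}\<rbrakk> \<Longrightarrow> has_chain R I (length fs)"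
proof (induction fs arbitrary: I)
  case Nil
  then obtain P where "primeideal P R" "I \<subseteq> P" using prime_avoiding[OF Nil(1), of "{\<one>}"] by auto
  then show ?case unfolding has_chain_from by auto
next
  case (Cons f fs)
  have f: "f \<in> carrier R" and fs: "set fs \<subseteq> carrier R" using Cons.prems by auto
  \<comment> \<open>A prime that avoids the whole monoid can be the bottom of the chain: it omits
    \<open>f\<close>, and the monoid of the remaining elements avoids \<open>P + (f)\<close>, since
    from \<open>w = p + r f\<close> the element \<open>w - f r\<close> would lie both in
    \<open>P\<close> and in the larger monoid.\<close>
  obtain P where P: "primeideal P R" "I \<subseteq> P" "P \<inter> boundary_monoid (f # fs) = {}"
    using prime_avoiding[OF Cons.prems(1) boundary_monoid_closed[OF Cons.prems(2)]] Cons.prems(3) by blast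
  have iP: "ideal P R" using P(1) primeideal.axioms(1) by blast
  have "f [^] (1::nat) \<otimes> (\<one> \<oplus> f \<otimes> \<zero>) = f" using f by simp
  moreover have "f [^] (1::nat) \<otimes> (\<one> \<oplus> f \<otimes> \<zero>) \<in> boundary_monoid (f # fs)"
    unfolding boundary_monoid.simps using boundary_monoid_closed(2)[OF fs] by blast
  ultimately have fP: "f \<notin> P" using P(3) by auto
  have "boundary_monoid fs \<inter> (P <+>\<^bsub>R\<^esub> PIdl f) = {}"
  proof (rule ccontr)
    assume "boundary_monoid fs \<inter> (P <+>\<^bsub>R\<^esub> PIdl f) \<noteq> {}"
    then obtain w where w: "w \<in> boundary_monoid fs" "w \<in> P <+>\<^bsub>R\<^esub> PIdl f" by blast
    then obtain p v where pv: "p \<in> P" "v \<in> PIdl f" "w = p \<oplus> v" using mem_add by metis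
    then obtain r where r: "r \<in> carrier R" "v = r \<otimes> f" using mem_PIdl by metis
    have pc: "p \<in> carrier R" using idealD(1)[OF iP pv(1)] .
    have "f [^] (0::nat) \<otimes> (w \<oplus> f \<otimes> (\<ominus> r)) = p"
      unfolding pv(3) r(2) using f r(1) pc by (simp add: r_minus m_comm[of r f] a_assoc r_neg)
    moreover have "f [^] (0::nat) \<otimes> (w \<oplus> f \<otimes> (\<ominus> r)) \<in> boundary_monoid (f # fs)"
      unfolding boundary_monoid.simps using w(1) a_inv_closed[OF r(1)] by blast
    ultimately show False using P(3) pv(1) by auto
  qed
  then have "has_chain R (P <+>\<^bsub>R\<^esub> PIdl f) (length fs)"
    using Cons.IH[OF ideal_adj[OF iP f] fs] by blast
  then have "has_chain R P (Suc (length fs))"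
    using has_chain_Suc[OF P(1)] ideal_adj_psubset[OF iP f fP] by blast
  then show ?case using has_chain_mono[OF _ P(2) order.refl] by simp
qed

text \<open>These are the forms left of elements of the boundary monoid when a single degree is
  kept. The product \<open>x \<otimes> c\<close> must have the degree \<open>sum_list hs\<close> of
  \<open>u\<close>, so \<open>c\<close> has one degree less, and in degree 0 it is absent. Each form
  is the monomial with exponents \<open>hs\<close> plus terms with lexicographically larger
  exponents.\<close>

inductive lead :: "(nat \<Rightarrow> 'a set) \<Rightarrow> 'a list \<Rightarrow> nat list \<Rightarrow> 'a \<Rightarrow> bool" for q where
  nil: "lead q [] [] \<one>"
| cons: "\<lbrakk>lead q l hs u; if sum_list hs = 0 then c = \<zero> else c \<in> q (sum_list hs - 1)\<rbrakk> \<Longrightarrow>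
    lead q (x # l) (h # hs) (x [^] h \<otimes> (u \<oplus> x \<otimes> c))"

fun monomial :: "'a list \<Rightarrow> nat list \<Rightarrow> 'a" where
  "monomial (x # l) (h # hs) = x [^] h \<otimes> monomial l hs"
| "monomial _ _ = \<one>"

definition filtration :: "(nat \<Rightarrow> 'a set) \<Rightarrow> bool" where
  "filtration J \<longleftrightarrow> (\<forall>v. ideal (J v) R) \<and> J 0 = carrier R \<and> (\<forall>u v. u \<le> v \<longrightarrow> J v \<subseteq> J u) \<and>
     (\<forall>u v. \<forall>a\<in>J u. \<forall>b\<in>J v. a \<otimes> b \<in> J (u + v))"

lemma filtrationD:
  assumes "filtration J"
  shows "ideal (J v) R" "J 0 = carrier R" "\<lbrakk>u \<le> v; a \<in> J v\<rbrakk> \<Longrightarrow> a \<in> J u"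
    "\<lbrakk>a \<in> J u; b \<in> J v\<rbrakk> \<Longrightarrow> a \<otimes> b \<in> J (u + v)"
  using assms unfolding filtration_def by blast+

lemma filtration_pow: assumes "filtration J" "a \<in> J u" shows "a [^] (n::nat) \<in> J (n * u)"
proof (induction n)
  case 0
  then show ?case using filtrationD(2)[OF assms(1)] by simp
next
  case (Suc n)
  then show ?case using filtrationD(4)[OF assms(1) Suc assms(2)] by (simp add: Groups.add.commute)
qed

text \<open>With \<open>\<delta> = Suc (lex_total hs)\<close> for the tail \<open>hs\<close>, the
  extra term \<open>x [^] h \<otimes> (x \<otimes> c)\<close> has weight at least
  \<open>h (W + \<delta>) + (W + \<delta>) + (sum_list hs - 1) W\<close>, exactly one more than the
  weight of the monomial, which is therefore the only term of lowest weight.\<close>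

lemma lead_approx:
  assumes J: "filtration J" and q: "\<And>k. q k \<subseteq> J (k * W)"
  shows "\<lbrakk>lead q l hs u; \<And>x w. (x, w) \<in> set (zip l (weights W hs)) \<Longrightarrow> x \<in> J w\<rbrakk> \<Longrightarrow>
    u \<in> carrier R \<and> monomial l hs \<in> J (sum_list hs * W + lex_total hs) \<and>
    u \<ominus> monomial l hs \<in> J (Suc (sum_list hs * W + lex_total hs))"
proof (induction rule: lead.induct)
  case nil
  then show ?case using filtrationD(2)[OF J] idealD(2)[OF filtrationD(1)[OF J], of 1] by (simp add: minus_eq r_neg)
next
  case (cons l hs u c x h)
  note D = filtrationD[OF J] and I = idealD[OF filtrationD(1)[OF J]]
  have u: "u \<in> carrier R" and mu: "monomial l hs \<in> J (sum_list hs * W + lex_total hs)"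
    and d: "u \<ominus> monomial l hs \<in> J (Suc (sum_list hs * W + lex_total hs))" using cons by auto
  have x: "x \<in> J (W + Suc (lex_total hs))" using cons.prems by simp
  have xh: "x [^] h \<in> J (h * (W + Suc (lex_total hs)))" using filtration_pow[OF J x] .
  let ?v = "sum_list (h # hs) * W + lex_total (h # hs)"
  have v: "?v = h * (W + Suc (lex_total hs)) + (sum_list hs * W + lex_total hs)" by (simp add: algebra_simps)
  have "x [^] h \<otimes> monomial l hs \<in> J ?v" unfolding v using D(4)[OF xh mu] .
  moreover have e1: "x [^] h \<otimes> (u \<ominus> monomial l hs) \<in> J (Suc ?v)" unfolding v using D(4)[OF xh d] by simp
  have xc: "x \<in> carrier R" "x [^] h \<in> carrier R" "monomial l hs \<in> carrier R" using I(1) x xh mu by blast+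
  have "c \<in> carrier R \<and> x [^] h \<otimes> (x \<otimes> c) \<in> J (Suc ?v)"
  proof (cases "sum_list hs = 0")
    case True
    then show ?thesis using cons.hyps xc I(2) by auto
  next
    case False
    have c: "c \<in> J ((sum_list hs - 1) * W)" using cons.hyps(2) q unfolding if_not_P[OF False] by blast
    have "x [^] h \<otimes> (x \<otimes> c) \<in> J (h * (W + Suc (lex_total hs)) + ((W + Suc (lex_total hs)) + (sum_list hs - 1) * W))"
      using D(4)[OF xh D(4)[OF x c]] .
    moreover have "h * (W + Suc (lex_total hs)) + ((W + Suc (lex_total hs)) + (sum_list hs - 1) * W) = Suc ?v"
      unfolding v using False by (cases "sum_list hs") (simp_all add: algebra_simps)
    ultimately have "x [^] h \<otimes> (x \<otimes> c) \<in> J (Suc ?v)" by (simp only:)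
    then show ?thesis using I(1)[OF c] by blast
  qed
  then have cc: "c \<in> carrier R" and e2: "x [^] h \<otimes> (x \<otimes> c) \<in> J (Suc ?v)" by auto
  have "x [^] h \<otimes> (u \<oplus> x \<otimes> c) \<ominus> x [^] h \<otimes> monomial l hs =
      x [^] h \<otimes> (u \<ominus> monomial l hs) \<oplus> x [^] h \<otimes> (x \<otimes> c)" using xc u cc by algebra
  then have "x [^] h \<otimes> (u \<oplus> x \<otimes> c) \<ominus> x [^] h \<otimes> monomial l hs \<in> J (Suc ?v)" using I(3)[OF e1 e2] by simp
  ultimately show ?case using xc u cc by simp
qed

text \<open>A relation between values and weights rather than a function, because different
  monomials may have the same value in the ring.\<close>

fun Mon :: "('a \<times> nat) list \<Rightarrow> ('a \<times> nat) set" where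
  "Mon [] = {(\<one>, 0)}"
| "Mon ((x, w) # l) = {(x [^] (g::nat) \<otimes> c, w * g + u) | g c u. (c, u) \<in> Mon l}"

lemma Mon_closed: "\<lbrakk>fst ` set l \<subseteq> carrier R; (c, u) \<in> Mon l\<rbrakk> \<Longrightarrow> c \<in> carrier R"
proof (induction l arbitrary: c u)
  case (Cons a l)
  obtain x w where a: "a = (x, w)" by (cases a)
  obtain g c' u' where "c = x [^] (g::nat) \<otimes> c'" "(c', u') \<in> Mon l" using Cons.prems unfolding a by auto
  then show ?case using Cons.IH[of c' u'] Cons.prems(1) a by auto
qed simp

lemma Mon_one: "(\<one>, 0) \<in> Mon l"
proof (induction l)
  case (Cons a l)
  obtain x w where a: "a = (x, w)" by (cases a)
  have "(x [^] (0::nat) \<otimes> \<one>, w * 0 + 0) \<in> Mon (a # l)" unfolding a Mon.simps using Cons by blast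
  then show ?case by simp
qed simp

lemma Mon_mult:
  "\<lbrakk>fst ` set l \<subseteq> carrier R; (c, u) \<in> Mon l; (c', u') \<in> Mon l\<rbrakk> \<Longrightarrow> (c \<otimes> c', u + u') \<in> Mon l"
proof (induction l arbitrary: c u c' u')
  case (Cons a l)
  obtain x w where a: "a = (x, w)" by (cases a)
  have x: "x \<in> carrier R" using Cons.prems(1) a by simp
  obtain g d v where 1: "c = x [^] (g::nat) \<otimes> d" "u = w * g + v" "(d, v) \<in> Mon l" using Cons.prems unfolding a by auto
  obtain g' d' v' where 2: "c' = x [^] (g'::nat) \<otimes> d'" "u' = w * g' + v'" "(d', v') \<in> Mon l" using Cons.prems unfolding a by auto
  have dc: "d \<in> carrier R" "d' \<in> carrier R" using Mon_closed[of l] 1 2 Cons.prems(1) by auto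
  have "c \<otimes> c' = (x [^] g \<otimes> x [^] g') \<otimes> (d \<otimes> d')" unfolding 1 2 using x dc by (simp add: m_ac)
  then have "c \<otimes> c' = x [^] (g + g') \<otimes> (d \<otimes> d')" using x by (simp add: nat_pow_mult)
  moreover have "u + u' = w * (g + g') + (v + v')" unfolding 1 2 by (simp add: algebra_simps)
  moreover have "(d \<otimes> d', v + v') \<in> Mon l" using Cons.IH[OF _ 1(3) 2(3)] Cons.prems(1) by simp
  ultimately show ?case unfolding a Mon.simps by blast
qed simp

lemma Mon_generator: "\<lbrakk>fst ` set l \<subseteq> carrier R; (x, w) \<in> set l\<rbrakk> \<Longrightarrow> (x, w) \<in> Mon l"
proof (induction l)
  case (Cons a l)
  obtain y v where a: "a = (y, v)" by (cases a)
  have y: "y \<in> carrier R" and x: "x \<in> carrier R"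
    using Cons.prems a by force+
  show ?case
  proof (cases "a = (x, w)")
    case True
    have "(x [^] (1::nat) \<otimes> \<one>, w * 1 + 0) \<in> Mon (a # l)" unfolding True Mon.simps using Mon_one by blast
    then show ?thesis using x by simp
  next
    case False
    then have "(x, w) \<in> Mon l"
      using Cons.IH Cons.prems by auto
    then have "(y [^] (0::nat) \<otimes> x, v * 0 + w) \<in> Mon (a # l)" unfolding a Mon.simps by blast
    then show ?thesis using x by simp
  qed
qed simp

lemma Mon_monomial:
  "length l = length hs \<Longrightarrow> (monomial l hs, sum_list hs * W + lex_total hs) \<in> Mon (zip l (weights W hs))"
proof (induction l hs rule: list_induct2)
  case (Cons x l h hs)
  have "sum_list (h # hs) * W + lex_total (h # hs) = (W + Suc (lex_total hs)) * h + (sum_list hs * W + lex_total hs)"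
    by (simp add: algebra_simps)
  then show ?case
    unfolding weights.simps zip_Cons_Cons Mon.simps monomial.simps using Cons.IH by blast
qed simp

lemma congruent_mult:
  assumes p: "ideal p R" and c: "r \<in> carrier R" "s \<in> carrier R" "r' \<in> carrier R" "s' \<in> carrier R"
    and "r \<ominus> s \<in> p" "r' \<ominus> s' \<in> p"
  shows "r \<otimes> r' \<ominus> s \<otimes> s' \<in> p"
proof -
  have "r \<otimes> r' \<ominus> s \<otimes> s' = r \<otimes> (r' \<ominus> s') \<oplus> (r \<ominus> s) \<otimes> s'" using c by algebra
  then show ?thesis using idealD(3,6,7)[OF p] assms by simp
qed

lemma congruent_pow:
  assumes p: "ideal p R" and c: "r \<in> carrier R" "s \<in> carrier R" and "r \<ominus> s \<in> p"
  shows "r [^] (n::nat) \<ominus> s [^] n \<in> p"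
proof (induction n)
  case 0
  then show ?case using idealD(2)[OF p] by (simp add: minus_eq r_neg)
next
  case (Suc n)
  then show ?case using congruent_mult[OF p _ _ c Suc assms(4)] c by simp
qed

text \<open>Modulo \<open>p\<close> each \<open>x\<close> behaves like the power
  \<open>w / e\<close> of \<open>z\<close>. As these exponents are fractional, a monomial of weight
  \<open>u\<close> is compared with \<open>z\<close> in two ways: its \<open>e\<close>-th power is a
  power of \<open>z\<close>, and it is itself a multiple of \<open>z [^] B\<close>, where
  \<open>B\<close> falls short of \<open>u / e\<close> by at most the sum of the weights.\<close>

lemma Mon_congruent:
  assumes p: "ideal p R" and z: "z \<in> carrier R" and e: "e > 0"
  shows "\<lbrakk>\<And>x w. (x, w) \<in> set l \<Longrightarrow> x \<in> carrier R \<and> x [^] e \<ominus> z [^] w \<in> p; (c, u) \<in> Mon l\<rbrakk> \<Longrightarrow>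
    c [^] e \<ominus> z [^] u \<in> p \<and>
    (\<exists>B. \<exists>r\<in>carrier R. c \<ominus> r \<otimes> z [^] B \<in> p \<and> u \<le> e * B + e * sum_list (map snd l))"
proof (induction l arbitrary: c u)
  case Nil
  have "\<one> \<ominus> \<one> \<otimes> z [^] (0::nat) \<in> p" using idealD(2)[OF p] by (simp add: minus_eq r_neg)
  then have "\<exists>B. \<exists>r\<in>carrier R. \<one> \<ominus> r \<otimes> z [^] B \<in> p \<and> 0 \<le> e * B + e * sum_list (map snd ([] :: ('a \<times> nat) list))"
    by blast
  then show ?case using Nil idealD(2)[OF p] by (simp add: minus_eq r_neg)
next
  case (Cons a l)
  obtain x w where a: "a = (x, w)" by (cases a)
  have x: "x \<in> carrier R" "x [^] e \<ominus> z [^] w \<in> p" using Cons.prems(1) a by auto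
  obtain g d v where c: "c = x [^] (g::nat) \<otimes> d" "u = w * g + v" "(d, v) \<in> Mon l" using Cons.prems unfolding a by auto
  have "fst ` set l \<subseteq> carrier R" using Cons.prems(1) by force
  then have d: "d \<in> carrier R" using Mon_closed[OF _ c(3)] by blast
  have IH: "d [^] e \<ominus> z [^] v \<in> p" "\<exists>B. \<exists>r\<in>carrier R. d \<ominus> r \<otimes> z [^] B \<in> p \<and> v \<le> e * B + e * sum_list (map snd l)"
    using Cons.IH[OF _ c(3)] Cons.prems(1) by auto
  have "(x [^] e) [^] g \<ominus> (z [^] w) [^] g \<in> p" using congruent_pow[OF p _ _ x(2)] x(1) z by simp
  then have "(x [^] g) [^] e \<ominus> z [^] (w * g) \<in> p" using x(1) z by (simp add: nat_pow_pow Groups.mult.commute)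
  then have "(x [^] g) [^] e \<otimes> d [^] e \<ominus> z [^] (w * g) \<otimes> z [^] v \<in> p"
    using congruent_mult[OF p _ _ _ _ _ IH(1)] x(1) z d by simp
  moreover have "(x [^] g) [^] e \<otimes> d [^] e = c [^] e" unfolding c(1) using x(1) d by (simp add: nat_pow_distrib)
  ultimately have ce: "c [^] e \<ominus> z [^] u \<in> p" unfolding c(2) using z by (simp add: nat_pow_mult)
  obtain B r where B: "r \<in> carrier R" "d \<ominus> r \<otimes> z [^] B \<in> p" "v \<le> e * B + e * sum_list (map snd l)"
    using IH(2) by blast
  \<comment> \<open>Only the multiple of \<open>e\<close> in the exponent is turned into a power of
    \<open>z\<close>; the remainder is below \<open>e\<close> and costs weight less than
    \<open>w * e\<close> if \<open>w\<close> is positive, and none otherwise.\<close>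
  let ?k = "g div e" and ?j = "g mod e"
  have "(x [^] e) [^] ?k \<ominus> (z [^] w) [^] ?k \<in> p" using congruent_pow[OF p _ _ x(2)] x(1) z by simp
  then have 1: "x [^] (e * ?k) \<ominus> z [^] (w * ?k) \<in> p" using x(1) z by (simp add: nat_pow_pow)
  have "x [^] (e * ?k) \<otimes> x [^] ?j \<ominus> z [^] (w * ?k) \<otimes> x [^] ?j \<in> p"
    using congruent_mult[OF p _ _ _ _ 1, of "x [^] ?j" "x [^] ?j"] x(1) z idealD(2)[OF p] by (simp add: minus_eq r_neg)
  then have 2: "x [^] g \<ominus> z [^] (w * ?k) \<otimes> x [^] ?j \<in> p" using x(1) by (simp add: nat_pow_mult)
  have "c \<ominus> (z [^] (w * ?k) \<otimes> x [^] ?j) \<otimes> (r \<otimes> z [^] B) \<in> p"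
    unfolding c(1) using congruent_mult[OF p _ _ d _ 2 B(2)] x(1) z B(1) by simp
  moreover have "(z [^] (w * ?k) \<otimes> x [^] ?j) \<otimes> (r \<otimes> z [^] B) = (x [^] ?j \<otimes> r) \<otimes> (z [^] (w * ?k) \<otimes> z [^] B)"
    using x(1) z B(1) by (simp add: m_ac)
  ultimately have "c \<ominus> (x [^] ?j \<otimes> r) \<otimes> z [^] (w * ?k + B) \<in> p" using z by (simp add: nat_pow_mult)
  moreover have "u \<le> e * (w * ?k + B) + e * sum_list (map snd (a # l))"
  proof -
    have "g \<le> e * ?k + e" using e mod_less_divisor[OF e, of g] mult_div_mod_eq[of e g] by linarith
    then have "w * g \<le> w * (e * ?k + e)" by (rule mult_le_mono2)
    then show ?thesis unfolding c(2) a using B(3) by (simp add: algebra_simps)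
  qed
  ultimately show ?case using ce x(1) B(1) by blast
qed

definition weight_ideal :: "'a set \<Rightarrow> ('a \<times> nat) list \<Rightarrow> nat \<Rightarrow> 'a set" where
  "weight_ideal a l v = Idl (a \<union> {c. \<exists>u\<ge>v. (c, u) \<in> Mon l})"

lemma weight_ideal:
  assumes a: "ideal a R" and l: "fst ` set l \<subseteq> carrier R"
  shows "filtration (weight_ideal a l)" "a \<subseteq> weight_ideal a l v" "(c, u) \<in> Mon l \<Longrightarrow> v \<le> u \<Longrightarrow> c \<in> weight_ideal a l v"
    "\<lbrakk>ideal K R; a \<subseteq> K; \<And>c u. (c, u) \<in> Mon l \<Longrightarrow> v \<le> u \<Longrightarrow> c \<in> K\<rbrakk> \<Longrightarrow> weight_ideal a l v \<subseteq> K"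
proof -
  define J where "J = weight_ideal a l"
  have gc: "a \<union> {c. \<exists>u\<ge>v. (c, u) \<in> Mon l} \<subseteq> carrier R" for v
    using idealD(1)[OF a] Mon_closed[OF l] by blast
  have id: "ideal (J v) R" for v unfolding J_def weight_ideal_def using genideal_ideal[OF gc] .
  have up: "a \<union> {c. \<exists>u\<ge>v. (c, u) \<in> Mon l} \<subseteq> J v" for v unfolding J_def weight_ideal_def using genideal_self[OF gc] .
  have least: "J v \<subseteq> K" if "ideal K R" "a \<subseteq> K" "\<And>c u. (c, u) \<in> Mon l \<Longrightarrow> v \<le> u \<Longrightarrow> c \<in> K" for K v
    unfolding J_def weight_ideal_def using that by (intro genideal_minimal) auto
  show "a \<subseteq> weight_ideal a l v" "(c, u) \<in> Mon l \<Longrightarrow> v \<le> u \<Longrightarrow> c \<in> weight_ideal a l v"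
    "\<lbrakk>ideal K R; a \<subseteq> K; \<And>c u. (c, u) \<in> Mon l \<Longrightarrow> v \<le> u \<Longrightarrow> c \<in> K\<rbrakk> \<Longrightarrow> weight_ideal a l v \<subseteq> K"
    using up[of v] least[of K v] unfolding J_def by blast+
  have homog: "J v \<subseteq> J u" if "u \<le> v" for u v
    using up[of u] that le_trans by (intro least[OF id]) blast+
  have "\<one> \<in> J 0" using up[of 0] Mon_one by blast
  then have J0: "J 0 = carrier R" using ideal.one_imp_carrier[OF id] by blast
  have mult: "b \<otimes> c \<in> J (u + v)" if b: "b \<in> J u" and c: "c \<in> J v" for b c u v
  proof -
    \<comment> \<open>Products are checked on the generators of one factor at a time, by means of
      colon ideals of \<open>J (u + v)\<close>.\<close>
    have col: "ideal (colon (J (u + v)) x) R" if "x \<in> carrier R" for x using ideal_colon[OF id that] .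
    have step1: "d \<in> colon (J (u + v)) x" if x: "(x, v') \<in> Mon l" "v \<le> v'" and d: "d \<in> J u" for d x v'
    proof -
      have xc: "x \<in> carrier R" using Mon_closed[OF l x(1)] .
      have "J u \<subseteq> colon (J (u + v)) x"
      proof (rule least[OF col[OF xc]])
        show "a \<subseteq> colon (J (u + v)) x"
          using idealD(1,7)[OF a] up[of "u + v"] xc by (auto simp: colon_def)
        show "c \<in> colon (J (u + v)) x" if "(c, u') \<in> Mon l" "u \<le> u'" for c u'
        proof -
          have "u + v \<le> u' + v'" using x(2) that(2) by simp
          then have "c \<otimes> x \<in> J (u + v)" using Mon_mult[OF l that(1) x(1)] up[of "u + v"] by blast
          then show ?thesis using Mon_closed[OF l that(1)] by (simp add: colon_def)
        qed
      qed
      then show ?thesis using d by blast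
    qed
    have bc: "b \<in> carrier R" using idealD(1)[OF id b] .
    have "J v \<subseteq> colon (J (u + v)) b"
    proof (rule least[OF col[OF bc]])
      show "a \<subseteq> colon (J (u + v)) b"
        using idealD(1,7)[OF a] up[of "u + v"] bc by (auto simp: colon_def)
      show "x \<in> colon (J (u + v)) b" if "(x, v') \<in> Mon l" "v \<le> v'" for x v'
        using step1[OF that b] Mon_closed[OF l that(1)] m_comm[OF bc] by (simp add: colon_def)
    qed
    then have "c \<otimes> b \<in> J (u + v)" using c by (auto simp: colon_def)
    then show ?thesis using m_comm[OF bc idealD(1)[OF id c]] by simp
  qed
  show "filtration (weight_ideal a l)"
    using id J0 homog mult unfolding filtration_def J_def by blast
qed

end

context acc_cring
begin

text \<open>Analytic independence of parameters: modulo the prime \<open>p\<close> every parameter behaves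
  like a fixed power of the last one \<open>z\<close>, with the given weight as exponent, so an element of weight
  \<open>v\<close> cannot have weight \<open>v + 1\<close>.\<close>

lemma parameters_independent:
  assumes m: "primeideal m R" and loc: "\<And>p. primeideal p R \<Longrightarrow> p \<subseteq> m"
    and a: "ideal a R" "\<And>p. primeideal p R \<Longrightarrow> a \<subseteq> p"
    and xs: "set xs \<subseteq> m" and n: "n \<subseteq> m"
    and gen: "\<And>J. \<lbrakk>ideal J R; a \<subseteq> J; set xs \<subseteq> J\<rbrakk> \<Longrightarrow> n \<subseteq> J"
    and rad: "\<And>b. b \<in> m \<Longrightarrow> \<exists>e::nat. b [^] e \<in> n"
    and chain: "chain_to R {} (length xs) m" and len: "length hs = length xs"
  shows "\<exists>W J. filtration J \<and> (\<forall>v. a \<subseteq> J v) \<and> n \<subseteq> J W \<and>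
    (\<forall>q u. (\<forall>k. q k \<subseteq> J (k * W)) \<longrightarrow> lead q xs hs u \<longrightarrow> u \<notin> J (Suc (sum_list hs) * W))"
proof (cases "xs = []")
  case True
  have im: "ideal m R" using m primeideal.axioms(1) by blast
  \<comment> \<open>Without parameters the only form is \<open>\<one>\<close>, and the filtration
    with the single proper step \<open>m\<close> already excludes it.\<close>
  define J where "J v = (if v = 0 then carrier R else m)" for v :: nat
  have "filtration J"
    unfolding filtration_def J_def using im oneideal idealD[OF im] by auto
  moreover have "\<one> \<notin> m" using ideal.one_imp_carrier[OF im] primeideal.I_notcarr[OF m] by blast
  then have "u \<notin> J (Suc (sum_list hs) * 1)" if "lead q xs hs u" for q u
    using that True len by (auto simp: J_def elim: lead.cases)
  moreover have "\<forall>v. a \<subseteq> J v" "n \<subseteq> J 1" using a(2)[OF m] idealD(1)[OF a(1)] n by (auto simp: J_def)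
  ultimately show ?thesis by blast
next
  case False
  have im: "ideal m R" using m primeideal.axioms(1) by blast
  have mc: "x \<in> carrier R" if "x \<in> m" for x using idealD(1)[OF im that] .
  \<comment> \<open>This choice makes \<open>Suc (sum_list hs) * W\<close> exactly one more than the
    weight of the monomial with exponents \<open>hs\<close>.\<close>
  define W where "W = Suc (lex_total hs)"
  define ws where "ws = weights W hs"
  define l where "l = zip xs ws"
  define z where "z = last xs"
  define e where "e = last ws"
  have lw: "length ws = length xs" by (simp add: ws_def len)
  have wsne: "ws \<noteq> []" using False lw by auto
  have z: "z \<in> m" using xs False by (auto simp: z_def)
  have zc: "z \<in> carrier R" using mc z .
  have wW: "W \<le> w" "0 < w" if "w \<in> set ws" for w using weights_bounds[of w W hs] that by (auto simp: ws_def)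
  have e: "0 < e" using wW(2) wsne by (simp add: e_def)
  have lc: "x \<in> carrier R" "x \<in> m" "w \<in> set ws" if "(x, w) \<in> set l" for x w
    using that xs mc by (auto simp: l_def dest: set_zip_leftD set_zip_rightD)
  have lcf: "fst ` set l \<subseteq> carrier R" using lc(1) by auto
  \<comment> \<open>The last pair is left out, as it would give
    \<open>z [^] e \<ominus> z [^] e\<close>. So there is one element fewer than there are
    parameters, and the height theorem leaves room for a prime strictly below
    \<open>m\<close>.\<close>
  define ys where "ys = map (\<lambda>(x, w). x [^] e \<ominus> z [^] w) (butlast l)"
  have powm: "x [^] (k::nat) \<in> m" if "x \<in> m" "0 < k" for x k
  proof (cases k)
    case (Suc k')
    then show ?thesis using idealD(6)[OF im that(1)] mc[OF that(1)] by simp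
  qed (use that in simp)
  have lne: "l \<noteq> []" using False wsne by (simp add: l_def)
  have lastl: "last l = (z, e)"
    unfolding l_def z_def e_def using lw wsne False by (simp add: last_conv_nth)
  have "set ys \<subseteq> m"
  proof
    fix y assume "y \<in> set ys"
    then obtain x w where xw: "(x, w) \<in> set l" "y = x [^] e \<ominus> z [^] w"
      by (auto simp: ys_def dest: in_set_butlastD)
    then show "y \<in> m" using idealD(5)[OF im powm[OF lc(2)[OF xw(1)] e] powm[OF z wW(2)[OF lc(3)[OF xw(1)]]]] by simp
  qed
  moreover have "length xs = length ys + 1" using lw False by (cases xs) (auto simp: ys_def l_def)
  ultimately have "chain_to R ({} \<union> set ys) 1 m" using krull_height[of "{}" ys 1 m] chain by simp
  then obtain p where p: "primeideal p R" "p \<subset> m" "set ys \<subseteq> p" by auto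
  have ip: "ideal p R" using p(1) primeideal.axioms(1) by blast
  have cong: "x \<in> carrier R \<and> x [^] e \<ominus> z [^] w \<in> p" if xw: "(x, w) \<in> set l" for x w
  proof -
    have "set l = insert (z, e) (set (butlast l))" using append_butlast_last_id[OF lne] lastl
      by (metis Un_insert_right list.simps(15) set_append sup_bot_right empty_set)
    then consider "(x, w) = (z, e)" | "(x, w) \<in> set (butlast l)" using xw by blast
    then have "x [^] e \<ominus> z [^] w \<in> p"
    proof cases
      case 1
      then show ?thesis using zc idealD(2)[OF ip] by (simp add: minus_eq r_neg)
    next
      case 2
      then have "x [^] e \<ominus> z [^] w \<in> set ys" by (force simp: ys_def)
      then show ?thesis using p(3) by blast
    qed
    then show ?thesis using lc(1)[OF xw] by blast
  qed
  \<comment> \<open>If \<open>z\<close> were in \<open>p\<close>, so would be all parameters, then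
    \<open>n\<close>, and finally \<open>m\<close>.\<close>
  have zp: "z \<notin> p"
  proof
    assume zp: "z \<in> p"
    have "set xs \<subseteq> p"
    proof
      fix x assume "x \<in> set xs"
      then obtain w where xw: "(x, w) \<in> set l" using lw by (metis l_def in_set_impl_in_set_zip1)
      obtain k where k: "w = Suc k" using wW(2)[OF lc(3)[OF xw]] by (cases w) auto
      have "z [^] w \<in> p" unfolding k using idealD(6)[OF ip zp] zc by simp
      then have "x [^] e \<ominus> z [^] w \<oplus> z [^] w \<in> p" using cong[OF xw] idealD(3)[OF ip] by blast
      moreover have "x [^] e \<ominus> z [^] w \<oplus> z [^] w = x [^] e" using lc(1)[OF xw] zc by (simp add: minus_eq a_assoc l_neg)
      ultimately show "x \<in> p" using primeideal.prime_power[OF p(1) lc(1)[OF xw], of e] by simp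
    qed
    then have "n \<subseteq> p" using gen[OF ip a(2)[OF p(1)]] by blast
    then have "m \<subseteq> p" using rad primeideal.prime_power[OF p(1) mc] by blast
    then show False using p(2) by blast
  qed
  define J where "J = weight_ideal a l"
  note wi = weight_ideal[OF a(1) lcf, folded J_def]
  have J: "filtration J" using wi(1) by blast
  have genJ: "x \<in> J w" if "(x, w) \<in> set l" for x w
    using wi(3)[OF Mon_generator[OF lcf that]] by simp
  have "set xs \<subseteq> J W"
  proof
    fix x assume "x \<in> set xs"
    then obtain w where xw: "(x, w) \<in> set l" using lw by (metis l_def in_set_impl_in_set_zip1)
    show "x \<in> J W" using filtrationD(3)[OF J wW(1)[OF lc(3)[OF xw]] genJ[OF xw]] .
  qed
  then have nJ: "n \<subseteq> J W" using gen[OF filtrationD(1)[OF J] wi(2)] by blast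
  have main: "u \<notin> J (Suc (sum_list hs) * W)" if q: "\<And>k. q k \<subseteq> J (k * W)" and u: "lead q xs hs u" for q u
  proof
    assume uJ: "u \<in> J (Suc (sum_list hs) * W)"
    define v where "v = sum_list hs * W + lex_total hs"
    have Sv: "Suc (sum_list hs) * W = Suc v" by (simp add: v_def W_def)
    define c where "c = monomial xs hs"
    have ap: "u \<in> carrier R" "c \<in> J v" "u \<ominus> c \<in> J (Suc v)"
      using lead_approx[OF J q u] genJ unfolding l_def ws_def v_def c_def by auto
    have cc: "c \<in> carrier R" using idealD(1)[OF filtrationD(1)[OF J] ap(2)] .
    have "u \<ominus> (u \<ominus> c) \<in> J (Suc v)" using idealD(5)[OF filtrationD(1)[OF J]] uJ ap(3) Sv by simp
    moreover have "u \<ominus> (u \<ominus> c) = c" using ap(1) cc by algebra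
    ultimately have cJ: "c \<in> J (Suc v)" by simp
    have cM: "(c, v) \<in> Mon l" unfolding c_def v_def l_def ws_def using Mon_monomial len by simp
    \<comment> \<open>\<open>j\<close> is chosen to beat the loss \<open>\<Sigma>\<close> in
      \<open>Mon_congruent\<close>: modulo \<open>p\<close> a monomial of weight at least
      \<open>e * j * Suc v\<close> is a multiple of \<open>z [^] B\<close> with
      \<open>B \<ge> j * Suc v - \<Sigma> = v * j + 1 = H\<close>. On the other hand
      \<open>c [^] (e * j)\<close> is congruent to \<open>z [^] (v * j)\<close>.\<close>
    define \<Sigma> where "\<Sigma> = sum_list (map snd l)"
    define j where "j = \<Sigma> + 1"
    define H where "H = v * j + 1"
    have "(c [^] e) [^] j \<ominus> (z [^] v) [^] j \<in> p"
      using congruent_pow[OF ip, of "c [^] e" "z [^] v" j] Mon_congruent[OF ip zc e cong cM] cc zc by simp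
    then have c1: "c [^] (e * j) \<ominus> z [^] (v * j) \<in> p" using cc zc by (simp add: nat_pow_pow)
    have zH: "z [^] H \<in> carrier R" using zc by simp
    have "J (e * j * Suc v) \<subseteq> p <+>\<^bsub>R\<^esub> PIdl (z [^] H)"
    proof (rule wi(4))
      show "ideal (p <+>\<^bsub>R\<^esub> PIdl (z [^] H)) R" using ideal_adj[OF ip zH] .
      show "a \<subseteq> p <+>\<^bsub>R\<^esub> PIdl (z [^] H)" using a(2)[OF p(1)] ideal_sum_upper(1)[OF ip cgenideal_ideal[OF zH]] by blast
      fix d u assume d: "(d, u) \<in> Mon l" "e * j * Suc v \<le> u"
      have dc: "d \<in> carrier R" using Mon_closed[OF lcf d(1)] .
      obtain B r where B: "r \<in> carrier R" "d \<ominus> r \<otimes> z [^] B \<in> p" "u \<le> e * B + e * \<Sigma>"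
        using Mon_congruent[OF ip zc e cong d(1)] unfolding \<Sigma>_def by blast
      have "e * (j * Suc v) \<le> e * (B + \<Sigma>)" using d(2) B(3) by (simp add: algebra_simps)
      then have "j * Suc v \<le> B + \<Sigma>" using e by simp
      then have "H \<le> B" by (simp add: H_def j_def Groups.mult.commute)
      then have "z [^] B = z [^] (B - H) \<otimes> z [^] H" using zc by (simp add: nat_pow_mult)
      then have "r \<otimes> z [^] B = (r \<otimes> z [^] (B - H)) \<otimes> z [^] H" using B(1) zc by (simp add: m_assoc)
      moreover have "r \<otimes> z [^] (B - H) \<in> carrier R" using B(1) zc by simp
      ultimately have "r \<otimes> z [^] B \<in> PIdl (z [^] H)" using mem_PIdl by blast
      moreover have "d = (d \<ominus> r \<otimes> z [^] B) \<oplus> r \<otimes> z [^] B" using dc B(1) zc by (simp add: minus_eq a_assoc l_neg)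
      ultimately show "d \<in> p <+>\<^bsub>R\<^esub> PIdl (z [^] H)" using B(2) mem_add by metis
    qed
    then have "c [^] (e * j) \<in> p <+>\<^bsub>R\<^esub> PIdl (z [^] H)" using filtration_pow[OF J cJ, of "e * j"] by blast
    then obtain s t where "s \<in> p" "t \<in> PIdl (z [^] H)" "c [^] (e * j) = s \<oplus> t" using mem_add by metis
    then obtain r where r: "s \<in> p" "r \<in> carrier R" "c [^] (e * j) = s \<oplus> r \<otimes> z [^] H" using mem_PIdl by metis
    have sc: "s \<in> carrier R" using idealD(1)[OF ip r(1)] .
    have zv: "z [^] (v * j) \<in> carrier R" using zc by simp
    \<comment> \<open>Since \<open>z\<close> is outside the prime \<open>p\<close>, the factor
      \<open>\<one> \<ominus> r \<otimes> z\<close> would be in \<open>p\<close> and so in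
      \<open>m\<close>, which contains \<open>z\<close>; then \<open>m\<close> would contain
      \<open>\<one>\<close>.\<close>
    have "z [^] (v * j) \<otimes> (\<one> \<ominus> r \<otimes> z) = s \<ominus> (c [^] (e * j) \<ominus> z [^] (v * j))"
    proof -
      have "z [^] H = z [^] (v * j) \<otimes> z" by (simp add: H_def)
      then show ?thesis unfolding r(3) using sc r(2) zc zv by algebra
    qed
    then have "z [^] (v * j) \<otimes> (\<one> \<ominus> r \<otimes> z) \<in> p" using idealD(5)[OF ip r(1) c1] by simp
    then have "z [^] (v * j) \<in> p \<or> \<one> \<ominus> r \<otimes> z \<in> p"
      using primeideal.I_prime[OF p(1) zv, of "\<one> \<ominus> r \<otimes> z"] r(2) zc by simp
    then have "\<one> \<ominus> r \<otimes> z \<in> m" using primeideal.prime_power[OF p(1) zc] zp p(2) by blast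
    then have "\<one> \<ominus> r \<otimes> z \<oplus> r \<otimes> z \<in> m" using idealD(3)[OF im] idealD(6)[OF im z r(2)] by blast
    moreover have "\<one> \<ominus> r \<otimes> z \<oplus> r \<otimes> z = \<one>" using r(2) zc by algebra
    ultimately have "\<one> \<in> m" by simp
    then show False using ideal.one_imp_carrier[OF im] primeideal.I_notcarr[OF m] by blast
  qed
  show ?thesis using J wi(2) nJ main by blast
qed

end

section \<open>The Krull super-dimension of the bigraded ring\<close>

lemma chain_to_mono: "\<lbrakk>chain_to A J n P; I \<subseteq> J\<rbrakk> \<Longrightarrow> chain_to A I n P"
  by (induction n arbitrary: P) auto

context local_super_ring_ideal
begin

text \<open>Elements of \<open>n^k R\<close> need not be even, while the filtration lives on
  \<open>A\<close>; what it controls is their even component.\<close>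

lemma Bi_filtration:
  assumes J: "A.filtration J" and W: "N \<inter> Ev \<subseteq> J W"
  shows "x \<in> Bi k 0 \<Longrightarrow> \<exists>a\<in>J (k * W). \<exists>b\<in>Od. x = a \<oplus> b"
proof (induction k arbitrary: x)
  case 0
  obtain a b where "a \<in> Ev" "b \<in> Od" "x = a \<oplus> b" using decompose[OF Bi_closed(1)[OF 0]] .
  then show ?case using A.filtrationD(2)[OF J] by (auto simp: even_ring_simps)
next
  case (Suc k)
  note IH = Suc.IH
  note I = A.idealD[OF A.filtrationD(1)[OF J], unfolded even_ring_simps]
  show ?case
    using Suc.prems unfolding Bi_Suc[of k 0]
  proof induction
    case (prod i j)
    obtain a b where ab: "a \<in> J (k * W)" "b \<in> Od" "j = a \<oplus> b" using IH[OF prod(2)] by blast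
    have "i \<otimes> j = i \<otimes> a \<oplus> i \<otimes> b" unfolding ab(3) using ab prod part_closed I(1)[OF ab(1)] by (simp add: r_distr)
    moreover have "i \<otimes> a \<in> J (Suc k * W)"
      using A.filtrationD(4)[OF J _ ab(1), of i W] prod(1) W by (auto simp: even_ring_simps)
    ultimately show ?case using even_odd[OF _ ab(2), of i] prod(1) by blast
  next
    case (sum s t)
    obtain a b where 1: "a \<in> J (Suc k * W)" "b \<in> Od" "s = a \<oplus> b" using sum.IH(1) by blast
    obtain c d where 2: "c \<in> J (Suc k * W)" "d \<in> Od" "t = c \<oplus> d" using sum.IH(2) by blast
    have "a \<in> carrier R" "b \<in> carrier R" "c \<in> carrier R" "d \<in> carrier R"
      using 1 2 I(1) part_closed(1,2) by blast+
    then have "s \<oplus> t = (a \<oplus> c) \<oplus> (b \<oplus> d)" unfolding 1(3) 2(3) by (simp add: a_ac)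
    then show ?case using I(3)[OF 1(1) 2(1)] part_closed(6)[OF 1(2) 2(2)] by blast
  qed
qed

lemma q_filtration:
  assumes "A.filtration J" "N \<inter> Ev \<subseteq> J W" shows "q k \<subseteq> J (k * W)"
proof
  fix x assume x: "x \<in> q k"
  then obtain a b where ab: "a \<in> J (k * W)" "b \<in> Od" "x = a \<oplus> b" using Bi_filtration[OF assms] by blast
  have "a \<in> Ev" using A.idealD(1)[OF A.filtrationD(1)[OF assms(1)] ab(1)] by (simp add: even_ring_simps)
  then show "x \<in> J (k * W)" using even_component_unique[of x a b] ab x by auto
qed

text \<open>The even component of the summand in \<open>n^(t + 1) R\<close> is controlled by
  multiplicativity. The summand with a factor from the odd part of \<open>N\<close> has its even
  component in \<open>R_1^2\<close>, which every step of the filtration contains.\<close>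

lemma Nx_filtration:
  assumes J: "A.filtration J" and W: "N \<inter> Ev \<subseteq> J W" and osq: "\<And>v. odd_square_ideal R \<subseteq> J v"
    and u: "u \<in> Ev" "u \<in> Nx t 0"
  shows "u \<in> J (Suc t * W)"
proof -
  note I = A.idealD[OF A.filtrationD(1)[OF J], unfolded even_ring_simps]
  obtain x y where xy: "x \<in> Bi (Suc t) 0" "y \<in> Bi t (Suc 0)" "u = x \<oplus> y" using u(2) unfolding mem_Nx by blast
  obtain a b where 1: "a \<in> J (Suc t * W)" "b \<in> Od" "x = a \<oplus> b" using Bi_filtration[OF J W xy(1)] by blast
  obtain c d where 2: "c \<in> odd_square_ideal R" "d \<in> Od" "y = c \<oplus> d" using Bi_odd_decompose[OF xy(2)] by blast
  have ac: "a \<oplus> c \<in> J (Suc t * W)" using I(3)[OF 1(1)] osq 2(1) by blast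
  have "a \<in> carrier R" "b \<in> carrier R" "c \<in> carrier R" "d \<in> carrier R"
    using 1 2 I(1) osq part_closed(1,2) by blast+
  then have "u = (a \<oplus> c) \<oplus> (b \<oplus> d)" unfolding xy(3) 1(3) 2(3) by (simp add: a_ac)
  then show ?thesis using even_component_unique[OF u(1) I(1)[OF ac] part_closed(6)[OF 1(2) 2(2)]] ac by simp
qed

text \<open>Only bidegree \<open>(sum_list hs, 0)\<close> is followed: there the component of
  \<open>x^h (w' + x c)\<close> is determined by that of \<open>w'\<close> and by the component of
  \<open>c\<close> one degree lower, which is the recursion of \<open>lead\<close>. To see that an
  element is nonzero, one component is enough.\<close>

lemma boundary_monoid_lead:
  "\<lbrakk>set l \<subseteq> N \<inter> Ev; w \<in> SE.boundary_monoid (map (homog 1 0) l)\<rbrakk> \<Longrightarrow>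
    w \<in> even_part S \<and> (\<exists>hs u. length hs = length l \<and> A.lead q l hs u \<and> u \<in> q (sum_list hs) \<and>
      w (sum_list hs) 0 = Nx (sum_list hs) 0 +> u)"
proof (induction l arbitrary: w)
  case Nil
  then have w: "w = homog 0 0 \<one>" by (simp add: even_ring_simps one_S)
  have "w 0 0 = Nx 0 0 +> \<one>" by (simp add: w homog_def cls_def)
  moreover have "A.lead q [] [] \<one>" using A.lead.nil[of q] by (simp add: even_ring_simps)
  ultimately have "length ([] :: nat list) = length ([] :: 'a list) \<and> A.lead q [] [] \<one> \<and> \<one> \<in> q (sum_list []) \<and>
      w (sum_list []) 0 = Nx (sum_list []) 0 +> \<one>" using one_even one_in_Bi by simp
  then show ?case using homog_closed(2)[OF one_in_Bi one_even] w by blast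
next
  case (Cons x l)
  have x: "x \<in> N \<inter> Ev" and l: "set l \<subseteq> N \<inter> Ev" using Cons.prems by auto
  have xB: "x \<in> Bi (Suc 0) 0" using N0_mult[OF x one_in_Bi] x part_closed(1) by simp
  have xE: "x \<in> Ev" and xc: "x \<in> carrier R" using x part_closed by auto
  obtain h w' c where w: "w = homog 1 0 x [^]\<^bsub>even_ring S\<^esub> (h::nat) \<otimes>\<^bsub>S\<^esub> (w' \<oplus>\<^bsub>S\<^esub> homog 1 0 x \<otimes>\<^bsub>S\<^esub> c)"
    "w' \<in> SE.boundary_monoid (map (homog 1 0) l)" "c \<in> even_part S"
    using Cons.prems(2) by (auto simp: even_ring_simps)
  obtain hs u where IH: "w' \<in> even_part S" "length hs = length l" "A.lead q l hs u" "u \<in> q (sum_list hs)"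
    "w' (sum_list hs) 0 = Nx (sum_list hs) 0 +> u" using Cons.IH[OF l w(2)] by blast
  let ?t = "sum_list hs"
  obtain p' pc where p': "rep Ev p'" "w' = cls p'" and pc: "rep Ev pc" "c = cls pc"
    using IH(1) w(3) unfolding even_S by blast
  define xh where "xh = x [^]\<^bsub>A\<^esub> h"
  have pow: "xh \<in> Bi h 0" "homog 1 0 x [^]\<^bsub>even_ring S\<^esub> h = homog h 0 xh"
    using homog_pow[OF xE xB, of h] by (simp_all add: xh_def)
  have xhE: "xh \<in> Ev" using A.nat_pow_closed[of x h] xE by (simp add: even_ring_simps xh_def)
  have xhc: "xh \<in> carrier R" using part_closed(1)[OF xhE] .
  have r1: "rep Ev (\<lambda>i j. if i = 1 \<and> j = 0 then x else \<zero>)" using rep_single[of Ev x 1 0] part_closed xE xB by simp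
  have rh: "rep Ev (\<lambda>i j. if i = h \<and> j = 0 then xh else \<zero>)" using rep_single[of Ev xh h 0] part_closed xhE pow by simp
  define s where "s = conv (\<lambda>i j. if i = 1 \<and> j = 0 then x else \<zero>) pc"
  have rs: "rep Ev s" unfolding s_def using part_closed even_even by (intro rep_conv[OF r1 pc(1)]) auto
  define r where "r = (\<lambda>k l. p' k l \<oplus> s k l)"
  have rr: "rep Ev r" unfolding r_def using part_closed by (intro rep_add[OF p'(1) rs]) auto
  have "homog 1 0 x \<otimes>\<^bsub>S\<^esub> c = cls s" unfolding pc(2) homog_def s_def using cls_mult[OF r1 pc(1)] by simp
  then have wr: "w = cls (conv (\<lambda>i j. if i = h \<and> j = 0 then xh else \<zero>) r)"
    unfolding w(1) pow(2) p'(2) using cls_add[OF p'(1) rs] cls_mult[OF rh rr] by (simp add: r_def homog_def)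
  \<comment> \<open>In degree 0 the product with \<open>x\<close> contributes nothing, which matches
    the case distinction in \<open>lead\<close>.\<close>
  define c0 where "c0 = (if ?t = 0 then \<zero> else pc (?t - 1) 0)"
  have c0E: "c0 \<in> Ev" using rep_Bi(3)[OF pc(1)] part_closed(3) by (simp add: c0_def)
  have c0c: "c0 \<in> carrier R" using part_closed(1)[OF c0E] .
  have "s ?t 0 = (if 1 \<le> ?t then x \<otimes> pc (?t - 1) 0 else \<zero>)"
    unfolding s_def using conv_single[OF pc(1) xc, of 1 0 ?t 0] by simp
  then have st: "s ?t 0 = x \<otimes> c0" using xc by (cases "?t = 0") (auto simp: c0_def simp del: sum_list_eq_0_iff)
  define u' where "u' = xh \<otimes> (u \<oplus> x \<otimes> c0)"
  have uc: "u \<in> carrier R" "u \<in> Ev" "u \<in> Bi ?t 0" using IH(4) part_closed(1) by auto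
  have p'c: "p' ?t 0 \<in> carrier R" using rep_Bi(2)[OF p'(1)] .
  have wt: "w (h + ?t) 0 = Nx (h + ?t) 0 +> (xh \<otimes> (p' ?t 0 \<oplus> x \<otimes> c0))"
    unfolding wr cls_def using conv_single[OF rr xhc, of h 0 "h + ?t" 0] st by (simp add: r_def)
  have "p' ?t 0 \<ominus> u \<in> Nx ?t 0" using IH(5) Nx_coset_eq_iff[OF p'c uc(1)] unfolding p'(2) cls_def by simp
  then have "xh \<otimes> (p' ?t 0 \<ominus> u) \<in> Nx (h + ?t) 0" using Nx_mult_right[of _ ?t 0 xh h 0] pow(1) by simp
  moreover have "xh \<otimes> (p' ?t 0 \<oplus> x \<otimes> c0) \<ominus> u' = xh \<otimes> (p' ?t 0 \<ominus> u)"
  proof -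
    have y: "x \<otimes> c0 \<in> carrier R" using xc c0c by simp
    then have "(p' ?t 0 \<oplus> x \<otimes> c0) \<ominus> (u \<oplus> x \<otimes> c0) = p' ?t 0 \<ominus> u"
      using p'c uc(1) a_comm[of u "x \<otimes> c0"] by (simp add: minus_eq minus_add a_assoc r_neg2)
    moreover have "xh \<otimes> (p' ?t 0 \<oplus> x \<otimes> c0) \<ominus> u' = xh \<otimes> ((p' ?t 0 \<oplus> x \<otimes> c0) \<ominus> (u \<oplus> x \<otimes> c0))"
      unfolding u'_def using xhc p'c uc(1) y by (simp add: minus_eq r_distr r_minus)
    ultimately show ?thesis by simp
  qed
  ultimately have "w (h + ?t) 0 = Nx (h + ?t) 0 +> u'"
    unfolding wt using Nx_coset_eq_iff xhc p'c xc c0c uc by (simp add: u'_def)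
  moreover have "A.lead q (x # l) (h # hs) u'"
  proof -
    have "if ?t = 0 then c0 = \<zero>\<^bsub>A\<^esub> else c0 \<in> q (?t - 1)"
      using rep_Bi[OF pc(1), of "?t - 1" 0] by (auto simp: c0_def even_ring_simps)
    then have "A.lead q (x # l) (h # hs) (x [^]\<^bsub>A\<^esub> h \<otimes>\<^bsub>A\<^esub> (u \<oplus>\<^bsub>A\<^esub> x \<otimes>\<^bsub>A\<^esub> c0))" by (rule A.lead.cons[OF IH(3)])
    then show ?thesis by (simp add: u'_def xh_def even_ring_simps)
  qed
  moreover have "u' \<in> q (h + ?t)"
  proof -
    have "x \<otimes> c0 \<in> Bi ?t 0"
    proof (cases "?t = 0")
      case False
      then have "c0 \<in> Bi (?t - 1) 0" using rep_Bi(1)[OF pc(1)] by (simp add: c0_def del: sum_list_eq_0_iff)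
      moreover have "Suc (?t - 1) = ?t" using False by (simp del: sum_list_eq_0_iff)
      ultimately show ?thesis using N0_mult[OF x] by metis
    qed (use xc Bi_closed(2) in \<open>simp add: c0_def\<close>)
    then have "u \<oplus> x \<otimes> c0 \<in> Bi ?t 0" using Bi_closed(3) uc(3) by blast
    then have "u' \<in> Bi (h + ?t) (0 + 0)" unfolding u'_def by (rule Bi_mult[OF pow(1)])
    moreover have "u' \<in> Ev" unfolding u'_def using even_even part_closed(5) xhE uc(2) xE c0E by blast
    ultimately show ?thesis by simp
  qed
  moreover have "w \<in> even_part S"
    unfolding wr even_S using part_closed even_even by (intro imageI CollectI rep_conv[OF rh rr]) auto
  moreover have "length (h # hs) = length (x # l)" using IH(2) by simp
  ultimately show ?case by (metis sum_list.Cons)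
qed

text \<open>The chain condition supplies a maximal ideal above \<open>p\<close>, and
  \<open>m\<close> is the only one.\<close>

lemma prime_subset_m: assumes "primeideal p A" shows "p \<subseteq> m"
proof -
  have ip: "ideal p A" and ne: "carrier A \<noteq> p" using assms primeideal.axioms(1) primeideal.I_notcarr by blast+
  define Q where "Q J \<longleftrightarrow> p \<subseteq> J \<and> J \<noteq> carrier A" for J
  have "Q p" using ne by (auto simp: Q_def)
  then obtain J where J: "ideal J A" "Q J" and max: "\<And>K. \<lbrakk>ideal K A; J \<subset> K\<rbrakk> \<Longrightarrow> \<not> Q K"
    using A.ideal_maximal[OF ip, of Q] by blast
  have "maximalideal J A"
  proof (rule maximalidealI[OF J(1)])
    show "carrier A \<noteq> J" using J(2) by (auto simp: Q_def)
    show "K = J \<or> K = carrier A" if "ideal K A" "J \<subseteq> K" "K \<subseteq> carrier A" for K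
      using max[OF that(1)] that J(2) unfolding Q_def by blast
  qed
  then have "J = m" using local by (simp add: local_ring_def)
  then show ?thesis using J(2) by (simp add: Q_def)
qed

text \<open>The chain comes from the boundary monoid of the classes of the parameters in bidegree
  \<open>(1, 0)\<close>. If this monoid contained 0, a form \<open>u\<close> would lie in
  \<open>Nx (sum_list hs) 0\<close>, and so in the step of the filtration that
  \<open>parameters_independent\<close> forbids.\<close>

lemma bgr_chain:
  assumes xs: "set xs \<subseteq> N \<inter> Ev"
    and gen: "\<And>J. \<lbrakk>ideal J A; odd_square_ideal R \<subseteq> J; set xs \<subseteq> J\<rbrakk> \<Longrightarrow> N \<inter> Ev \<subseteq> J"
    and chain: "chain_to A {} (length xs) m"
  shows "has_chain (even_ring S) {} (length xs)"
proof -
  let ?fs = "map (homog 1 0) xs"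
  have fs: "set ?fs \<subseteq> carrier (even_ring S)"
  proof
    fix f assume "f \<in> set ?fs"
    then obtain x where x: "x \<in> N \<inter> Ev" "f = homog 1 0 x" using xs by auto
    have "x \<in> Bi 1 0" using N0_mult[OF x(1) one_in_Bi] x part_closed(1) by simp
    then show "f \<in> carrier (even_ring S)" using homog_closed(2) x by (simp add: even_ring_simps)
  qed
  have nm: "N \<inter> Ev \<subseteq> m"
  proof
    fix b assume b: "b \<in> N \<inter> Ev"
    then have "b [^]\<^bsub>A\<^esub> (1::nat) \<in> N \<inter> Ev" using A.nat_pow_eone[of b] by (simp add: even_ring_simps)
    then have "b \<in> ideal_radical A (N \<inter> Ev)"
      unfolding ideal_radical_def using b by (intro CollectI conjI exI[of _ "1::nat"]) (simp_all add: even_ring_simps)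
    then show "b \<in> m" using radical by simp
  qed
  have rad: "\<exists>e::nat. b [^]\<^bsub>A\<^esub> e \<in> N \<inter> Ev" if "b \<in> m" for b
    using that radical unfolding ideal_radical_def by blast
  have "SE.boundary_monoid ?fs \<inter> {\<zero>\<^bsub>even_ring S\<^esub>} = {}"
  proof (rule ccontr)
    assume "\<not> ?thesis"
    then have "\<zero>\<^bsub>S\<^esub> \<in> SE.boundary_monoid ?fs" by (auto simp: even_ring_simps)
    then obtain hs u where hs: "length hs = length xs" "A.lead q xs hs u" "u \<in> q (sum_list hs)"
      "\<zero>\<^bsub>S\<^esub> (sum_list hs) 0 = Nx (sum_list hs) 0 +> u" using boundary_monoid_lead[OF xs] by blast
    have xm: "set xs \<subseteq> m" using xs nm by (rule order_trans)
    have "\<exists>W J. A.filtration J \<and> (\<forall>v. odd_square_ideal R \<subseteq> J v) \<and> N \<inter> Ev \<subseteq> J W \<and>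
      (\<forall>q u. (\<forall>k. q k \<subseteq> J (k * W)) \<longrightarrow> A.lead q xs hs u \<longrightarrow> u \<notin> J (Suc (sum_list hs) * W))"
      by (rule A.parameters_independent[OF prime_m prime_subset_m ideal_osq prime_contains_osq xm nm gen rad chain hs(1)])
    then obtain W J where J: "A.filtration J" "\<forall>v. odd_square_ideal R \<subseteq> J v" "N \<inter> Ev \<subseteq> J W"
      and notin: "\<And>q u. \<lbrakk>\<forall>k. q k \<subseteq> J (k * W); A.lead q xs hs u\<rbrakk> \<Longrightarrow> u \<notin> J (Suc (sum_list hs) * W)"
      by (elim exE conjE) simp_all
    have uc: "u \<in> carrier R" using hs(3) part_closed(1) by blast
    have "Nx (sum_list hs) 0 +> u = Nx (sum_list hs) 0 +> \<zero>" using hs(4) by (simp add: bgr_def Nx_coset_zero)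
    then have "u \<in> Nx (sum_list hs) 0" using Nx_coset_eq_iff[OF uc zero_closed] uc by (simp add: minus_eq)
    then have "u \<in> J (Suc (sum_list hs) * W)" using Nx_filtration[OF J(1,3)] J(2) hs(3) by blast
    moreover have "\<forall>k. q k \<subseteq> J (k * W)" using q_filtration[OF J(1,3)] by (rule allI)
    then have "u \<notin> J (Suc (sum_list hs) * W)" using notin[OF _ hs(2)] by simp
    ultimately show False by (rule notE[rotated])
  qed
  then have "has_chain (even_ring S) {\<zero>\<^bsub>even_ring S\<^esub>} (length ?fs)"
    by (rule SE.chain_of_boundary_monoid[OF SE.zeroideal fs])
  then show ?thesis using has_chain_mono[of _ _ _ "{}"] by fastforce
qed

lemma ideal_even_annihilator_S: assumes "y \<in> carrier S" shows "ideal (even_annihilator S y) (even_ring S)"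
proof (rule SE.idealI_closed)
  have c: "x \<in> carrier S" if "x \<in> even_part S" for x using that part_S_subset by blast
  show "even_annihilator S y \<subseteq> carrier (even_ring S)" by (auto simp: even_annihilator_def even_ring_simps)
  show "\<zero>\<^bsub>even_ring S\<^esub> \<in> even_annihilator S y" using assms zero_even_S by (simp add: even_annihilator_def even_ring_simps)
  show "u \<oplus>\<^bsub>even_ring S\<^esub> v \<in> even_annihilator S y" if "u \<in> even_annihilator S y" "v \<in> even_annihilator S y" for u v
    using that assms c even_S_add by (simp add: even_annihilator_def even_ring_simps S_distr)
  show "r \<otimes>\<^bsub>even_ring S\<^esub> x \<in> even_annihilator S y" if "x \<in> even_annihilator S y" "r \<in> carrier (even_ring S)" for x r
    using that assms c even_S_mult by (simp add: even_annihilator_def even_ring_simps S_mult_assoc)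
qed

lemma list_product_carrier: "set zs \<subseteq> Od \<Longrightarrow> list_product R zs \<in> carrier R"
  by (induction zs) (use part_closed in \<open>auto simp: list_product_def\<close>)

lemma Ksdim1_bgr_le:
  assumes xs: "set xs \<subseteq> Ev" and dim: "ereal (real (length xs)) = Kdim (bar_ring R)"
    and gen: "even_residue R ` (N \<inter> Ev) = Idl\<^bsub>bar_ring R\<^esub> (even_residue R ` set xs)"
  shows "Ksdim1 S \<le> Ksdim1 R"
proof -
  let ?O = "odd_square_ideal R" and ?d = "length xs"
  interpret O: ideal ?O A by (rule ideal_osq)
  interpret B: ring "bar_ring R" unfolding bar_ring_def by (rule O.quotient_is_ring)
  have res: "even_residue R = (+>\<^bsub>A\<^esub>) ?O" by (simp add: even_residue_def fun_eq_iff)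
  have carB: "carrier (bar_ring R) = even_residue R ` carrier A" unfolding bar_ring_def res by (rule A.carrier_Quot)
  have bar: "has_chain (bar_ring R) {} n \<longleftrightarrow> has_chain A ?O n" for n
    unfolding bar_ring_def by (rule A.has_chain_Quot[OF ideal_osq])
  \<comment> \<open>All primes of \<open>A\<close> contain \<open>R_1^2\<close>, so \<open>A\<close>
    has the same chains as \<open>bar_ring R\<close>.\<close>
  have chainA: "has_chain A ?O n" if ch: "has_chain A {} n" for n
  proof -
    obtain P where "chain_from A n P" using ch unfolding has_chain_from by blast
    then show ?thesis unfolding has_chain_from using prime_contains_osq chain_from_prime by blast
  qed
  have bound: "n \<le> ?d" if "has_chain A {} n" for n
  proof -
    have "ereal (real n) \<le> Kdim (bar_ring R)" using Kdim_ge_iff bar chainA[OF that] by blast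
    then show ?thesis unfolding dim[symmetric] by simp
  qed
  have resxs: "even_residue R ` set xs \<subseteq> carrier (bar_ring R)" using xs unfolding carB by (auto simp: even_ring_simps)
  \<comment> \<open>The given parameters need not lie in \<open>N\<close>; it is only known that
    their residues come from it. Elements of \<open>N\<close> with the same residues still generate
    modulo \<open>R_1^2\<close>, and they have classes in bidegree \<open>(1, 0)\<close>.\<close>
  have "\<exists>x'\<in>N \<inter> Ev. even_residue R x' = even_residue R x" if "x \<in> set xs" for x
  proof -
    have "even_residue R x \<in> even_residue R ` (N \<inter> Ev)" unfolding gen using B.genideal_self[OF resxs] that by blast
    then show ?thesis by (metis imageE)
  qed
  then obtain g where g: "\<And>x. x \<in> set xs \<Longrightarrow> g x \<in> N \<inter> Ev \<and> even_residue R (g x) = even_residue R x" by metis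
  define xs' where "xs' = map g xs"
  have res': "even_residue R ` set xs' = even_residue R ` set xs" using g by (auto simp: xs'_def image_iff)
  have gen': "N \<inter> Ev \<subseteq> J" if J: "ideal J A" "?O \<subseteq> J" "set xs' \<subseteq> J" for J
  proof
    fix b assume b: "b \<in> N \<inter> Ev"
    have "ideal (even_residue R ` J) (bar_ring R)"
      unfolding bar_ring_def res using A.ring_ideal_imp_quot_ideal[OF ideal_osq J(1)] by simp
    then have "Idl\<^bsub>bar_ring R\<^esub> (even_residue R ` set xs) \<subseteq> even_residue R ` J"
      using J(3) unfolding res'[symmetric] by (intro B.genideal_minimal) auto
    then have "even_residue R b \<in> even_residue R ` J" using b gen by blast
    then show "b \<in> J" unfolding res using A.prime_Quot(3)[OF ideal_osq J(1,2)] b by (simp add: even_ring_simps)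
  qed
  have "has_chain A ?O ?d" using Kdim_ge_iff[of ?d "bar_ring R"] dim bar by simp
  then obtain Q where Q: "prime_chain A ?d Q" unfolding has_chain_def by blast
  have to: "chain_to A {} ?d (Q ?d)" using has_chain_imp_to[OF Q] by blast
  \<comment> \<open>If the chain stops below \<open>m\<close>, then \<open>m\<close> is put on top
    of it; inserting \<open>\<zero>\<close> serves to shorten the result by one again.\<close>
  have "chain_to A {} ?d m"
  proof (cases "Q ?d = m")
    case False
    then have "chain_to A {} (Suc ?d) m" using to prime_m prime_subset_m[OF chain_to_prime[OF to]] by auto
    then have "chain_to A (insert \<zero>\<^bsub>A\<^esub> {}) ?d m"
      using A.chain_to_insert[of "{}" ?d m "\<zero>\<^bsub>A\<^esub>"] A.idealD(2)[OF primeideal.axioms(1)[OF prime_m]] by blast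
    then show ?thesis using chain_to_mono by blast
  qed (use to in simp)
  then have chS: "has_chain (even_ring S) {} ?d"
    using bgr_chain[of xs'] g gen' by (auto simp: xs'_def)
  show ?thesis
    unfolding Ksdim1_def[of S]
  proof (rule Sup_least)
    fix s assume "s \<in> {enat (length ys) | ys. odd_parameters S ys}"
    then obtain ys where ys: "s = enat (length ys)" "ys \<noteq> []" "set ys \<subseteq> odd_part S"
      "Kdim (even_ring S Quot even_annihilator S (list_product S ys)) = Kdim (even_ring S)"
      unfolding odd_parameters_def by blast
    have yc: "list_product S ys \<in> carrier S" using osum_carrier[OF list_product_osum[OF ys(3)]] .
    \<comment> \<open>A lower bound for the dimension of the even ring of \<open>S\<close> is
      enough: the quotient by the annihilator has the same dimension, so some chain of length
      \<open>?d\<close> lies above the annihilator.\<close>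
    have "ereal (real ?d) \<le> Kdim (even_ring S Quot even_annihilator S (list_product S ys))"
      unfolding ys(4) using Kdim_ge_iff chS by blast
    then have "has_chain (even_ring S) (even_annihilator S (list_product S ys)) ?d"
      using Kdim_ge_iff SE.has_chain_Quot[OF ideal_even_annihilator_S[OF yc]] by blast
    then obtain zs where zs: "length zs = length ys" "set zs \<subseteq> Od"
      "has_chain A (even_annihilator R (list_product R zs)) ?d" using chain_lift[OF ys(3)] by blast
    let ?I = "even_annihilator R (list_product R zs)"
    have quot: "has_chain (A Quot ?I) {} n \<longleftrightarrow> has_chain A ?I n" for n
      using A.has_chain_Quot[OF ideal_even_annihilator[OF list_product_carrier[OF zs(2)]]] .
    have empty: "has_chain A {} n" if "has_chain A I n" for I n using has_chain_mono[OF that] by simp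
    \<comment> \<open>In \<open>A\<close> no chain is longer than \<open>?d\<close>, so the chain of
      length \<open>?d\<close> above the annihilator forces both dimensions to equal
      \<open>?d\<close>.\<close>
    have "Kdim A = ereal (real ?d)"
      using Kdim_le[of A ?d] bound Kdim_ge_iff[of ?d A] empty[OF zs(3)] by (intro antisym) auto
    moreover have "Kdim (A Quot ?I) = ereal (real ?d)"
      using Kdim_le[of "A Quot ?I" ?d] bound empty quot Kdim_ge_iff[of ?d "A Quot ?I"] zs(3) by (intro antisym) auto
    ultimately have "odd_parameters R zs" unfolding odd_parameters_def using zs ys(2) by auto
    then show "s \<le> Ksdim1 R" unfolding Ksdim1_def ys(1) zs(1)[symmetric] by (intro Sup_upper) blast
  qed
qed

end

theorem proposition6p7:
  fixes R :: "('a, 'b) super_ring_scheme"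
    and M N :: "'a set"
    and xs :: "'a list"
  assumes "local_super_ring R M"
    and "noetherian_super_ring R"
    and "\<exists>K. subfield K R"
    and "primary_superideal R M N"
    and "set xs \<subseteq> even_part R"
    and "system_of_parameters (bar_ring R) (even_residue R ` (M \<inter> even_part R))
           (map (even_residue R) xs)"
    and "even_residue R ` (N \<inter> even_part R) =
           Idl\<^bsub>bar_ring R\<^esub> (even_residue R ` set xs)"
  shows "Ksdim1 (bgr R N) \<le> Ksdim1 R"
proof -
  interpret super_ring R using assms(1) by (simp add: local_super_ring_def)
  obtain m where m: "local_ring (even_ring R) m" "M = m <+>\<^bsub>R\<^esub> odd_part R"
    using assms(1) by (auto simp: local_super_ring_def)
  have "ideal m (even_ring R)" using m(1) maximalideal.axioms(1) by (auto simp: local_ring_def)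
  then have mE: "m \<subseteq> even_part R" using ideal.Icarr by (fastforce simp: even_ring_simps)
  \<comment> \<open>\<open>M\<close> is given as the sum of \<open>m\<close> and the odd part;
    uniqueness of components recovers \<open>m\<close> from it.\<close>
  have "M \<inter> even_part R = m"
  proof
    show "M \<inter> even_part R \<subseteq> m"
    proof
      fix x assume x: "x \<in> M \<inter> even_part R"
      then obtain a b where ab: "a \<in> m" "b \<in> odd_part R" "x = a \<oplus>\<^bsub>R\<^esub> b"
        unfolding m(2) set_add_def' by auto
      then have "x = a" using even_component_unique[of x a b] mE x by auto
      then show "x \<in> m" using ab(1) by simp
    qed
    show "m \<subseteq> M \<inter> even_part R"
    proof
      fix x assume "x \<in> m"
      moreover from this have "x = x \<oplus>\<^bsub>R\<^esub> \<zero>\<^bsub>R\<^esub>" using mE part_closed(1) by auto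
      ultimately show "x \<in> M \<inter> even_part R" using mE part_closed(4) unfolding m(2) set_add_def' by blast
    qed
  qed
  then interpret local_super_ring_ideal R N m
    using assms(2,4) m(1) by unfold_locales (simp_all add: primary_superideal_def primary_to_def)
  show ?thesis
    using Ksdim1_bgr_le assms(5-7) by (simp add: system_of_parameters_def)
qed

end
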